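(* Let $p\in(1,\infty)$, $s\in(0,1)$, $N>p$. Then the problem $$-\Delta_p u+(-\Delta_p)^s u=|u|^{p^*-2}u\text{ in }\mathbb{R}^N$$ does not admit any nontrivial weak solution in $\mathcal{W}_p\cap L^p(\mathbb{R}^N)$.
   Context: $p^*=\frac{Np}{N-p}$. $[u]_{s,p}=\left(\iint_{\mathbb{R}^{2N}}\frac{|u(x)-u(y)|^p}{|x-y|^{N+sp}}dx\,dy\right)^{1/p}$. $\mathcal{W}_p$ is the completion of $C_c^\infty(\mathbb{R}^N)$ with respect to $\rho_p(u)=\|\nabla u\|_{L^p}+[u]_{s,p}$, equivalently $\{u\in L^{p^*}(\mathbb{R}^N):\|\nabla u\|_p+[u]_{s,p}<\infty\}$. A weak solution is $u\in\mathcal{W}_p$ such that for all $v\in\mathcal{W}_p$: $\int|\nabla u|^{p-2}\nabla u\cdot\nabla v\,dx+\iint_{\mathbb{R}^{2N}}\frac{|u(x)-u(y)|^{p-2}(u(x)-u(y))(v(x)-v(y))}{|x-y|^{N+sp}}dx\,dy=\int|u|^{p^*-2}uv\,dx$. *)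

theory Defs
  imports "HOL-Analysis.Analysis"
begin

primrec Ck :: "nat \<Rightarrow> ('a::euclidean_space \<Rightarrow> real) \<Rightarrow> bool" where
  "Ck 0 f = continuous_on UNIV f"
| "Ck (Suc k) f = ((\<forall>x. f differentiable (at x)) \<and>
                   (\<forall>v. Ck k (\<lambda>x. frechet_derivative f (at x) v)))"

definition test_fun :: "('a::euclidean_space \<Rightarrow> real) \<Rightarrow> bool" where
  "test_fun \<phi> \<longleftrightarrow> (\<forall>k. Ck k \<phi>) \<and> compact (closure {x. \<phi> x \<noteq> 0})"

definition loc_integrable :: "('a::euclidean_space \<Rightarrow> 'b::{banach,second_countable_topology}) \<Rightarrow> bool" where
  "loc_integrable f \<longleftrightarrow> f \<in> borel_measurable lborel \<and>
     (\<forall>K. compact K \<longrightarrow> set_integrable lborel K f)"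

definition weak_gradient :: "('a::euclidean_space \<Rightarrow> real) \<Rightarrow> ('a \<Rightarrow> 'a) \<Rightarrow> bool" where
  "weak_gradient u g \<longleftrightarrow> loc_integrable u \<and> loc_integrable g \<and>
     (\<forall>\<phi> i. test_fun \<phi> \<longrightarrow> i \<in> Basis \<longrightarrow>
        (\<integral>x. u x * frechet_derivative \<phi> (at x) i \<partial>lborel) = - (\<integral>x. (g x \<bullet> i) * \<phi> x \<partial>lborel))"

definition in_Lp :: "real \<Rightarrow> ('a::euclidean_space \<Rightarrow> real) \<Rightarrow> bool" where
  "in_Lp p u \<longleftrightarrow> u \<in> borel_measurable lborel \<and> integrable lborel (\<lambda>x. \<bar>u x\<bar> powr p)"

definition crit_exp :: "'a::euclidean_space itself \<Rightarrow> real \<Rightarrow> real" where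
  "crit_exp TYPE('a) p = real DIM('a) * p / (real DIM('a) - p)"

definition gagliardo_integrand :: "real \<Rightarrow> real \<Rightarrow> ('a::euclidean_space \<Rightarrow> real) \<Rightarrow> 'a \<times> 'a \<Rightarrow> real" where
  "gagliardo_integrand s p u = (\<lambda>(x,y). \<bar>u x - u y\<bar> powr p / norm (x - y) powr (real DIM('a) + s * p))"

definition W_space :: "real \<Rightarrow> real \<Rightarrow> ('a::euclidean_space \<Rightarrow> real) set" where
  "W_space s p = {u. in_Lp (crit_exp TYPE('a) p) u \<and>
      (\<exists>g. weak_gradient u g \<and> integrable lborel (\<lambda>x. norm (g x) powr p)) \<and>
      gagliardo_integrand s p u \<in> borel_measurable (lborel \<Otimes>\<^sub>M lborel) \<and>
      integrable (lborel \<Otimes>\<^sub>M lborel) (gagliardo_integrand s p u)}"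

definition weak_solution :: "real \<Rightarrow> real \<Rightarrow> ('a::euclidean_space \<Rightarrow> real) \<Rightarrow> bool" where
  "weak_solution s p u \<longleftrightarrow> u \<in> W_space s p \<and>
     (\<forall>g v h. weak_gradient u g \<longrightarrow> v \<in> W_space s p \<longrightarrow> weak_gradient v h \<longrightarrow>
        (\<integral>x. norm (g x) powr (p - 2) * (g x \<bullet> h x) \<partial>lborel)
        + (\<integral>z. (case z of (x,y) \<Rightarrow>
              \<bar>u x - u y\<bar> powr (p - 2) * (u x - u y) * (v x - v y)
                / norm (x - y) powr (real DIM('a) + s * p)) \<partial>(lborel \<Otimes>\<^sub>M lborel))
        = (\<integral>x. \<bar>u x\<bar> powr (crit_exp TYPE('a) p - 2) * u x * v x \<partial>lborel))"

end

theory Submission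
  imports Defs
begin

text \<open>
  A Pohozaev argument that needs no pointwise regularity of the solution \<open>u\<close>. The equation is tested
  with \<open>u \<circ> \<Phi> - u\<close>, where \<open>\<Phi>\<close> is a small deformation of one coordinate along the bounded field
  \<open>sin (\<epsilon> x\<^sub>i) / \<epsilon>\<close>, an approximation of the dilation field that avoids cutoffs at infinity. By
  Young's inequality (convexity) the gradient term and the Gagliardo term are at most the differences of
  the corresponding energies, and these differences are computed to first order by changing variables.
  The critical term is compared with the difference of the \<open>L\<^sup>q\<close> norms, where \<open>q\<close> is the critical exponent;
  the error is of higher order in the size \<open>t\<close> of the deformation, because \<open>u \<circ> \<Phi> - u\<close> is of order \<open>t\<close> in
  \<open>L\<^sup>p\<close> and \<open>u\<close> lies in every \<open>L\<^sup>r\<close> with \<open>r \<ge> q\<close>. Letting \<open>t\<close> and then \<open>\<epsilon>\<close> tend to \<open>0\<close> and summing over the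
  coordinates, the terms at the critical scaling cancel and what remains is \<open>(1 - s) p [u]\<^sup>p \<le> 0\<close>, so \<open>u\<close> is
  constant.

  The higher integrability comes from testing with truncations of \<open>u\<close> between consecutive dyadic levels, for
  which the nonlocal term is nonnegative by monotonicity: the tails of \<open>\<integral>\<bar>u\<bar>\<^sup>q\<close> over the sets \<open>\<bar>u\<bar> > 2\<^sup>k\<close>
  then decay faster than any geometric sequence.
\<close>

section \<open>Smooth test functions and the fundamental lemma\<close>

text \<open>Weak gradients are given only through test functions, while the solution is tested with
  compositions. Absolute continuity on almost every line, with the value at the base point built in,
  is stable under both kinds of composition: a C^1 function on the left, and on the right a map
  carrying coordinate lines to coordinate lines. Hence one coordinate is deformed at a time, and the
  change of variables is one-dimensional too.

  The obstacle is the critical term, which needs a lower bound: convexity at \<open>u\<close> gives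
  an upper one. Convexity at the deformed function has the right sign, and the exchange costs a
  remainder of order t^m that must be o(t). So 1 < m < p, and the Young exponent p / (p - m) on the
  other factor asks for more than L^q.

  The fields sin(eps r) / eps are 1-Lipschitz for every eps, which gives domination as eps tends to
  0, but their bound 1 / eps enters the remainder. So \<open>t\<close> goes to 0 first.

  With their weights 1/p and 1/q the gradient and critical energies decrease at the common rate (N -
  p) / p under dilation, the nonlocal energy at the faster rate (N - s p) / p. A one-sided
  inequality therefore decides.\<close>

definition bump_aux :: "nat \<Rightarrow> real \<Rightarrow> real" where
  "bump_aux n r = (if r > 0 then exp (- 1 / r) / r ^ n else 0)"

text \<open>The powers of \<open>r\<close> in the denominator are there for this: differentiation
  only combines members with larger \<open>n\<close>, so one family contains all derivatives of
  exp(-1/r).\<close>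

lemma bump_aux_has_derivative:
  "(bump_aux n has_real_derivative bump_aux (n + 2) r - real n * bump_aux (n + 1) r) (at r)"
proof -
  consider "r < 0" | "r = 0" | "r > 0" by linarith
  then show ?thesis
  proof cases
    case 1
    have "((\<lambda>_. 0) has_real_derivative 0) (at r)" by simp
    then have "(bump_aux n has_real_derivative 0) (at r)"
      by (rule has_field_derivative_transform_within[where d = "- r"])
         (use 1 in \<open>auto simp: bump_aux_def dist_real_def\<close>)
    with 1 show ?thesis by (simp add: bump_aux_def)
  next
    case 2
    have "((\<lambda>h. bump_aux n h / h) \<longlongrightarrow> 0) (at_right 0)"
    proof -
      \<comment> \<open>With h = 1/x the difference quotient at 0 becomes x^(n+1) exp(-x), which
        tends to 0 as \<open>x\<close> grows.\<close>
      have "((\<lambda>h. bump_aux n (inverse h) / inverse h) \<longlongrightarrow> 0) at_top"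
      proof (rule Lim_transform_eventually[OF tendsto_power_div_exp_0[of "Suc n"]])
        show "\<forall>\<^sub>F x::real in at_top. x ^ Suc n / exp x = bump_aux n (inverse x) / inverse x"
          using eventually_gt_at_top[of 0]
          by eventually_elim (auto simp: bump_aux_def field_simps exp_minus)
      qed
      then show ?thesis by (simp add: filterlim_at_right_to_top)
    qed
    moreover have "((\<lambda>h. bump_aux n h / h) \<longlongrightarrow> 0) (at_left 0)"
    proof (rule Lim_transform_eventually[OF tendsto_const[of "0::real"]])
      show "\<forall>\<^sub>F h in at_left (0::real). 0 = bump_aux n h / h"
        by (auto simp: bump_aux_def eventually_at_left_field intro!: exI[of _ "-1"])
    qed
    ultimately have "((\<lambda>h. bump_aux n h / h) \<longlongrightarrow> 0) (at 0)"
      by (simp add: filterlim_split_at)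
    then show ?thesis using 2 by (simp add: has_field_derivative_iff bump_aux_def)
  next
    case 3
    have "((\<lambda>r. exp (- 1 / r) / r ^ n) has_real_derivative bump_aux (n + 2) r - real n * bump_aux (n + 1) r) (at r)"
    proof -
      have "real n * r ^ (n - 1) = real n * r ^ n / r" using 3 by (cases n) auto
      moreover have "((\<lambda>r. exp (- 1 / r) / r ^ n) has_real_derivative
          (exp (- 1 / r) * (1 / r\<^sup>2) * r ^ n - exp (- 1 / r) * (real n * r ^ (n - 1))) / (r ^ n * r ^ n)) (at r)"
        using 3 by (auto intro!: derivative_eq_intros simp: power2_eq_square)
      moreover have "(exp (- 1 / r) * (1 / r\<^sup>2) * r ^ n - exp (- 1 / r) * (real n * r ^ n / r)) / (r ^ n * r ^ n)
          = bump_aux (n + 2) r - real n * bump_aux (n + 1) r"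
        using 3 by (simp add: bump_aux_def field_simps power2_eq_square)
      ultimately show ?thesis by simp
        qed
    then show ?thesis
      by (rule has_field_derivative_transform_within[OF _ 3]) (use 3 in \<open>auto simp: bump_aux_def dist_real_def\<close>)
  qed
qed

text \<open>An induction on \<open>k\<close> in \<open>Ck\<close> must pass to directional
  derivatives, so it runs over a class of expressions closed under them rather than over the test
  functions alone.\<close>

inductive bump_class :: "('a::euclidean_space \<Rightarrow> real) \<Rightarrow> bool" where
  const: "bump_class (\<lambda>_. c)"
| inner: "bump_class (\<lambda>x. x \<bullet> v)"
| add: "bump_class f \<Longrightarrow> bump_class g \<Longrightarrow> bump_class (\<lambda>x. f x + g x)"
| mult: "bump_class f \<Longrightarrow> bump_class g \<Longrightarrow> bump_class (\<lambda>x. f x * g x)"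
| bump: "bump_class f \<Longrightarrow> bump_class (\<lambda>x. bump_aux n (f x))"

lemma bump_class_derivative:
  assumes "bump_class f"
  shows "\<exists>f'. (\<forall>x. (f has_derivative f' x) (at x)) \<and> (\<forall>v. bump_class (\<lambda>x. f' x v))"
  using assms
proof induction
  case (const c)
  show ?case by (rule exI[of _ "\<lambda>_ _. 0"]) (auto intro: bump_class.const)
next
  case (inner w)
  show ?case by (rule exI[of _ "\<lambda>_ v. v \<bullet> w"]) (auto intro!: bump_class.const derivative_eq_intros)
next
  case (add f g)
  then obtain f' g' where "\<forall>x. (f has_derivative f' x) (at x)" "\<forall>v. bump_class (\<lambda>x. f' x v)"
    "\<forall>x. (g has_derivative g' x) (at x)" "\<forall>v. bump_class (\<lambda>x. g' x v)" by metis
  then show ?case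
    by (intro exI[of _ "\<lambda>x v. f' x v + g' x v"]) (auto intro!: bump_class.add derivative_eq_intros)
next
  case (mult f g)
  then obtain f' g' where "\<forall>x. (f has_derivative f' x) (at x)" "\<forall>v. bump_class (\<lambda>x. f' x v)"
    "\<forall>x. (g has_derivative g' x) (at x)" "\<forall>v. bump_class (\<lambda>x. g' x v)" by metis
  then show ?case using mult.hyps
    by (intro exI[of _ "\<lambda>x v. f x * g' x v + f' x v * g x"])
       (auto intro!: bump_class.add bump_class.mult derivative_eq_intros)
next
  case (bump f n)
  then obtain f' where f': "\<forall>x. (f has_derivative f' x) (at x)" "\<forall>v. bump_class (\<lambda>x. f' x v)" by metis
  let ?d = "\<lambda>x v. (bump_aux (n + 2) (f x) + (- real n) * bump_aux (n + 1) (f x)) * f' x v"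
  have "((\<lambda>x. bump_aux n (f x)) has_derivative ?d x) (at x)" for x
    using has_derivative_compose[OF f'(1)[rule_format, of x]
        bump_aux_has_derivative[of n "f x", unfolded has_field_derivative_def]]
    by simp
  moreover have "bump_class (\<lambda>x. ?d x v)" for v
    using f' bump.hyps by (intro bump_class.intros) auto
  ultimately show ?case by (intro exI[of _ ?d]) auto
qed

lemma bump_class_Ck: "bump_class f \<Longrightarrow> Ck k f"
proof (induction k arbitrary: f)
  case 0
  obtain f' where "\<And>x. (f has_derivative f' x) (at x)"
    using bump_class_derivative[OF 0] by metis
  then show ?case
    by (auto intro!: continuous_at_imp_continuous_on intro: has_derivative_continuous)
next
  case (Suc k)
  obtain f' where f': "\<And>x. (f has_derivative f' x) (at x)" "\<And>v. bump_class (\<lambda>x. f' x v)"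
    using bump_class_derivative[OF Suc.prems] by metis
  have "frechet_derivative f (at x) = f' x" for x
    using frechet_derivative_at[OF f'(1)] by simp
  moreover have "f differentiable (at x)" for x
    using f'(1) by (rule differentiableI)
  ultimately show ?case using f'(2) Suc.IH by simp
qed

text \<open>A product of one-dimensional bumps: in each coordinate the argument is positive exactly
  between \<open>a\<close> and \<open>b\<close>. The factor \<open>Suc n\<close> drives exp(-1/r) to
  1 inside, so the sequence approximates the indicator of the open box by test functions.\<close>

definition box_test :: "'a::euclidean_space \<Rightarrow> 'a \<Rightarrow> nat \<Rightarrow> 'a \<Rightarrow> real" where
  "box_test a b n x = (\<Prod>i\<in>Basis. bump_aux 0 (real (Suc n) * ((b - x) \<bullet> i * ((x - a) \<bullet> i))))"

lemma bump_class_prod: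
  "finite I \<Longrightarrow> (\<And>i. i \<in> I \<Longrightarrow> bump_class (f i)) \<Longrightarrow> bump_class (\<lambda>x. \<Prod>i\<in>I. f i x)"
  by (induction I rule: finite_induct) (auto intro: bump_class.intros)

lemma box_test_class: "bump_class (box_test a b n)"
proof -
  have "bump_class (\<lambda>x. bump_aux 0 (real (Suc n) * ((b \<bullet> i + (-1) * (x \<bullet> i)) * (x \<bullet> i + - (a \<bullet> i)))))" for i
    by (intro bump_class.intros)
  then show ?thesis unfolding box_test_def[abs_def]
    by (intro bump_class_prod) (auto simp: inner_diff_left)
qed

lemma box_test_eq_0:
  assumes "\<And>i. i \<in> Basis \<Longrightarrow> a \<bullet> i < b \<bullet> i" "x \<notin> box a b"
  shows "box_test a b n x = 0"
proof -
  obtain i where i: "i \<in> Basis" "\<not> (a \<bullet> i < x \<bullet> i \<and> x \<bullet> i < b \<bullet> i)" using assms by (auto simp: mem_box)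
  then have "(b - x) \<bullet> i * ((x - a) \<bullet> i) \<le> 0"
    using assms(1)[OF i(1)] by (auto simp: inner_diff_left mult_le_0_iff not_less)
  then have "bump_aux 0 (real (Suc n) * ((b - x) \<bullet> i * ((x - a) \<bullet> i))) = 0"
    unfolding bump_aux_def by (smt (verit) mult_nonneg_nonpos of_nat_0_le_iff)
  then show ?thesis using i(1) unfolding box_test_def by (metis (mono_tags, lifting) finite_Basis prod_zero)
qed

lemma test_fun_box_test:
  assumes "\<And>i. i \<in> Basis \<Longrightarrow> a \<bullet> i < b \<bullet> i"
  shows "test_fun (box_test a b n)"
  unfolding test_fun_def
proof
  show "\<forall>k. Ck k (box_test a b n)" using bump_class_Ck box_test_class by blast
  have "{x. box_test a b n x \<noteq> 0} \<subseteq> cbox a b"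
    using box_test_eq_0[OF assms] box_subset_cbox by blast
  then have "closure {x. box_test a b n x \<noteq> 0} \<subseteq> cbox a b" by (rule closure_minimal) (rule closed_cbox)
  then show "compact (closure {x. box_test a b n x \<noteq> 0})"
    by (metis bounded_cbox bounded_subset compact_cbox compact_closure \<open>{x. box_test a b n x \<noteq> 0} \<subseteq> cbox a b\<close>)
qed

lemma bump_aux_0_bounds: "0 \<le> bump_aux 0 r" "bump_aux 0 r \<le> 1"
  by (auto simp: bump_aux_def)

lemma box_test_bounds: "0 \<le> box_test a b n x" "box_test a b n x \<le> 1"
  unfolding box_test_def by (auto intro!: prod_nonneg prod_le_1 simp: bump_aux_0_bounds)

lemma box_test_tendsto:
  assumes "\<And>i. i \<in> Basis \<Longrightarrow> a \<bullet> i < b \<bullet> i"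
  shows "(\<lambda>n. box_test a b n x) \<longlonglongrightarrow> indicator (box a b) x"
proof (cases "x \<in> box a b")
  case False
  then show ?thesis using box_test_eq_0[OF assms False] by simp
next
  case True
  have "(\<lambda>n. bump_aux 0 (real (Suc n) * r)) \<longlonglongrightarrow> 1" if "r > 0" for r
  proof -
    have "(\<lambda>n. exp (- (inverse (real (Suc n)) / r))) \<longlonglongrightarrow> exp (- (0 / r))"
      by (intro tendsto_intros LIMSEQ_inverse_real_of_nat) (use that in auto)
    then show ?thesis using that by (simp add: bump_aux_def divide_simps)
  qed
  then have "(\<lambda>n. box_test a b n x) \<longlonglongrightarrow> (\<Prod>i\<in>(Basis::'a set). 1)"
    unfolding box_test_def using True
    by (intro tendsto_prod) (auto simp: mem_box inner_diff_left)
  with True show ?thesis by simp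
qed

lemma box_test_continuous: "continuous_on UNIV (box_test a b n)"
  using bump_class_Ck[OF box_test_class, of 0] by simp

lemma box_test_measurable [measurable]: "box_test a b n \<in> borel_measurable borel"
  using box_test_continuous by (rule borel_measurable_continuous_onI)

section \<open>The fundamental lemma of the calculus of variations\<close>

lemma loc_integrable_cbox:
  assumes "loc_integrable f" shows "integrable lborel (\<lambda>x. indicator (cbox a b) x *\<^sub>R f x)"
  using assms unfolding loc_integrable_def set_integrable_def by (meson compact_cbox)

lemma loc_integrable_box:
  fixes f :: "'a::euclidean_space \<Rightarrow> 'b::{banach,second_countable_topology}"
  assumes "loc_integrable f" shows "set_integrable lborel (box a b) f"
  using assms box_subset_cbox[of a b] unfolding loc_integrable_def
  by (metis compact_cbox set_integrable_subset borel_open open_box sets_lborel)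

lemma test_integral_zero_box:
  fixes f :: "'a::euclidean_space \<Rightarrow> real"
  assumes f: "loc_integrable f" and 0: "\<And>\<phi>. test_fun \<phi> \<Longrightarrow> (\<integral>x. f x * \<phi> x \<partial>lborel) = 0"
  shows "(\<integral>x. indicator (box a b) x *\<^sub>R f x \<partial>lborel) = 0"
proof (cases "\<forall>i\<in>Basis. a \<bullet> i < b \<bullet> i")
  case False
  then have "box a b = {}" by (auto simp: box_eq_empty not_less)
  then show ?thesis by simp
next
  case True
  have [measurable]: "f \<in> borel_measurable borel" using f by (simp add: loc_integrable_def)
  have "(\<lambda>n. \<integral>x. f x * box_test a b n x \<partial>lborel) \<longlonglongrightarrow> (\<integral>x. f x * indicator (box a b) x \<partial>lborel)"
  proof (rule integral_dominated_convergence)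
    show "integrable lborel (\<lambda>x. norm (indicator (cbox a b) x *\<^sub>R f x))"
      using loc_integrable_cbox[OF f] by (rule integrable_norm)
    show "AE x in lborel. (\<lambda>n. f x * box_test a b n x) \<longlonglongrightarrow> f x * indicator (box a b) x"
      by (intro AE_I2 tendsto_intros box_test_tendsto) (use True in auto)
    show "AE x in lborel. norm (f x * box_test a b n x) \<le> norm (indicator (cbox a b) x *\<^sub>R f x)" for n
    proof (rule AE_I2)
      fix x
      show "norm (f x * box_test a b n x) \<le> norm (indicator (cbox a b) x *\<^sub>R f x)"
        using box_test_bounds[of a b n x] box_test_eq_0[of a b x n] True box_subset_cbox[of a b]
        by (cases "x \<in> cbox a b"; cases "x \<in> box a b") (auto simp: abs_mult mult_left_le)
    qed
  qed auto
  moreover have "(\<integral>x. f x * box_test a b n x \<partial>lborel) = 0" for n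
    using True by (intro 0 test_fun_box_test) auto
  ultimately show ?thesis by (simp add: LIMSEQ_const_iff mult.commute)
qed

text \<open>Boxes are stable under intersection and generate the Borel sets, so a Dynkin argument
  carries the vanishing to every Borel set, and densities with equal integrals agree almost
  everywhere.\<close>

lemma integrable_box_zero_imp_AE_zero:
  fixes f :: "'a::euclidean_space \<Rightarrow> real"
  assumes f: "integrable lborel f" and 0: "\<And>a b. (\<integral>x. indicator (box a b) x *\<^sub>R f x \<partial>lborel) = 0"
  shows "AE x in lborel. f x = 0"
proof (rule density_unique_real[OF f])
  show "integrable lborel (\<lambda>_::'a. 0::real)" by simp
  have int: "set_integrable lborel A f" if "A \<in> sets lborel" for A
    using f that unfolding set_integrable_def by (intro integrable_mult_indicator)
  let ?E = "range (\<lambda>(a, b). box a b::'a set)"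
  have Int_stable: "Int_stable ?E"
    by (auto simp: Int_stable_def box_Int_box)
  have E: "?E \<subseteq> Pow UNIV" by simp
  have sets: "sets lborel = sigma_sets UNIV ?E"
    by (subst sets_lborel, subst borel_eq_box) auto
  \<comment> \<open>The complement case of the induction needs the integral over the whole space; it
    is the limit over growing centred boxes.\<close>
  have U: "set_lebesgue_integral lborel UNIV f = 0"
  proof -
    have "(\<lambda>n. \<integral>x. indicator (box (- (real n *\<^sub>R One)) (real n *\<^sub>R One)) x *\<^sub>R f x \<partial>lborel) \<longlonglongrightarrow> (\<integral>x. f x \<partial>lborel)"
    proof (rule integral_dominated_convergence)
      show "integrable lborel (\<lambda>x. norm (f x))" using f by simp
      show "AE x in lborel. (\<lambda>n. indicator (box (- (real n *\<^sub>R One)) (real n *\<^sub>R One)) x *\<^sub>R f x) \<longlonglongrightarrow> f x"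
      proof (rule AE_I2)
        fix x :: 'a
        obtain m where m: "norm x < real m" using reals_Archimedean2 by blast
        have "x \<in> box (- (real n *\<^sub>R One)) (real n *\<^sub>R One)" if "n \<ge> m" for n
          unfolding mem_box
        proof
          fix i :: 'a assume "i \<in> Basis"
          then have "\<bar>x \<bullet> i\<bar> < real n" using Basis_le_norm[of i x] m that by auto
          then show "- (real n *\<^sub>R One) \<bullet> i < x \<bullet> i \<and> x \<bullet> i < real n *\<^sub>R One \<bullet> i" using \<open>i \<in> Basis\<close> by auto
        qed
        then have "\<forall>\<^sub>F n in sequentially. indicator (box (- (real n *\<^sub>R One)) (real n *\<^sub>R One)) x *\<^sub>R f x = f x"
          by (intro eventually_sequentiallyI[of m]) auto
        then show "(\<lambda>n. indicator (box (- (real n *\<^sub>R One)) (real n *\<^sub>R One)) x *\<^sub>R f x) \<longlonglongrightarrow> f x"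
          by (rule tendsto_eventually)
      qed
    qed (use f in \<open>auto split: split_indicator\<close>)
    then show ?thesis unfolding 0 by (simp add: LIMSEQ_const_iff set_lebesgue_integral_def)
  qed
  fix A :: "'a set" assume "A \<in> sets lborel"
  then have "A \<in> sigma_sets UNIV ?E" using sets by simp
  from Int_stable E this have "set_lebesgue_integral lborel A f = 0"
  proof (induction rule: sigma_sets_induct_disjoint)
    case (basic A)
    then show ?case using 0 by (auto simp: set_lebesgue_integral_def)
  next
    case empty
    then show ?case by (simp add: set_lebesgue_integral_def)
  next
    case (compl A)
    then have A: "A \<in> sets lborel" by (subst sets)
    then have "UNIV - A \<in> sets lborel" by (metis sets.compl_sets space_lborel space_borel)
    with A have "set_lebesgue_integral lborel (A \<union> (UNIV - A)) f =
       set_lebesgue_integral lborel A f + set_lebesgue_integral lborel (UNIV - A) f"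
      by (intro set_integral_Un int) auto
    with compl U show ?case by simp
  next
    case (union A)
    then have "range A \<subseteq> sets lborel" using sets by simp
    then have "set_lebesgue_integral lborel (\<Union>i. A i) f = (\<Sum>i. set_lebesgue_integral lborel (A i) f)"
      using union(1) int by (intro lebesgue_integral_countable_add) (auto simp: disjoint_family_on_def)
    then show ?case using union by simp
  qed
  then show "set_lebesgue_integral lborel A f = (LINT x:A|lborel. 0)"
    by (simp add: set_lebesgue_integral_def)
qed

text \<open>\<open>f\<close> is only locally integrable, so it is first cut off to centred boxes.
  The intersection of two boxes is again a box, which preserves the hypothesis of the integrable
  case.\<close>

lemma test_integral_zero_imp_AE_zero:
  fixes f :: "'a::euclidean_space \<Rightarrow> real"
  assumes f: "loc_integrable f" and 0: "\<And>\<phi>. test_fun \<phi> \<Longrightarrow> (\<integral>x. f x * \<phi> x \<partial>lborel) = 0"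
  shows "AE x in lborel. f x = 0"
proof -
  let ?B = "\<lambda>n::nat. box (- (real n *\<^sub>R One)) (real n *\<^sub>R One) :: 'a set"
  have "AE x in lborel. indicator (?B n) x *\<^sub>R f x = 0" for n
  proof (rule integrable_box_zero_imp_AE_zero)
    show "integrable lborel (\<lambda>x. indicator (?B n) x *\<^sub>R f x)"
      using loc_integrable_box[OF f] by (simp add: set_integrable_def)
    fix a b :: 'a
    obtain c d :: 'a where "box a b \<inter> ?B n = box c d" using box_Int_box by blast
    moreover have "(\<lambda>x. indicator (box a b) x *\<^sub>R indicator (?B n) x *\<^sub>R f x) = (\<lambda>x. indicator (box a b \<inter> ?B n) x *\<^sub>R f x)"
      by (auto split: split_indicator)
    ultimately show "(\<integral>x. indicator (box a b) x *\<^sub>R indicator (?B n) x *\<^sub>R f x \<partial>lborel) = 0"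
      using test_integral_zero_box[OF f 0, of c d] by (simp only:)
  qed
  then have "AE x in lborel. \<forall>n. indicator (?B n) x *\<^sub>R f x = 0"
    by (subst AE_all_countable) (rule allI)
  then show ?thesis
  proof eventually_elim
    case (elim x)
    obtain m where m: "norm x < real m" using reals_Archimedean2 by blast
    have "x \<in> ?B m"
      unfolding mem_box
    proof
      fix i :: 'a assume "i \<in> Basis"
      then have "\<bar>x \<bullet> i\<bar> < real m" using Basis_le_norm[of i x] m by auto
      then show "- (real m *\<^sub>R One) \<bullet> i < x \<bullet> i \<and> x \<bullet> i < real m *\<^sub>R One \<bullet> i" using \<open>i \<in> Basis\<close> by auto
    qed
    then have "indicator (?B m) x = (1::real)" by (rule indicator_simps)
    with elim[rule_format, of m] show ?case by (metis scaleR_one)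
  qed
qed

section \<open>Absolute continuity on lines\<close>

text \<open>\<open>U\<close> is locally absolutely continuous with derivative \<open>w\<close>.
  Encoding this by the fundamental theorem for the Lebesgue integral avoids almost everywhere
  derivatives and leaves \<open>w\<close> free to change on a null set, as long as it stays
  measurable.\<close>

definition is_primitive :: "(real \<Rightarrow> real) \<Rightarrow> (real \<Rightarrow> real) \<Rightarrow> bool" where
  "is_primitive U w \<longleftrightarrow>
    (\<forall>a b. a \<le> b \<longrightarrow> set_integrable lborel {a..b} w \<and> U b - U a = (LINT r:{a..b}|lborel. w r))"

lemma is_primitiveD:
  assumes "is_primitive U w" "a \<le> b"
  shows "set_integrable lborel {a..b} w" "U b - U a = (LINT r:{a..b}|lborel. w r)"
    "w integrable_on {a..b}" "U b - U a = integral {a..b} w"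
  using assms set_borel_integral_eq_integral[of "{a..b}" w] unfolding is_primitive_def by auto

lemma is_primitive_continuous_on:
  assumes "is_primitive U w"
  shows "continuous_on S U"
proof -
  have "isCont U x" for x
  proof -
    have "continuous_on {x - 1..x + 1} (\<lambda>r. U (x - 1) + integral {x - 1..r} w)"
      using is_primitiveD(3)[OF assms, of "x - 1" "x + 1"]
      by (intro continuous_intros indefinite_integral_continuous_1) auto
    also have "?this \<longleftrightarrow> continuous_on {x - 1..x + 1} U"
    proof (intro continuous_on_cong refl)
      fix r assume "r \<in> {x - 1..x + 1}"
      then show "U (x - 1) + integral {x - 1..r} w = U r"
        using is_primitiveD(4)[OF assms, of "x - 1" r] by simp
    qed
    finally show ?thesis
      by (intro continuous_on_interior[where S = "{x - 1..x + 1}"]) auto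
  qed
  then show ?thesis by (simp add: continuous_at_imp_continuous_on)
qed

lemma is_primitive_unique:
  assumes "is_primitive U w" "is_primitive V w"
  shows "U r - V r = U 0 - V 0"
  using is_primitiveD(2)[OF assms(1), of 0 r] is_primitiveD(2)[OF assms(2), of 0 r]
    is_primitiveD(2)[OF assms(1), of r 0] is_primitiveD(2)[OF assms(2), of r 0]
  by (cases "0 \<le> r") auto

text \<open>Integrability is asked on countably many intervals only, so that it can hold for almost
  every line at once.\<close>

lemma is_primitive_exists:
  assumes int: "\<And>n::nat. set_integrable lborel {- real n..real n} w"
  obtains U where "is_primitive U w" "U 0 = c"
proof -
  have si: "set_integrable lborel {a..b} w" for a b
  proof -
    obtain n where n: "max \<bar>a\<bar> \<bar>b\<bar> \<le> real n" using real_arch_simple by blast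
    then have "{a..b} \<subseteq> {- real n..real n}" by auto
    then show ?thesis by (rule set_integrable_subset[OF int, rotated]) simp
  qed
  have io: "w integrable_on {a..b}" for a b using set_borel_integral_eq_integral(1)[OF si] .
  define U where "U r = c + (if r \<ge> 0 then integral {0..r} w else - integral {r..0} w)" for r
  have "U b - U a = integral {a..b} w" if "a \<le> b" for a b
  proof -
    consider "0 \<le> a" | "a < 0" "0 \<le> b" | "b < 0" by linarith
    then show ?thesis
    proof cases
      case 1 then show ?thesis using that Henstock_Kurzweil_Integration.integral_combine[of 0 a b w] io by (simp add: U_def)
    next
      case 2 then show ?thesis using Henstock_Kurzweil_Integration.integral_combine[of a 0 b w] io by (simp add: U_def)
    next
      case 3 then show ?thesis using that Henstock_Kurzweil_Integration.integral_combine[of a b 0 w] io by (simp add: U_def)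
    qed
  qed
  then have "is_primitive U w"
    unfolding is_primitive_def using si set_borel_integral_eq_integral(2)[OF si] by auto
  moreover have "U 0 = c" by (simp add: U_def)
  ultimately show ?thesis using that by blast
qed

lemma is_primitive_cong_AE:
  assumes "is_primitive U w" and [measurable]: "w' \<in> borel_measurable borel"
    and ae: "AE r in lborel. w r = w' r"
  shows "is_primitive U w'"
  unfolding is_primitive_def
proof (intro allI impI)
  fix a b :: real assume "a \<le> b"
  note w = is_primitiveD(1,2)[OF assms(1) this]
  have m: "(\<lambda>x. indicator {a..b} x *\<^sub>R w x) \<in> borel_measurable lborel"
    using w(1) unfolding set_integrable_def by (rule borel_measurable_integrable)
  have "AE x in lborel. indicator {a..b} x *\<^sub>R w x = indicator {a..b} x *\<^sub>R w' x"
    using ae by eventually_elim simp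
  then show "set_integrable lborel {a..b} w' \<and> U b - U a = (LINT r:{a..b}|lborel. w' r)"
    using w integrable_cong_AE[OF m, of "\<lambda>x. indicator {a..b} x *\<^sub>R w' x"]
      integral_cong_AE[OF m, of "\<lambda>x. indicator {a..b} x *\<^sub>R w' x"]
    unfolding set_integrable_def set_lebesgue_integral_def by simp
qed

lemma MVT_closed_segment:
  fixes F :: "real \<Rightarrow> real"
  assumes F: "\<And>x. (F has_real_derivative F' x) (at x)"
  obtains z where "z \<in> closed_segment x y" "F y - F x = F' z * (y - x)"
proof -
  consider "x < y" | "x = y" | "y < x" by linarith
  then show ?thesis
  proof cases
    case 1
    from MVT2[OF this, of F F'] F obtain z where "x < z" "z < y" "F y - F x = (y - x) * F' z" by auto
    then show ?thesis using that[of z] by (simp add: closed_segment_eq_real_ivl mult.commute)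
  next
    case 2 then show ?thesis using that[of x] by simp
  next
    case 3
    from MVT2[OF this, of F F'] F obtain z where "y < z" "z < x" "F x - F y = (x - y) * F' z" by auto
    then show ?thesis using that[of z] 3 by (simp add: closed_segment_eq_real_ivl algebra_simps)
  qed
qed

lemma set_integrable_bounded_mult:
  fixes w f :: "real \<Rightarrow> real"
  assumes w: "set_integrable lborel {a..b} w" and f: "continuous_on UNIV f"
  shows "set_integrable lborel {a..b} (\<lambda>r. f r * w r)"
proof -
  have "compact (f ` {a..b})" using f by (intro compact_continuous_image) (auto intro: continuous_on_subset)
  then obtain B where B: "\<And>r. r \<in> {a..b} \<Longrightarrow> \<bar>f r\<bar> \<le> B"
    by (metis bounded_real compact_imp_bounded image_eqI)
  have [measurable]: "f \<in> borel_measurable borel" using f by (rule borel_measurable_continuous_onI)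
  have [measurable]: "(\<lambda>x. indicator {a..b} x * w x) \<in> borel_measurable borel"
    using w unfolding set_integrable_def by (auto dest: borel_measurable_integrable)
  have "integrable lborel (\<lambda>x. f x * (indicator {a..b} x * w x))"
  proof (rule Bochner_Integration.integrable_bound)
    show "integrable lborel (\<lambda>x. B * (indicator {a..b} x * w x))"
      using w unfolding set_integrable_def by simp
    show "AE x in lborel. norm (f x * (indicator {a..b} x * w x)) \<le> norm (B * (indicator {a..b} x * w x))"
    proof (rule AE_I2)
      fix x show "norm (f x * (indicator {a..b} x * w x)) \<le> norm (B * (indicator {a..b} x * w x))"
        using B[of x] by (cases "x \<in> {a..b}") (auto simp: abs_mult intro!: mult_right_mono)
    qed
  qed measurable
  then show ?thesis unfolding set_integrable_def by (simp add: mult_ac)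
qed

text \<open>A mesh argument instead of almost everywhere differentiation: on intervals shorter than
  the modulus of continuity of \<open>\<lambda>r. F' (U r)\<close>, freezing this function at one
  value costs at most \<epsilon> times the integral of |w|. Summing over the mesh and letting
  \<epsilon> tend to 0 leaves an equality.\<close>

lemma is_primitive_chain:
  assumes U: "is_primitive U w"
    and F: "\<And>x. (F has_real_derivative F' x) (at x)" and F': "continuous_on UNIV F'"
  shows "is_primitive (\<lambda>r. F (U r)) (\<lambda>r. F' (U r) * w r)"
proof -
  have cU: "continuous_on S U" for S using U by (rule is_primitive_continuous_on)
  have cF'U: "continuous_on UNIV (\<lambda>r. F' (U r))"
    using F' cU by (rule continuous_on_compose2) auto
  have si: "set_integrable lborel {a..b} (\<lambda>r. F' (U r) * w r)" if "a \<le> b" for a b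
    using is_primitiveD(1)[OF U that] cF'U by (rule set_integrable_bounded_mult)
  have "F (U b) - F (U a) = (LINT r:{a..b}|lborel. F' (U r) * w r)" if ab: "a < b" for a b
  proof -
    define W where "W s r = integral {s..r} (\<lambda>r. F' (U r) * w r)" for s r
    define A where "A s r = integral {s..r} (\<lambda>r. \<bar>w r\<bar>)" for s r
    have io: "(\<lambda>r. F' (U r) * w r) integrable_on {s..r}" if "s \<le> r" for s r
      using set_borel_integral_eq_integral(1)[OF si[OF that]] .
    have ioa: "(\<lambda>r. \<bar>w r\<bar>) integrable_on {s..r}" if "s \<le> r" for s r
      using set_borel_integral_eq_integral(1)[OF set_integrable_abs[OF is_primitiveD(1)[OF U that]]] .
    have "\<bar>F (U b) - F (U a) - W a b\<bar> \<le> \<epsilon> * A a b" if "\<epsilon> > 0" for \<epsilon>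
    proof -
      have "uniformly_continuous_on {a..b} (\<lambda>r. F' (U r))"
        using cF'U by (intro compact_uniformly_continuous) (auto intro: continuous_on_subset)
      then obtain \<delta> where \<delta>: "\<delta> > 0" "\<And>r s. r \<in> {a..b} \<Longrightarrow> s \<in> {a..b} \<Longrightarrow> dist r s < \<delta> \<Longrightarrow> dist (F' (U r)) (F' (U s)) < \<epsilon>"
        using \<open>\<epsilon> > 0\<close> unfolding uniformly_continuous_on_def by metis
      have step: "\<bar>F (U r) - F (U s) - W s r\<bar> \<le> \<epsilon> * A s r"
        if sr: "a \<le> s" "s \<le> r" "r \<le> b" "r - s < \<delta>" for s r
      proof -
        obtain z where z: "z \<in> closed_segment (U s) (U r)" "F (U r) - F (U s) = F' z * (U r - U s)"
          using MVT_closed_segment[OF F] by blast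
        \<comment> \<open>The mean value theorem gives \<open>z\<close> between \<open>U s\<close>
          and \<open>U r\<close>. Connectedness makes it a value of \<open>U\<close> at a point of
          the same short interval, where uniform continuity applies.\<close>
        have "connected (U ` {s..r})" by (intro connected_continuous_image cU) simp
        then have "closed_segment (U s) (U r) \<subseteq> U ` {s..r}"
          using sr by (intro closed_segment_subset) (auto simp: is_interval_connected_1[symmetric] intro: is_interval_convex)
        with z obtain \<rho> where \<rho>: "\<rho> \<in> {s..r}" "z = U \<rho>" by auto
        have "F (U r) - F (U s) - W s r = integral {s..r} (\<lambda>t. F' z * w t) - W s r"
          using z(2) is_primitiveD(4)[OF U sr(2)] by simp
        also have "\<dots> = integral {s..r} (\<lambda>t. F' z * w t - F' (U t) * w t)"
          unfolding W_def using sr io is_primitiveD(3)[OF U]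
          by (intro Henstock_Kurzweil_Integration.integral_diff[symmetric]) (auto intro: integrable_on_mult_right)
        also have "norm \<dots> \<le> integral {s..r} (\<lambda>t. \<epsilon> * \<bar>w t\<bar>)"
        proof (rule integral_norm_bound_integral)
          show "(\<lambda>t. F' z * w t - F' (U t) * w t) integrable_on {s..r}"
            using sr io is_primitiveD(3)[OF U] by (intro integrable_diff) (auto intro: integrable_on_mult_right)
          show "(\<lambda>t. \<epsilon> * \<bar>w t\<bar>) integrable_on {s..r}" using ioa[OF sr(2)] by (rule integrable_on_mult_right)
          fix t assume t: "t \<in> {s..r}"
          have "dist (F' (U \<rho>)) (F' (U t)) < \<epsilon>" using t \<rho> sr by (intro \<delta>) (auto simp: dist_real_def)
          then show "norm (F' z * w t - F' (U t) * w t) \<le> \<epsilon> * \<bar>w t\<bar>"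
            by (auto simp: \<rho> dist_real_def left_diff_distrib[symmetric] abs_mult intro!: mult_right_mono)
        qed
        finally show ?thesis by (simp add: A_def)
      qed
      obtain n :: nat where n: "(b - a) / \<delta> < real n" using reals_Archimedean2 by blast
      moreover have "0 < (b - a) / \<delta>" using ab \<delta> by simp
      ultimately have n0: "0 < real n" by linarith
      \<comment> \<open>Equal steps shorter than \<open>\<delta>\<close>; the error bounds add up
        along the mesh because the integral of |w| is additive over intervals.\<close>
      define h where "h = (b - a) / real n"
      have h: "0 < h" "h < \<delta>" "a + real n * h = b" using n n0 \<delta> ab by (auto simp: h_def field_simps)
      have "\<bar>F (U (a + real k * h)) - F (U a) - W a (a + real k * h)\<bar> \<le> \<epsilon> * A a (a + real k * h)" if "k \<le> n" for k
        using that
      proof (induction k)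
        case 0
        then show ?case by (simp add: W_def A_def)
      next
        case (Suc k)
        let ?s = "a + real k * h" and ?r = "a + real (Suc k) * h"
        have "real (Suc k) * h \<le> real n * h" using Suc.prems h by (intro mult_right_mono) auto
        then have sr: "a \<le> ?s" "?s \<le> ?r" "?r \<le> b" "?r - ?s < \<delta>" using h by (auto simp: algebra_simps)
        have "W a ?r = W a ?s + W ?s ?r" "A a ?r = A a ?s + A ?s ?r"
          unfolding W_def A_def using sr io ioa
          by (auto intro!: Henstock_Kurzweil_Integration.integral_combine[symmetric] simp del: of_nat_Suc)
        then show ?case using step[OF sr] Suc by (simp only: distrib_left) linarith
      qed
      from this[of n] show ?thesis using h by simp
    qed
    then have "\<bar>F (U b) - F (U a) - W a b\<bar> \<le> 0 * A a b"
      by (intro tendsto_lowerbound[where F = "at_right 0" and f = "\<lambda>\<epsilon>. \<epsilon> * A a b"] tendsto_intros)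
         (auto simp: eventually_at_right_field intro: exI[of _ 1])
    then show ?thesis
      using set_borel_integral_eq_integral(2)[OF si, of a b] ab by (simp add: W_def)
  qed
  moreover have "(LINT r:{a..a}|lborel. F' (U r) * w r) = 0" for a
    using set_borel_integral_eq_integral(2)[OF si, of a a] by simp
  ultimately show ?thesis
    unfolding is_primitive_def using si by (metis diff_self less_eq_real_def)
qed

lemma is_primitive_substitution:
  assumes U: "is_primitive U w"
    and \<tau>: "\<And>x. (\<tau> has_real_derivative \<tau>' x) (at x)" "continuous_on UNIV \<tau>'" "\<And>x. 0 \<le> \<tau>' x"
  shows "is_primitive (\<lambda>r. U (\<tau> r)) (\<lambda>r. w (\<tau> r) * \<tau>' r)"
  unfolding is_primitive_def
proof (intro allI impI)
  fix a b :: real assume ab: "a \<le> b"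
  have le: "\<tau> a \<le> \<tau> b" using DERIV_nonneg_imp_nondecreasing[OF ab, of \<tau>] \<tau> by blast
  have "continuous_on {a..b} \<tau>'" using \<tau>(2) by (rule continuous_on_subset) simp
  note * = integral_substitution[OF is_primitiveD(1)[OF U le] \<tau>(1) this \<tau>(3) ab]
  show "set_integrable lborel {a..b} (\<lambda>r. w (\<tau> r) * \<tau>' r) \<and>
    U (\<tau> b) - U (\<tau> a) = (LINT r:{a..b}|lborel. w (\<tau> r) * \<tau>' r)"
    using * is_primitiveD(2)[OF U le] by (simp add: set_lebesgue_integral_def mult.commute)
qed

lemma is_primitive_shift:
  assumes "is_primitive U w" shows "is_primitive (\<lambda>r. U (c + r)) (\<lambda>r. w (c + r))"
proof -
  have "((\<lambda>r. c + r) has_real_derivative 1) (at x)" for x by (auto intro!: derivative_eq_intros)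
  from is_primitive_substitution[OF assms this] show ?thesis by simp
qed

text \<open>By substitution, the integral of \<open>\<tau>'\<close> over the preimage of a null set
  is 0, and \<open>\<tau>'\<close> is positive. The substitution is for compact intervals, hence the
  countable exhaustion.\<close>

lemma AE_comp_increasing:
  fixes \<tau> :: "real \<Rightarrow> real"
  assumes ae: "AE r in lborel. P r"
    and \<tau>: "\<And>x. (\<tau> has_real_derivative \<tau>' x) (at x)" "continuous_on UNIV \<tau>'" "\<And>x. 0 < \<tau>' x"
  shows "AE r in lborel. P (\<tau> r)"
proof -
  from ae obtain N where N: "{x. \<not> P x} \<subseteq> N" "N \<in> null_sets lborel"
    by (auto elim!: AE_E simp: null_sets_def)
  have [measurable]: "N \<in> sets borel" using N by auto
  have [measurable]: "\<tau> \<in> borel_measurable borel" "\<tau>' \<in> borel_measurable borel"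
    using \<tau>(1,2) by (auto intro!: borel_measurable_continuous_onI continuous_at_imp_continuous_on DERIV_isCont)
  have "AE r in lborel. r \<in> {- real n..real n} \<longrightarrow> \<tau> r \<notin> N" for n
  proof -
    let ?a = "- real n" and ?b = "real n"
    have "(\<integral>\<^sup>+x. ennreal (indicator N (\<tau> x) * \<tau>' x * indicator {?a..?b} x) \<partial>lborel)
        = (\<integral>\<^sup>+x. ennreal (indicator N x * indicator {\<tau> ?a..\<tau> ?b} x) \<partial>lborel)"
      using \<tau> by (intro nn_integral_substitution[symmetric])
        (auto intro: continuous_on_subset less_imp_le simp: set_borel_measurable_def)
    also have "\<dots> = (\<integral>\<^sup>+x. 0 \<partial>(lborel::real measure))"
      by (rule nn_integral_cong_AE) (use AE_not_in[OF N(2)] in \<open>eventually_elim, simp\<close>)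
    finally have "AE x in lborel. ennreal (indicator N (\<tau> x) * \<tau>' x * indicator {?a..?b} x) = 0"
      using \<open>N \<in> sets borel\<close> by (subst nn_integral_0_iff_AE[symmetric]) auto
    then show ?thesis
    proof eventually_elim
      case (elim x)
      then show ?case using \<tau>(3)[of x] by (auto simp: indicator_def split: if_splits)
    qed
  qed
  then have "AE r in lborel. \<forall>n. r \<in> {- real n..real n} \<longrightarrow> \<tau> r \<notin> N"
    by (subst AE_all_countable) (rule allI)
  then show ?thesis
  proof eventually_elim
    case (elim r)
    obtain n where "\<bar>r\<bar> \<le> real n" using real_arch_simple by blast
    then have "r \<in> {- real n..real n}" by auto
    with elim N(1) show ?case by blast
  qed
qed

section \<open>Absolute continuity along a line in space\<close>

text \<open>The primitive is anchored at the value \<open>u x\<close> itself, while elsewhere on the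
  line it agrees with \<open>u\<close> almost everywhere only. Two base points with this property
  can then be compared exactly, which turns almost everywhere statements into identities between
  values of \<open>u\<close>.\<close>

definition ac_on_line :: "'a::euclidean_space \<Rightarrow> ('a \<Rightarrow> real) \<Rightarrow> ('a \<Rightarrow> real) \<Rightarrow> 'a \<Rightarrow> bool" where
  "ac_on_line e u c x \<longleftrightarrow> (\<exists>U. is_primitive U (\<lambda>r. c (x + r *\<^sub>R e)) \<and> U 0 = u x \<and>
     (AE r in lborel. u (x + r *\<^sub>R e) = U r))"

text \<open>The primitives anchored at the two base points have the same density, and both agree
  with \<open>u\<close> almost everywhere on the common line. They therefore agree at one point,
  hence everywhere.\<close>

lemma ac_on_line_value:
  assumes "ac_on_line e u c (x + r *\<^sub>R e)"
    and U: "is_primitive U (\<lambda>r. c (x + r *\<^sub>R e))" "U 0 = u x" "AE r in lborel. u (x + r *\<^sub>R e) = U r"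
  shows "u (x + r *\<^sub>R e) = U r"
proof -
  from assms(1) obtain V where V: "is_primitive V (\<lambda>s. c (x + r *\<^sub>R e + s *\<^sub>R e))" "V 0 = u (x + r *\<^sub>R e)"
    "AE s in lborel. u (x + r *\<^sub>R e + s *\<^sub>R e) = V s" unfolding ac_on_line_def by blast
  have U': "is_primitive (\<lambda>s. U (r + s)) (\<lambda>s. c (x + r *\<^sub>R e + s *\<^sub>R e))"
    using is_primitive_shift[OF U(1), of r] by (simp add: scaleR_add_left add.assoc)
  have "AE s in lborel. u (x + (r + s) *\<^sub>R e) = U (r + s)"
    by (rule AE_comp_increasing[OF U(3), of _ "\<lambda>_. 1"]) (auto intro!: derivative_eq_intros)
  with V(3) have "AE s in lborel. U (r + s) = V s"
    by eventually_elim (simp add: scaleR_add_left add.assoc)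
  \<comment> \<open>A property that holds almost everywhere on the line holds somewhere, since
    Lebesgue measure is not zero.\<close>
  then obtain s where "U (r + s) = V s"
    using eventually_happens'[of "ae_filter (lborel :: real measure)"] by (auto simp: ae_filter_eq_bot_iff)
  then have "U r = V 0" using is_primitive_unique[OF U' V(1), of s] by simp
  with V show ?thesis by simp
qed

lemma ac_on_line_diff:
  assumes "ac_on_line e u c x" "ac_on_line e u c (x + r *\<^sub>R e)" "0 \<le> r"
  shows "u (x + r *\<^sub>R e) - u x = (LINT \<rho>:{0..r}|lborel. c (x + \<rho> *\<^sub>R e))"
proof -
  from assms(1) obtain U where U: "is_primitive U (\<lambda>r. c (x + r *\<^sub>R e))" "U 0 = u x"
    "AE r in lborel. u (x + r *\<^sub>R e) = U r" unfolding ac_on_line_def by blast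
  then show ?thesis using is_primitiveD(2)[OF U(1) assms(3)] ac_on_line_value[OF assms(2) U] by simp
qed

lemma ac_on_line_chain:
  assumes "ac_on_line e u c x" "(\<lambda>r. F' (u (x + r *\<^sub>R e)) * c (x + r *\<^sub>R e)) \<in> borel_measurable borel"
    and F: "\<And>x. (F has_real_derivative F' x) (at x)" and F': "continuous_on UNIV F'"
  shows "ac_on_line e (\<lambda>y. F (u y)) (\<lambda>y. F' (u y) * c y) x"
proof -
  from assms(1) obtain U where U: "is_primitive U (\<lambda>r. c (x + r *\<^sub>R e))" "U 0 = u x"
    "AE r in lborel. u (x + r *\<^sub>R e) = U r" unfolding ac_on_line_def by blast
  have "is_primitive (\<lambda>r. F (U r)) (\<lambda>r. F' (u (x + r *\<^sub>R e)) * c (x + r *\<^sub>R e))"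
    using is_primitive_chain[OF U(1) F F'] assms(2)
    by (rule is_primitive_cong_AE) (use U(3) in \<open>eventually_elim, simp\<close>)
  moreover have "AE r in lborel. F (u (x + r *\<^sub>R e)) = F (U r)" using U(3) by eventually_elim simp
  ultimately show ?thesis unfolding ac_on_line_def using U(2) by (intro exI[of _ "\<lambda>r. F (U r)"]) simp
qed

text \<open>Covers both ways in which a deformation of one coordinate acts on coordinate lines:
  those in its own direction are reparametrised, the others are translated.\<close>

lemma ac_on_line_reparam:
  assumes "ac_on_line e u c (\<Phi> x)"
    and \<Phi>: "\<And>r. \<Phi> (x + r *\<^sub>R e) = \<Phi> x + \<tau> r *\<^sub>R e" "\<tau> 0 = 0"
    and \<tau>: "\<And>r. (\<tau> has_real_derivative \<tau>' r) (at r)" "continuous_on UNIV \<tau>'" "\<And>r. 0 < \<tau>' r"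
    and d: "\<And>r. d (x + r *\<^sub>R e) = c (\<Phi> (x + r *\<^sub>R e)) * \<tau>' r"
  shows "ac_on_line e (\<lambda>y. u (\<Phi> y)) d x"
proof -
  from assms(1) obtain U where U: "is_primitive U (\<lambda>r. c (\<Phi> x + r *\<^sub>R e))" "U 0 = u (\<Phi> x)"
    "AE r in lborel. u (\<Phi> x + r *\<^sub>R e) = U r" unfolding ac_on_line_def by blast
  show ?thesis unfolding ac_on_line_def
  proof (intro exI[of _ "\<lambda>r. U (\<tau> r)"] conjI)
    show "is_primitive (\<lambda>r. U (\<tau> r)) (\<lambda>r. d (x + r *\<^sub>R e))"
      using is_primitive_substitution[OF U(1) \<tau>(1,2)] \<tau>(3) by (simp add: d \<Phi> less_imp_le)
    show "AE r in lborel. u (\<Phi> (x + r *\<^sub>R e)) = U (\<tau> r)"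
      using AE_comp_increasing[OF U(3) \<tau>] by (simp add: \<Phi>)
  qed (use U \<Phi> in simp)
qed

section \<open>Weak gradients and absolute continuity on lines\<close>

lemma lborel_distr_translate: "distr lborel borel (\<lambda>x. x + c) = (lborel :: 'a::euclidean_space measure)"
  using lborel_distr_plus[of c] by (simp add: add.commute[of _ c] comp_def)

lemma nn_integral_lborel_translate:
  fixes f :: "'a::euclidean_space \<Rightarrow> ennreal"
  assumes [measurable]: "f \<in> borel_measurable borel"
  shows "(\<integral>\<^sup>+x. f (x + c) \<partial>lborel) = (\<integral>\<^sup>+x. f x \<partial>lborel)"
  by (subst (2) lborel_distr_translate[of c, symmetric]) (simp add: nn_integral_distr)

lemma integral_lborel_translate:
  fixes f :: "'a::euclidean_space \<Rightarrow> real"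
  assumes [measurable]: "f \<in> borel_measurable borel"
  shows "(\<integral>x. f (x + c) \<partial>lborel) = (\<integral>x. f x \<partial>lborel)"
  by (subst (2) lborel_distr_translate[of c, symmetric]) (simp add: integral_distr)

lemma integrable_lborel_translate:
  fixes f :: "'a::euclidean_space \<Rightarrow> real"
  assumes "integrable lborel f"
  shows "integrable lborel (\<lambda>x. f (x + c))"
proof -
  have [measurable]: "f \<in> borel_measurable borel" using assms by (auto dest: borel_measurable_integrable)
  show ?thesis using assms
    by (subst (asm) lborel_distr_translate[of c, symmetric]) (simp add: integrable_distr_eq)
qed

lemma AE_lborel_translate:
  fixes c :: "'a::euclidean_space"
  assumes "AE x in lborel. P x"
  shows "AE x in lborel. P (x + c)"
proof -
  have "AE x in distr lborel borel (\<lambda>x. x + c). P x" unfolding lborel_distr_translate by fact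
  then show ?thesis by (rule AE_distrD[rotated]) simp
qed

lemma loc_integrable_translate:
  fixes f :: "'a::euclidean_space \<Rightarrow> real"
  assumes "loc_integrable f" shows "loc_integrable (\<lambda>x. f (x + c))"
  unfolding loc_integrable_def
proof (intro conjI allI impI)
  have [measurable]: "f \<in> borel_measurable borel" using assms by (simp add: loc_integrable_def)
  then show "(\<lambda>x. f (x + c)) \<in> borel_measurable lborel" by simp
  fix K :: "'a set" assume "compact K"
  then have "compact ((\<lambda>x. c + x) ` K)" by (rule compact_translation)
  then have "integrable lborel (\<lambda>x. indicator ((\<lambda>x. c + x) ` K) x *\<^sub>R f x)"
    using assms by (auto simp: loc_integrable_def set_integrable_def)
  from integrable_lborel_translate[OF this, of c] show "set_integrable lborel K (\<lambda>x. f (x + c))"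
    unfolding set_integrable_def
    by (rule back_subst) (auto intro!: Bochner_Integration.integrable_cong simp: indicator_def image_iff add.commute)
qed

lemma loc_integrable_diff:
  assumes "loc_integrable f" "loc_integrable g" shows "loc_integrable (\<lambda>x. f x - g x)"
  using assms unfolding loc_integrable_def by (auto intro: set_integral_diff)

lemma loc_integrable_inner:
  fixes g :: "'a::euclidean_space \<Rightarrow> 'a"
  assumes "loc_integrable g" shows "loc_integrable (\<lambda>x. g x \<bullet> e)"
  unfolding loc_integrable_def
proof (intro conjI allI impI)
  have [measurable]: "g \<in> borel_measurable borel" using assms by (simp add: loc_integrable_def)
  show "(\<lambda>x. g x \<bullet> e) \<in> borel_measurable lborel" by simp
  fix K :: "'a set" assume "compact K"
  then have "integrable lborel (\<lambda>x. (indicator K x *\<^sub>R g x) \<bullet> e)"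
    using assms by (intro integrable_inner_left) (auto simp: loc_integrable_def set_integrable_def)
  then show "set_integrable lborel K (\<lambda>x. g x \<bullet> e)" by (simp add: set_integrable_def)
qed

lemma loc_integrable_bounded_mult:
  fixes f \<psi> :: "'a::euclidean_space \<Rightarrow> real"
  assumes f: "loc_integrable f" and [measurable]: "\<psi> \<in> borel_measurable borel"
    and B: "\<And>x. \<bar>\<psi> x\<bar> \<le> B * indicator (cball 0 R) x"
  shows "integrable lborel (\<lambda>x. f x * \<psi> x)"
proof -
  have [measurable]: "f \<in> borel_measurable borel" using f by (simp add: loc_integrable_def)
  have "integrable lborel (\<lambda>x. B * (indicator (cball 0 R) x *\<^sub>R f x))"
    using f unfolding loc_integrable_def set_integrable_def by (intro integrable_mult_right) auto
  then show ?thesis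
  proof (rule Bochner_Integration.integrable_bound)
    show "AE x in lborel. norm (f x * \<psi> x) \<le> norm (B * (indicator (cball 0 R) x *\<^sub>R f x))"
    proof (rule AE_I2)
      fix x
      have "\<bar>f x\<bar> * \<bar>\<psi> x\<bar> \<le> \<bar>f x\<bar> * (\<bar>B\<bar> * indicator (cball 0 R) x)"
        using B[of x] by (intro mult_left_mono) (auto simp: indicator_def split: if_splits)
      then show "norm (f x * \<psi> x) \<le> norm (B * (indicator (cball 0 R) x *\<^sub>R f x))"
        by (simp add: abs_mult mult_ac)
    qed
  qed measurable
qed

lemma test_fun_continuous: "test_fun \<phi> \<Longrightarrow> continuous_on S \<phi>"
  using continuous_on_subset[of UNIV \<phi> S] unfolding test_fun_def by (auto dest: spec[of _ 0])

lemma test_fun_has_derivative: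
  "test_fun \<phi> \<Longrightarrow> (\<phi> has_derivative frechet_derivative \<phi> (at x)) (at x)"
  unfolding test_fun_def frechet_derivative_works[symmetric] by (auto dest: spec[of _ "Suc 0"])

lemma test_fun_derivative_continuous:
  "test_fun \<phi> \<Longrightarrow> continuous_on S (\<lambda>x. frechet_derivative \<phi> (at x) v)"
  using continuous_on_subset[of UNIV "\<lambda>x. frechet_derivative \<phi> (at x) v" S]
  unfolding test_fun_def by (auto dest: spec[of _ "Suc 0"])

lemma test_fun_support:
  fixes \<phi> :: "'a::euclidean_space \<Rightarrow> real"
  assumes "test_fun \<phi>"
  obtains R where "0 < R" "\<And>x. x \<notin> cball 0 R \<Longrightarrow> \<phi> x = 0"
    "\<And>x v. x \<notin> cball 0 R \<Longrightarrow> frechet_derivative \<phi> (at x) v = 0"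
proof -
  have "bounded (closure {x. \<phi> x \<noteq> 0})" using assms by (simp add: test_fun_def compact_imp_bounded)
  then obtain R where R: "0 < R" "closure {x. \<phi> x \<noteq> 0} \<subseteq> cball 0 R"
    by (metis bounded_pos mem_cball_0 subsetI)
  then have 0: "\<phi> x = 0" if "x \<notin> cball 0 R" for x
    using closure_subset[of "{x. \<phi> x \<noteq> 0}"] that by blast
  have "frechet_derivative \<phi> (at x) v = 0" if x: "x \<notin> cball 0 R" for x v
  proof -
    have "(\<phi> has_derivative (\<lambda>_. 0)) (at x)"
      by (rule has_derivative_transform_within_open[where f = "\<lambda>_. 0" and s = "- cball 0 R"]) (use x 0 in auto)
    from frechet_derivative_at[OF this] show ?thesis by (metis (full_types))
  qed
  with R 0 show ?thesis using that by blast
qed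

lemma continuous_bounded_by_indicator:
  fixes f :: "'a::euclidean_space \<Rightarrow> real"
  assumes "continuous_on UNIV f" "\<And>x. x \<notin> cball 0 R \<Longrightarrow> f x = 0"
  obtains B where "0 < B" "\<And>x. \<bar>f x\<bar> \<le> B * indicator (cball 0 R) x"
proof -
  have "compact (f ` cball 0 R)" using assms by (intro compact_continuous_image) (auto intro: continuous_on_subset)
  then obtain B where B: "0 < B" "\<And>x. x \<in> cball 0 R \<Longrightarrow> \<bar>f x\<bar> \<le> B"
    by (metis bounded_pos compact_imp_bounded image_eqI real_norm_def)
  show ?thesis using B assms(2) by (intro that[of B]) (auto split: split_indicator)
qed

lemma frechet_derivative_shift:
  fixes \<phi> :: "'a::euclidean_space \<Rightarrow> real"
  assumes "\<phi> differentiable (at (x - a))"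
  shows "((\<lambda>x. \<phi> (x - a)) has_derivative frechet_derivative \<phi> (at (x - a))) (at x)"
    "frechet_derivative (\<lambda>x. \<phi> (x - a)) (at x) = frechet_derivative \<phi> (at (x - a))"
proof -
  have "((\<lambda>x. x - a) has_derivative (\<lambda>v. v)) (at x)" by (auto intro!: derivative_eq_intros)
  from has_derivative_compose[OF this assms[unfolded frechet_derivative_works]]
  show *: "((\<lambda>x. \<phi> (x - a)) has_derivative frechet_derivative \<phi> (at (x - a))) (at x)" .
  from frechet_derivative_at[OF *]
  show "frechet_derivative (\<lambda>x. \<phi> (x - a)) (at x) = frechet_derivative \<phi> (at (x - a))" by simp
qed

lemma Ck_shift: "Ck k \<phi> \<Longrightarrow> Ck k (\<lambda>x. \<phi> (x - a))"
proof (induction k arbitrary: \<phi>)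
  case 0
  then show ?case by (auto intro!: continuous_on_compose2[of UNIV \<phi>] continuous_intros)
next
  case (Suc k)
  then have d: "\<phi> differentiable (at x)" for x by simp
  have "Ck k (\<lambda>x. frechet_derivative \<phi> (at x) v)" for v using Suc.prems by simp
  from Suc.IH[OF this] have "Ck k (\<lambda>x. frechet_derivative \<phi> (at (x - a)) v)" for v .
  then show ?case
    using frechet_derivative_shift[OF d] by (auto simp: differentiable_def)
qed

lemma test_fun_shift:
  fixes \<phi> :: "'a::euclidean_space \<Rightarrow> real"
  assumes "test_fun \<phi>"
  shows "test_fun (\<lambda>x. \<phi> (x - a))"
  unfolding test_fun_def
proof
  show "\<forall>k. Ck k (\<lambda>x. \<phi> (x - a))" using assms Ck_shift by (auto simp: test_fun_def)
  obtain R where R: "\<And>x. x \<notin> cball 0 R \<Longrightarrow> \<phi> x = 0" using test_fun_support[OF assms] by metis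
  have "{x. \<phi> (x - a) \<noteq> 0} \<subseteq> cball a R" using R by (force simp: dist_norm norm_minus_commute)
  then show "compact (closure {x. \<phi> (x - a) \<noteq> 0})"
    by (metis bounded_cball bounded_subset compact_closure)
qed

text \<open>The definition speaks of basis vectors only; all directions are wanted because the level
  set estimate translates by every vector of a ball.\<close>

lemma weak_gradient_direction:
  fixes u :: "'a::euclidean_space \<Rightarrow> real"
  assumes w: "weak_gradient u g" and \<phi>: "test_fun \<phi>"
  shows "(\<integral>x. u x * frechet_derivative \<phi> (at x) e \<partial>lborel) = - (\<integral>x. (g x \<bullet> e) * \<phi> x \<partial>lborel)"
proof -
  obtain R where R: "\<And>x. x \<notin> cball 0 R \<Longrightarrow> \<phi> x = 0"
    "\<And>x v. x \<notin> cball 0 R \<Longrightarrow> frechet_derivative \<phi> (at x) v = 0" using test_fun_support[OF \<phi>] by metis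
  have u: "loc_integrable u" and g: "loc_integrable g" using w by (auto simp: weak_gradient_def)
  have m: "f \<in> borel_measurable borel" if "continuous_on UNIV f" for f :: "'a \<Rightarrow> real"
    using that by (rule borel_measurable_continuous_onI)
  have int1: "integrable lborel (\<lambda>x. u x * frechet_derivative \<phi> (at x) i)" for i
    using continuous_bounded_by_indicator[OF test_fun_derivative_continuous[OF \<phi>] R(2)]
      loc_integrable_bounded_mult[OF u m[OF test_fun_derivative_continuous[OF \<phi>]]] by metis
  have int2: "integrable lborel (\<lambda>x. (g x \<bullet> i) * \<phi> x)" for i
    using continuous_bounded_by_indicator[OF test_fun_continuous[OF \<phi>] R(1)]
      loc_integrable_bounded_mult[OF loc_integrable_inner[OF g] m[OF test_fun_continuous[OF \<phi>]]] by metis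
  have "frechet_derivative \<phi> (at x) e = (\<Sum>i\<in>Basis. (e \<bullet> i) * frechet_derivative \<phi> (at x) i)" for x
  proof -
    have lin: "linear (frechet_derivative \<phi> (at x))"
      using test_fun_has_derivative[OF \<phi>] has_derivative_linear by blast
    have "frechet_derivative \<phi> (at x) (\<Sum>i\<in>Basis. (e \<bullet> i) *\<^sub>R i) = (\<Sum>i\<in>Basis. (e \<bullet> i) * frechet_derivative \<phi> (at x) i)"
      using linear_sum[OF lin] linear_cmul[OF lin] by (simp add: linear_sum[OF lin])
    then show ?thesis by (simp add: euclidean_representation)
  qed
  then have "(\<integral>x. u x * frechet_derivative \<phi> (at x) e \<partial>lborel) =
    (\<integral>x. (\<Sum>i\<in>Basis. (e \<bullet> i) * (u x * frechet_derivative \<phi> (at x) i)) \<partial>lborel)"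
    by (simp add: sum_distrib_left mult_ac)
  also have "\<dots> = (\<Sum>i\<in>Basis. (e \<bullet> i) * (\<integral>x. u x * frechet_derivative \<phi> (at x) i \<partial>lborel))"
    using int1 by (subst Bochner_Integration.integral_sum) auto
  also have "\<dots> = (\<Sum>i\<in>Basis. (e \<bullet> i) * - (\<integral>x. (g x \<bullet> i) * \<phi> x \<partial>lborel))"
    using w \<phi> by (intro sum.cong) (auto simp: weak_gradient_def)
  also have "\<dots> = - (\<integral>x. (\<Sum>i\<in>Basis. (e \<bullet> i) * ((g x \<bullet> i) * \<phi> x)) \<partial>lborel)"
    using int2 by (subst Bochner_Integration.integral_sum) (auto simp: sum_negf)
  also have "\<dots> = - (\<integral>x. (g x \<bullet> e) * \<phi> x \<partial>lborel)"
    by (simp add: euclidean_inner[of _ e] sum_distrib_left mult_ac)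
  finally show ?thesis .
qed

section \<open>Exchanging line integrals and space integrals\<close>

lemma integrable_line_product:
  fixes c :: "'a::euclidean_space \<Rightarrow> real" and \<psi> :: "real \<Rightarrow> 'a \<Rightarrow> real"
  assumes c: "loc_integrable c" and \<psi>[measurable]: "case_prod \<psi> \<in> borel_measurable (borel \<Otimes>\<^sub>M borel)"
    and B: "\<And>r x. r \<in> {a..b} \<Longrightarrow> \<bar>\<psi> r x\<bar> \<le> B * indicator (cball 0 R) x"
  shows "integrable (lborel \<Otimes>\<^sub>M lborel) (\<lambda>(r, x). indicator {a..b} r * (\<psi> r x * c (x + r *\<^sub>R e)))"
proof (rule integrableI_bounded)
  have [measurable]: "c \<in> borel_measurable borel" using c by (simp add: loc_integrable_def)
  show "(\<lambda>(r, x). indicator {a..b} r * (\<psi> r x * c (x + r *\<^sub>R e))) \<in> borel_measurable (lborel \<Otimes>\<^sub>M lborel)"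
    by measurable
  \<comment> \<open>Large enough to contain the ball of radius \<open>R\<close> after every
    translation by \<open>r *\<^sub>R e\<close> with \<open>r\<close> in the interval.\<close>
  define R' where "R' = R + max \<bar>a\<bar> \<bar>b\<bar> * norm e"
  have [measurable]: "cball (0::'a) R' \<in> sets borel" by (intro borel_closed closed_cball)
  define C where "C = (\<integral>\<^sup>+x. ennreal \<bar>indicator (cball 0 R') x * c x\<bar> \<partial>lborel)"
  have C: "C < \<infinity>"
  proof -
    have "integrable lborel (\<lambda>x. indicator (cball 0 R') x * c x)"
      using c by (auto simp: loc_integrable_def set_integrable_def)
    then show ?thesis unfolding C_def by (simp add: integrable_iff_bounded)
  qed
  have slice: "(\<integral>\<^sup>+x. ennreal (norm (indicator {a..b} r * (\<psi> r x * c (x + r *\<^sub>R e)))) \<partial>lborel)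
      \<le> ennreal \<bar>B\<bar> * C * indicator {a..b} r" for r
  proof (cases "r \<in> {a..b}")
    case True
    have "(\<integral>\<^sup>+x. ennreal (norm (indicator {a..b} r * (\<psi> r x * c (x + r *\<^sub>R e)))) \<partial>lborel)
      \<le> (\<integral>\<^sup>+x. ennreal \<bar>B\<bar> * ennreal \<bar>indicator (cball 0 R') (x + r *\<^sub>R e) * c (x + r *\<^sub>R e)\<bar> \<partial>lborel)"
    proof (rule nn_integral_mono)
      fix x
      have "\<bar>r\<bar> \<le> max \<bar>a\<bar> \<bar>b\<bar>" using True by auto
      then have "norm (r *\<^sub>R e) \<le> max \<bar>a\<bar> \<bar>b\<bar> * norm e" by (auto intro!: mult_right_mono)
      then have "x \<in> cball 0 R \<Longrightarrow> x + r *\<^sub>R e \<in> cball 0 R'"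
        using norm_triangle_ineq[of x "r *\<^sub>R e"] by (simp add: R'_def)
      then have "\<bar>\<psi> r x\<bar> \<le> \<bar>B\<bar> * indicator (cball 0 R') (x + r *\<^sub>R e)"
        using B[OF True, of x] abs_ge_self[of B] by (cases "x \<in> cball 0 R") (auto simp: indicator_def split: if_splits)
      then have "\<bar>\<psi> r x\<bar> * \<bar>c (x + r *\<^sub>R e)\<bar> \<le> \<bar>B\<bar> * indicator (cball 0 R') (x + r *\<^sub>R e) * \<bar>c (x + r *\<^sub>R e)\<bar>"
        by (rule mult_right_mono) simp
      then show "ennreal (norm (indicator {a..b} r * (\<psi> r x * c (x + r *\<^sub>R e))))
        \<le> ennreal \<bar>B\<bar> * ennreal \<bar>indicator (cball 0 R') (x + r *\<^sub>R e) * c (x + r *\<^sub>R e)\<bar>"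
        using True by (simp add: ennreal_mult[symmetric] abs_mult mult_ac ennreal_leI)
    qed
    also have "\<dots> = ennreal \<bar>B\<bar> * C"
      unfolding C_def
      using nn_integral_lborel_translate[of "\<lambda>x. ennreal \<bar>B\<bar> * ennreal \<bar>indicator (cball 0 R') x * c x\<bar>" "r *\<^sub>R e"]
      by (simp add: nn_integral_cmult)
    finally show ?thesis using True by simp
  qed simp
  have "(\<integral>\<^sup>+z. ennreal (norm (case z of (r, x) \<Rightarrow> indicator {a..b} r * (\<psi> r x * c (x + r *\<^sub>R e)))) \<partial>(lborel \<Otimes>\<^sub>M lborel))
     = (\<integral>\<^sup>+r. \<integral>\<^sup>+x. ennreal (norm (indicator {a..b} r * (\<psi> r x * c (x + r *\<^sub>R e)))) \<partial>lborel \<partial>lborel)"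
    by (subst lborel.nn_integral_fst[symmetric]) (auto simp: split_beta')
  also have "\<dots> \<le> (\<integral>\<^sup>+r. ennreal \<bar>B\<bar> * C * indicator {a..b} r \<partial>lborel)"
    by (intro nn_integral_mono slice)
  also have "\<dots> < \<infinity>"
    using C by (simp add: nn_integral_cmult_indicator ennreal_mult_less_top less_top[symmetric] emeasure_lborel_Icc_eq ennreal_mult_eq_top_iff)
  finally show "(\<integral>\<^sup>+z. ennreal (norm (case z of (r, x) \<Rightarrow> indicator {a..b} r * (\<psi> r x * c (x + r *\<^sub>R e)))) \<partial>(lborel \<Otimes>\<^sub>M lborel)) < \<infinity>" .
qed

lemma cball_borel_measurable [measurable]: "cball (a::'a::metric_space) r \<in> sets borel"
  by (intro borel_closed closed_cball)

lemma test_shift_bound: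
  fixes \<psi> :: "'a::euclidean_space \<Rightarrow> real"
  assumes "continuous_on UNIV \<psi>" "\<And>x. x \<notin> cball 0 R \<Longrightarrow> \<psi> x = 0"
  obtains B R' where "0 < B" "\<And>r x. r \<in> {a..b} \<Longrightarrow> \<bar>\<psi> (x - r *\<^sub>R e)\<bar> \<le> B * indicator (cball 0 R') x"
proof -
  obtain B where B: "0 < B" "\<And>x. \<bar>\<psi> x\<bar> \<le> B * indicator (cball 0 R) x"
    using continuous_bounded_by_indicator[OF assms] by blast
  define R' where "R' = R + max \<bar>a\<bar> \<bar>b\<bar> * norm e"
  have "\<bar>\<psi> (x - r *\<^sub>R e)\<bar> \<le> B * indicator (cball 0 R') x" if r: "r \<in> {a..b}" for r x
  proof -
    have "\<bar>r\<bar> \<le> max \<bar>a\<bar> \<bar>b\<bar>" using r by auto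
    then have "norm (r *\<^sub>R e) \<le> max \<bar>a\<bar> \<bar>b\<bar> * norm e" by (auto intro!: mult_right_mono)
    then have "x - r *\<^sub>R e \<in> cball 0 R \<Longrightarrow> x \<in> cball 0 R'"
      using norm_triangle_ineq[of "x - r *\<^sub>R e" "r *\<^sub>R e"] by (simp add: R'_def)
    then show ?thesis using B(2)[of "x - r *\<^sub>R e"] B(1)
      by (cases "x - r *\<^sub>R e \<in> cball 0 R"; cases "x \<in> cball 0 R'") auto
  qed
  then show ?thesis using that[of B R'] B by blast
qed

text \<open>Both left-hand sides reduce to the same iterated integral, the first one by translation
  invariance. Together they shift an average along the line from \<open>c\<close> to the test
  function.\<close>

lemma integral_line_swap:
  fixes c \<psi> :: "'a::euclidean_space \<Rightarrow> real"
  assumes c: "loc_integrable c" and \<psi>: "continuous_on UNIV \<psi>" "\<And>x. x \<notin> cball 0 R \<Longrightarrow> \<psi> x = 0"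
  shows "(\<integral>x. \<psi> x * (LINT r:{a..b}|lborel. c (x + r *\<^sub>R e)) \<partial>lborel)
       = (LINT r:{a..b}|lborel. (\<integral>y. c y * \<psi> (y - r *\<^sub>R e) \<partial>lborel))"
    and "(\<integral>y. c y * (LINT r:{a..b}|lborel. \<psi> (y - r *\<^sub>R e)) \<partial>lborel)
       = (LINT r:{a..b}|lborel. (\<integral>y. c y * \<psi> (y - r *\<^sub>R e) \<partial>lborel))"
proof -
  have [measurable]: "c \<in> borel_measurable borel" using c by (simp add: loc_integrable_def)
  have [measurable]: "\<psi> \<in> borel_measurable borel" using \<psi>(1) by (rule borel_measurable_continuous_onI)
  obtain B where B: "\<And>x. \<bar>\<psi> x\<bar> \<le> B * indicator (cball 0 R) x"
    using continuous_bounded_by_indicator[OF \<psi>] by blast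
  have int: "integrable (lborel \<Otimes>\<^sub>M lborel) (\<lambda>(r, x). indicator {a..b} r * (\<psi> x * c (x + r *\<^sub>R e)))"
    by (rule integrable_line_product[OF c, where \<psi> = "\<lambda>_. \<psi>"]) (use B in auto)
  have "(\<integral>x. \<psi> x * (LINT r:{a..b}|lborel. c (x + r *\<^sub>R e)) \<partial>lborel)
      = (\<integral>x. (\<integral>r. indicator {a..b} r * (\<psi> x * c (x + r *\<^sub>R e)) \<partial>lborel) \<partial>lborel)"
    unfolding set_lebesgue_integral_def
    by (intro Bochner_Integration.integral_cong refl) (simp add: mult.left_commute[of _ "\<psi> _"])
  also have "\<dots> = (\<integral>r. (\<integral>x. indicator {a..b} r * (\<psi> x * c (x + r *\<^sub>R e)) \<partial>lborel) \<partial>lborel)"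
    using lborel_pair.Fubini_integral[OF int] .
  also have "\<dots> = (LINT r:{a..b}|lborel. (\<integral>y. c y * \<psi> (y - r *\<^sub>R e) \<partial>lborel))"
    unfolding set_lebesgue_integral_def
  proof (intro Bochner_Integration.integral_cong refl)
    fix r
    have "(\<integral>x. \<psi> x * c (x + r *\<^sub>R e) \<partial>lborel) = (\<integral>y. c y * \<psi> (y - r *\<^sub>R e) \<partial>lborel)"
      using integral_lborel_translate[of "\<lambda>y. c y * \<psi> (y - r *\<^sub>R e)" "r *\<^sub>R e"] by (simp add: mult.commute)
    then show "(\<integral>x. indicator {a..b} r * (\<psi> x * c (x + r *\<^sub>R e)) \<partial>lborel)
       = indicator {a..b} r *\<^sub>R (\<integral>y. c y * \<psi> (y - r *\<^sub>R e) \<partial>lborel)" by simp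
  qed
  finally show "(\<integral>x. \<psi> x * (LINT r:{a..b}|lborel. c (x + r *\<^sub>R e)) \<partial>lborel)
       = (LINT r:{a..b}|lborel. (\<integral>y. c y * \<psi> (y - r *\<^sub>R e) \<partial>lborel))" .
  obtain B' R' where B': "\<And>r x. r \<in> {a..b} \<Longrightarrow> \<bar>\<psi> (x - r *\<^sub>R e)\<bar> \<le> B' * indicator (cball 0 R') x"
    using test_shift_bound[OF \<psi>] by blast
  \<comment> \<open>The direction 0 leaves \<open>c\<close> in place; the whole translation now sits
    in the test function.\<close>
  have int: "integrable (lborel \<Otimes>\<^sub>M lborel) (\<lambda>(r, y). indicator {a..b} r * (\<psi> (y - r *\<^sub>R e) * c (y + r *\<^sub>R 0)))"
    by (rule integrable_line_product[OF c, where \<psi> = "\<lambda>r y. \<psi> (y - r *\<^sub>R e)"]) (use B' in auto)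
  have "(\<integral>y. c y * (LINT r:{a..b}|lborel. \<psi> (y - r *\<^sub>R e)) \<partial>lborel)
     = (\<integral>y. (\<integral>r. indicator {a..b} r * (\<psi> (y - r *\<^sub>R e) * c (y + r *\<^sub>R 0)) \<partial>lborel) \<partial>lborel)"
    unfolding set_lebesgue_integral_def
  proof (intro Bochner_Integration.integral_cong refl)
    fix y
    have "indicator {a..b} r * (\<psi> (y - r *\<^sub>R e) * c (y + r *\<^sub>R 0)) = c y * (indicator {a..b} r *\<^sub>R \<psi> (y - r *\<^sub>R e))" for r
      by simp
    then show "c y * (\<integral>r. indicator {a..b} r *\<^sub>R \<psi> (y - r *\<^sub>R e) \<partial>lborel)
      = (\<integral>r. indicator {a..b} r * (\<psi> (y - r *\<^sub>R e) * c (y + r *\<^sub>R 0)) \<partial>lborel)"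
      by (simp only: integral_mult_right_zero)
  qed
  also have "\<dots> = (\<integral>r. (\<integral>y. indicator {a..b} r * (\<psi> (y - r *\<^sub>R e) * c (y + r *\<^sub>R 0)) \<partial>lborel) \<partial>lborel)"
    using lborel_pair.Fubini_integral[OF int] .
  also have "\<dots> = (LINT r:{a..b}|lborel. (\<integral>y. c y * \<psi> (y - r *\<^sub>R e) \<partial>lborel))"
    unfolding set_lebesgue_integral_def by (simp add: mult.commute[of "c _"])
  finally show "(\<integral>y. c y * (LINT r:{a..b}|lborel. \<psi> (y - r *\<^sub>R e)) \<partial>lborel)
       = (LINT r:{a..b}|lborel. (\<integral>y. c y * \<psi> (y - r *\<^sub>R e) \<partial>lborel))" .
qed

lemma test_fun_increment:
  fixes \<phi> :: "'a::euclidean_space \<Rightarrow> real"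
  assumes \<phi>: "test_fun \<phi>" and "a \<le> b"
  shows "\<phi> (y - b *\<^sub>R e) - \<phi> (y - a *\<^sub>R e) = - (LINT r:{a..b}|lborel. frechet_derivative \<phi> (at (y - r *\<^sub>R e)) e)"
proof -
  define D where "D x = frechet_derivative \<phi> (at x) e" for x
  have cD: "continuous_on UNIV D" using test_fun_derivative_continuous[OF \<phi>] by (simp add: D_def)
  have "(\<integral>r. indicator {a..b} r *\<^sub>R (- D (y - r *\<^sub>R e)) \<partial>lborel) = \<phi> (y - b *\<^sub>R e) - \<phi> (y - a *\<^sub>R e)"
  proof (rule integral_FTC_Icc[OF \<open>a \<le> b\<close>])
    fix r
    have "((\<lambda>r. y - r *\<^sub>R e) has_derivative (\<lambda>h. - (h *\<^sub>R e))) (at r)"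
      by (auto intro!: derivative_eq_intros)
    from has_derivative_compose[OF this test_fun_has_derivative[OF \<phi>]]
    have *: "((\<lambda>r. \<phi> (y - r *\<^sub>R e)) has_derivative (\<lambda>h. frechet_derivative \<phi> (at (y - r *\<^sub>R e)) (- (h *\<^sub>R e)))) (at r)" .
    have "linear (frechet_derivative \<phi> (at (y - r *\<^sub>R e)))"
      using test_fun_has_derivative[OF \<phi>] has_derivative_linear by blast
    then have "frechet_derivative \<phi> (at (y - r *\<^sub>R e)) (- (h *\<^sub>R e)) = h *\<^sub>R - D (y - r *\<^sub>R e)" for h
      by (simp add: linear_neg linear_cmul D_def)
    with * have "((\<lambda>r. \<phi> (y - r *\<^sub>R e)) has_vector_derivative - D (y - r *\<^sub>R e)) (at r)"
      unfolding has_vector_derivative_def by simp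
    then show "((\<lambda>r. \<phi> (y - r *\<^sub>R e)) has_vector_derivative - D (y - r *\<^sub>R e)) (at r within {a..b})"
      by (rule has_vector_derivative_at_within)
  next
    show "continuous_on {a..b} (\<lambda>r. - D (y - r *\<^sub>R e))"
      by (intro continuous_intros continuous_on_compose2[OF cD]) auto
  qed
  then show ?thesis by (simp add: D_def set_lebesgue_integral_def)
qed

lemma integral_test_shift:
  fixes u \<phi> :: "'a::euclidean_space \<Rightarrow> real"
  assumes u: "loc_integrable u" and \<phi>: "continuous_on UNIV \<phi>" "\<And>x. x \<notin> cball 0 R \<Longrightarrow> \<phi> x = 0"
  shows "integrable lborel (\<lambda>x. u (x + c) * \<phi> x)" "integrable lborel (\<lambda>x. u x * \<phi> (x - c))"
    "(\<integral>x. u (x + c) * \<phi> x \<partial>lborel) = (\<integral>x. u x * \<phi> (x - c) \<partial>lborel)"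
proof -
  have [measurable]: "\<phi> \<in> borel_measurable borel" using \<phi>(1) by (rule borel_measurable_continuous_onI)
  have [measurable]: "u \<in> borel_measurable borel" using u by (simp add: loc_integrable_def)
  obtain B where B: "\<And>x. \<bar>\<phi> x\<bar> \<le> B * indicator (cball 0 R) x"
    using continuous_bounded_by_indicator[OF \<phi>] by blast
  show "integrable lborel (\<lambda>x. u (x + c) * \<phi> x)"
    by (rule loc_integrable_bounded_mult[OF loc_integrable_translate[OF u] _ B]) simp
  from integrable_lborel_translate[OF this, of "- c"] show "integrable lborel (\<lambda>x. u x * \<phi> (x - c))" by simp
  show "(\<integral>x. u (x + c) * \<phi> x \<partial>lborel) = (\<integral>x. u x * \<phi> (x - c) \<partial>lborel)"
    using integral_lborel_translate[of "\<lambda>x. u x * \<phi> (x - c)" c] by simp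
qed

lemma integral_increment_test:
  fixes u \<phi> :: "'a::euclidean_space \<Rightarrow> real"
  assumes u: "loc_integrable u" and \<phi>: "test_fun \<phi>" and "a \<le> b"
  shows "(\<integral>x. (u (x + b *\<^sub>R e) - u (x + a *\<^sub>R e)) * \<phi> x \<partial>lborel)
     = - (LINT r:{a..b}|lborel. (\<integral>y. u y * frechet_derivative \<phi> (at (y - r *\<^sub>R e)) e \<partial>lborel))"
proof -
  obtain R where R: "\<And>x. x \<notin> cball 0 R \<Longrightarrow> \<phi> x = 0"
    "\<And>x v. x \<notin> cball 0 R \<Longrightarrow> frechet_derivative \<phi> (at x) v = 0" using test_fun_support[OF \<phi>] by metis
  note int = integral_test_shift[OF u test_fun_continuous[OF \<phi>] R(1)]
  have "(\<integral>x. (u (x + b *\<^sub>R e) - u (x + a *\<^sub>R e)) * \<phi> x \<partial>lborel)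
    = (\<integral>x. u x * (\<phi> (x - b *\<^sub>R e) - \<phi> (x - a *\<^sub>R e)) \<partial>lborel)"
    using int by (simp add: left_diff_distrib right_diff_distrib)
  also have "\<dots> = - (\<integral>x. u x * (LINT r:{a..b}|lborel. frechet_derivative \<phi> (at (x - r *\<^sub>R e)) e) \<partial>lborel)"
    using test_fun_increment[OF \<phi> \<open>a \<le> b\<close>] by simp
  also have "\<dots> = - (LINT r:{a..b}|lborel. (\<integral>y. u y * frechet_derivative \<phi> (at (y - r *\<^sub>R e)) e \<partial>lborel))"
    using integral_line_swap(2)[OF u test_fun_derivative_continuous[OF \<phi>] R(2)] by simp
  finally show ?thesis .
qed

lemma loc_integrable_line_integral:
  fixes c :: "'a::euclidean_space \<Rightarrow> real"
  assumes c: "loc_integrable c"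
  shows "loc_integrable (\<lambda>x. LINT r:{a..b}|lborel. c (x + r *\<^sub>R e))"
  unfolding loc_integrable_def
proof (intro conjI allI impI)
  have [measurable]: "c \<in> borel_measurable borel" using c by (simp add: loc_integrable_def)
  show "(\<lambda>x. LINT r:{a..b}|lborel. c (x + r *\<^sub>R e)) \<in> borel_measurable lborel"
    unfolding set_lebesgue_integral_def by measurable
  fix K :: "'a set" assume K: "compact K"
  then have [measurable]: "K \<in> sets borel" by (rule borel_compact)
  obtain R where R: "K \<subseteq> cball 0 R" by (metis K compact_imp_bounded bounded_pos mem_cball_0 subsetI)
  have "integrable (lborel \<Otimes>\<^sub>M lborel) (\<lambda>(r, x). indicator {a..b} r * (indicator K x * c (x + r *\<^sub>R e)))"
    by (rule integrable_line_product[OF c, where \<psi> = "\<lambda>_. indicator K" and B = 1 and R = R])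
      (use R in \<open>auto split: split_indicator\<close>)
  from lborel_pair.integrable_snd[OF this]
  show "set_integrable lborel K (\<lambda>x. LINT r:{a..b}|lborel. c (x + r *\<^sub>R e))"
    unfolding set_integrable_def set_lebesgue_integral_def by (simp add: mult.left_commute[of _ "indicator K _"])
qed

section \<open>From a weak gradient to lines\<close>

text \<open>Integrated form of the weak derivative, for fixed \<open>a\<close> and \<open>b\<close>.
  A translate of a test function is a test function, so the defining identity holds for each
  \<open>r\<close>; integrating it over \<open>r\<close> and applying the fundamental lemma removes
  the test function.\<close>

lemma weak_gradient_line_increment:
  fixes u :: "'a::euclidean_space \<Rightarrow> real"
  assumes w: "weak_gradient u g" and ab: "a \<le> b"
  shows "AE x in lborel. u (x + b *\<^sub>R e) - u (x + a *\<^sub>R e) = (LINT r:{a..b}|lborel. g (x + r *\<^sub>R e) \<bullet> e)"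
proof -
  have u: "loc_integrable u" and g: "loc_integrable g" using w by (auto simp: weak_gradient_def)
  note c = loc_integrable_inner[OF g, of e]
  let ?f = "\<lambda>x. (u (x + b *\<^sub>R e) - u (x + a *\<^sub>R e)) - (LINT r:{a..b}|lborel. g (x + r *\<^sub>R e) \<bullet> e)"
  have "AE x in lborel. ?f x = 0"
  proof (rule test_integral_zero_imp_AE_zero)
    show "loc_integrable ?f"
      by (intro loc_integrable_diff loc_integrable_translate u loc_integrable_line_integral[OF c])
    fix \<phi> :: "'a \<Rightarrow> real" assume \<phi>: "test_fun \<phi>"
    obtain R where R: "\<And>x. x \<notin> cball 0 R \<Longrightarrow> \<phi> x = 0"
      "\<And>x v. x \<notin> cball 0 R \<Longrightarrow> frechet_derivative \<phi> (at x) v = 0" using test_fun_support[OF \<phi>] by metis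
    note int = integral_test_shift[OF _ test_fun_continuous[OF \<phi>] R(1), where c = 0, simplified]
    have "(\<integral>x. ?f x * \<phi> x \<partial>lborel) = (\<integral>x. (u (x + b *\<^sub>R e) - u (x + a *\<^sub>R e)) * \<phi> x \<partial>lborel)
       - (\<integral>x. (LINT r:{a..b}|lborel. g (x + r *\<^sub>R e) \<bullet> e) * \<phi> x \<partial>lborel)"
      by (subst Bochner_Integration.integral_diff[symmetric])
        (auto intro!: int loc_integrable_diff loc_integrable_translate u loc_integrable_line_integral[OF c]
           simp: left_diff_distrib)
    moreover have "(\<integral>y. u y * frechet_derivative \<phi> (at (y - r *\<^sub>R e)) e \<partial>lborel) = - (\<integral>y. (g y \<bullet> e) * \<phi> (y - r *\<^sub>R e) \<partial>lborel)" for r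
    proof -
      have "\<phi> differentiable (at x)" for x using test_fun_has_derivative[OF \<phi>] by (rule differentiableI)
      from frechet_derivative_shift(2)[OF this] weak_gradient_direction[OF w test_fun_shift[OF \<phi>, of "r *\<^sub>R e"]]
      show ?thesis by simp
    qed
    ultimately show "(\<integral>x. ?f x * \<phi> x \<partial>lborel) = 0"
      using integral_increment_test[OF u \<phi> ab, where e = e] integral_line_swap(1)[OF c test_fun_continuous[OF \<phi>] R(1), where a = a and b = b and e = e]
      by (simp add: mult.commute[of "\<phi> _"] set_lebesgue_integral_def)
  qed
  then show ?thesis by eventually_elim simp
qed

lemma loc_integrable_AE_lines:
  fixes c :: "'a::euclidean_space \<Rightarrow> real"
  assumes c: "loc_integrable c"
  shows "AE x in lborel. \<forall>n::nat. set_integrable lborel {- real n..real n} (\<lambda>r. c (x + r *\<^sub>R e))"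
proof -
  have "AE x in lborel. integrable lborel (\<lambda>r. indicator {- real n..real n} r * (indicator (cball 0 (real m)) x * c (x + r *\<^sub>R e)))"
    for n m :: nat
    by (rule lborel_pair.AE_integrable_snd[OF integrable_line_product[OF c, where B = 1 and R = "real m"]]) auto
  then have "AE x in lborel. \<forall>n m::nat. integrable lborel (\<lambda>r. indicator {- real n..real n} r * (indicator (cball 0 (real m)) x * c (x + r *\<^sub>R e)))"
    by (simp only: AE_all_countable) blast
  then show ?thesis
  proof eventually_elim
    case (elim x)
    obtain m where "norm x \<le> real m" using real_arch_simple by blast
    with elim[rule_format, of _ m] show ?case by (simp add: set_integrable_def)
  qed
qed

text \<open>The increments are known for each \<open>r\<close> at almost every point, while the
  claim wants, at almost every point, almost every \<open>r\<close>. Fubini for null sets makes the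
  exchange, provided that the exceptional set is jointly measurable.\<close>

lemma weak_gradient_ac_on_line:
  fixes u :: "'a::euclidean_space \<Rightarrow> real"
  assumes w: "weak_gradient u g"
  shows "AE x in lborel. ac_on_line e u (\<lambda>x. g x \<bullet> e) x"
proof -
  have u: "loc_integrable u" and g: "loc_integrable g" using w by (auto simp: weak_gradient_def)
  define c where "c x = g x \<bullet> e" for x
  have c: "loc_integrable c" unfolding c_def using g by (rule loc_integrable_inner)
  have [measurable]: "c \<in> borel_measurable borel" "u \<in> borel_measurable borel"
    using c u by (simp_all add: loc_integrable_def)
  define J where "J x r = (if 0 \<le> r then LINT \<rho>:{0..r}|lborel. c (x + \<rho> *\<^sub>R e) else - (LINT \<rho>:{r..0}|lborel. c (x + \<rho> *\<^sub>R e)))" for x r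
  \<comment> \<open>Conditions under the integral replace the intervals depending on
    \<open>r\<close>, which makes joint measurability in \<open>r\<close> and \<open>x\<close>
    visible.\<close>
  have J: "J x r = (if 0 \<le> r then \<integral>\<rho>. (if 0 \<le> \<rho> \<and> \<rho> \<le> r then c (x + \<rho> *\<^sub>R e) else 0) \<partial>lborel
     else - (\<integral>\<rho>. (if r \<le> \<rho> \<and> \<rho> \<le> 0 then c (x + \<rho> *\<^sub>R e) else 0) \<partial>lborel))" for x r
    unfolding J_def set_lebesgue_integral_def
    by (auto intro!: Bochner_Integration.integral_cong simp: indicator_def)
  have "(\<lambda>(r, x). J x r) \<in> borel_measurable (borel \<Otimes>\<^sub>M borel)"
    unfolding J split_beta' by measurable
  then have meas: "{z \<in> space (lborel \<Otimes>\<^sub>M lborel). u (snd z + fst z *\<^sub>R e) - u (snd z) = J (snd z) (fst z)} \<in> sets (lborel \<Otimes>\<^sub>M lborel)"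
    using \<open>u \<in> borel_measurable borel\<close> unfolding split_beta' by measurable
  have "AE x in lborel. u (x + r *\<^sub>R e) - u x = J x r" for r
  proof (cases "0 \<le> r")
    case True
    from weak_gradient_line_increment[OF w this, of e] show ?thesis
      by eventually_elim (use True in \<open>simp add: J_def c_def\<close>)
  next
    case False
    then have "r \<le> 0" by simp
    from weak_gradient_line_increment[OF w this, of e] show ?thesis
      by eventually_elim (use False in \<open>simp add: J_def c_def\<close>)
  qed
  then have "AE r in lborel. AE x in lborel. u (x + r *\<^sub>R e) - u x = J x r" by simp
  then have "AE x in lborel. AE r in lborel. u (x + r *\<^sub>R e) - u x = J x r"
    by (subst lborel_pair.AE_commute[symmetric]) (use meas in simp_all)
  with loc_integrable_AE_lines[OF c, of e] show ?thesis
  proof eventually_elim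
    case (elim x)
    obtain U where U: "is_primitive U (\<lambda>r. c (x + r *\<^sub>R e))" "U 0 = u x"
      using is_primitive_exists[of "\<lambda>r. c (x + r *\<^sub>R e)" "u x"] elim(1) by blast
    have "U r = u x + J x r" for r
      using is_primitiveD(2)[OF U(1), of 0 r] is_primitiveD(2)[OF U(1), of r 0] U(2) by (auto simp: J_def)
    with elim(2) have "AE r in lborel. u (x + r *\<^sub>R e) = U r" by (auto elim!: eventually_mono)
    with U show ?case unfolding ac_on_line_def c_def by blast
  qed
qed

section \<open>From lines back to a weak gradient\<close>

lemma continuous_on_integral_shift:
  fixes f \<psi> :: "'a::euclidean_space \<Rightarrow> real"
  assumes f: "loc_integrable f" and \<psi>: "continuous_on UNIV \<psi>" "\<And>x. x \<notin> cball 0 R \<Longrightarrow> \<psi> x = 0"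
  shows "continuous_on {a..b} (\<lambda>r. \<integral>y. f y * \<psi> (y - r *\<^sub>R e) \<partial>lborel)"
  unfolding continuous_on_sequentially
proof (intro allI ballI impI)
  fix r :: "nat \<Rightarrow> real" and s assume s: "s \<in> {a..b}" and r: "(\<forall>n. r n \<in> {a..b}) \<and> r \<longlonglongrightarrow> s"
  have [measurable]: "\<psi> \<in> borel_measurable borel" using \<psi>(1) by (rule borel_measurable_continuous_onI)
  have [measurable]: "f \<in> borel_measurable borel" using f by (simp add: loc_integrable_def)
  obtain B R' where B: "0 < B" "\<And>r x. r \<in> {a..b} \<Longrightarrow> \<bar>\<psi> (x - r *\<^sub>R e)\<bar> \<le> B * indicator (cball 0 R') x"
    using test_shift_bound[OF \<psi>] by blast
  have "(\<lambda>n. \<integral>y. f y * \<psi> (y - r n *\<^sub>R e) \<partial>lborel) \<longlonglongrightarrow> (\<integral>y. f y * \<psi> (y - s *\<^sub>R e) \<partial>lborel)"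
  proof (rule integral_dominated_convergence)
    show "integrable lborel (\<lambda>x. \<bar>f x * (B * indicator (cball 0 R') x)\<bar>)"
      by (intro integrable_abs loc_integrable_bounded_mult[OF f, of _ B R']) (use B in auto)
    show "AE x in lborel. norm (f x * \<psi> (x - r n *\<^sub>R e)) \<le> \<bar>f x * (B * indicator (cball 0 R') x)\<bar>" for n
      using B(2)[of "r n"] r B(1) by (auto simp: abs_mult intro!: mult_left_mono)
    show "AE x in lborel. (\<lambda>n. f x * \<psi> (x - r n *\<^sub>R e)) \<longlonglongrightarrow> f x * \<psi> (x - s *\<^sub>R e)"
    proof (rule AE_I2)
      fix x
      have "isCont \<psi> (x - s *\<^sub>R e)" using \<psi>(1) by (simp add: continuous_on_eq_continuous_at)
      moreover have "(\<lambda>n. x - r n *\<^sub>R e) \<longlonglongrightarrow> x - s *\<^sub>R e" using r by (intro tendsto_intros) auto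
      ultimately have "(\<lambda>n. \<psi> (x - r n *\<^sub>R e)) \<longlonglongrightarrow> \<psi> (x - s *\<^sub>R e)" by (rule isCont_tendsto_compose)
      then show "(\<lambda>n. f x * \<psi> (x - r n *\<^sub>R e)) \<longlonglongrightarrow> f x * \<psi> (x - s *\<^sub>R e)" by (intro tendsto_intros)
    qed
  qed auto
  then show "((\<lambda>r. \<integral>y. f y * \<psi> (y - r *\<^sub>R e) \<partial>lborel) \<circ> r) \<longlonglongrightarrow> (\<integral>y. f y * \<psi> (y - s *\<^sub>R e) \<partial>lborel)"
    by (simp add: o_def)
qed

text \<open>Increments over [0, b], tested and swapped, make the integral of \<open>h1 + h2\<close>
  over [0, b] vanish for every b \<ge> 0. Both functions are continuous in the shift, so
  differentiating at b = 0 gives \<open>h1 0 + h2 0 = 0\<close>, which is the integration by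
  parts.\<close>

lemma ac_on_line_integration_by_parts:
  fixes u c \<phi> :: "'a::euclidean_space \<Rightarrow> real"
  assumes u: "loc_integrable u" and c: "loc_integrable c" and \<phi>: "test_fun \<phi>"
    and ac: "AE x in lborel. ac_on_line e u c x"
  shows "(\<integral>x. u x * frechet_derivative \<phi> (at x) e \<partial>lborel) = - (\<integral>x. c x * \<phi> x \<partial>lborel)"
proof -
  obtain R where R: "\<And>x. x \<notin> cball 0 R \<Longrightarrow> \<phi> x = 0"
    "\<And>x v. x \<notin> cball 0 R \<Longrightarrow> frechet_derivative \<phi> (at x) v = 0" using test_fun_support[OF \<phi>] by metis
  define h1 where "h1 r = (\<integral>y. u y * frechet_derivative \<phi> (at (y - r *\<^sub>R e)) e \<partial>lborel)" for r
  define h2 where "h2 r = (\<integral>y. c y * \<phi> (y - r *\<^sub>R e) \<partial>lborel)" for r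
  have c1: "continuous_on {0..b} h1" for b unfolding h1_def
    by (rule continuous_on_integral_shift[OF u test_fun_derivative_continuous[OF \<phi>] R(2)])
  have c2: "continuous_on {0..b} h2" for b unfolding h2_def
    by (rule continuous_on_integral_shift[OF c test_fun_continuous[OF \<phi>] R(1)])
  have eq: "integral {0..b} (\<lambda>r. h1 r + h2 r) = 0" if "0 \<le> b" for b
  proof -
    \<comment> \<open>Both \<open>x\<close> and its translate must be good base points; translations
      preserve null sets.\<close>
    have "AE x in lborel. u (x + b *\<^sub>R e) - u (x + 0 *\<^sub>R e) = (LINT r:{0..b}|lborel. c (x + r *\<^sub>R e))"
      using ac AE_lborel_translate[OF ac, of "b *\<^sub>R e"]
      by eventually_elim (use ac_on_line_diff that in force)
    then have ae: "AE x in lborel. (u (x + b *\<^sub>R e) - u (x + 0 *\<^sub>R e)) * \<phi> x = \<phi> x * (LINT r:{0..b}|lborel. c (x + r *\<^sub>R e))"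
      by eventually_elim simp
    have [measurable]: "u \<in> borel_measurable borel" "\<phi> \<in> borel_measurable borel" "c \<in> borel_measurable borel"
      using u c borel_measurable_continuous_onI[OF test_fun_continuous[OF \<phi>]] by (auto simp: loc_integrable_def)
    have "(\<integral>x. (u (x + b *\<^sub>R e) - u (x + 0 *\<^sub>R e)) * \<phi> x \<partial>lborel) = (\<integral>x. \<phi> x * (LINT r:{0..b}|lborel. c (x + r *\<^sub>R e)) \<partial>lborel)"
      by (rule integral_cong_AE[OF _ _ ae]) (auto simp: set_lebesgue_integral_def)
    then have "- (LINT r:{0..b}|lborel. h1 r) = (LINT r:{0..b}|lborel. h2 r)"
      using integral_increment_test[OF u \<phi> that, where e = e] integral_line_swap(1)[OF c test_fun_continuous[OF \<phi>] R(1), where a = 0 and b = b and e = e]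
      by (simp add: h1_def h2_def)
    moreover have "(LINT r:{0..b}|lborel. h1 r) = integral {0..b} h1" "(LINT r:{0..b}|lborel. h2 r) = integral {0..b} h2"
      by (intro set_borel_integral_eq_integral borel_integrable_atLeastAtMost' c1 c2)+
    moreover have "integral {0..b} (\<lambda>r. h1 r + h2 r) = integral {0..b} h1 + integral {0..b} h2"
      by (intro Henstock_Kurzweil_Integration.integral_add integrable_continuous_real c1 c2)
    ultimately show ?thesis by simp
  qed
  have "((\<lambda>b. integral {0..b} (\<lambda>r. h1 r + h2 r)) has_vector_derivative (h1 0 + h2 0)) (at 0 within {0..1})"
    by (rule integral_has_vector_derivative) (auto intro!: continuous_intros c1 c2)
  moreover have "((\<lambda>b. integral {0..b} (\<lambda>r. h1 r + h2 r)) has_vector_derivative 0) (at 0 within {0..1})"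
    by (rule has_vector_derivative_transform[where f = "\<lambda>_. 0"]) (use eq in auto)
  ultimately have "h1 0 + h2 0 = 0"
    using vector_derivative_unique_within_closed_interval[of 0 1 0] by (metis atLeastAtMost_iff cbox_interval order_refl zero_le_one zero_less_one)
  then show ?thesis by (simp add: h1_def h2_def)
qed

lemma weak_gradientI_ac_on_line:
  fixes u :: "'a::euclidean_space \<Rightarrow> real"
  assumes "loc_integrable u" "loc_integrable g"
    and "\<And>i. i \<in> Basis \<Longrightarrow> AE x in lborel. ac_on_line i u (\<lambda>x. g x \<bullet> i) x"
  shows "weak_gradient u g"
  unfolding weak_gradient_def
  using assms ac_on_line_integration_by_parts[OF assms(1) loc_integrable_inner[OF assms(2)]] by blast

section \<open>Chain rule and translation estimates\<close>

lemma Young_powr: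
  fixes a b p :: real
  assumes "1 < p" "0 \<le> a" "0 \<le> b"
  shows "a powr (p - 1) * b \<le> (1 - 1 / p) * a powr p + b powr p / p"
proof -
  define q where "q = p / (p - 1)"
  have q: "1 < q" "1 / q + 1 / p = 1" using assms by (auto simp: q_def field_simps)
  have "a powr (p - 1) * b \<le> (a powr (p - 1)) powr q / q + b powr p / p"
    using assms q by (intro Youngs_inequality) auto
  also have "(a powr (p - 1)) powr q = a powr p" using assms by (simp add: powr_powr q_def)
  also have "a powr p / q = (1 - 1 / p) * a powr p" 
  proof -
    have "1 / q = 1 - 1 / p" using q(2) by simp
    then show ?thesis by (metis mult.commute times_divide_eq_right mult.right_neutral)
  qed
  finally show ?thesis .
qed

text \<open>The first bound is the gradient inequality of the convex function norm^p / p, with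
  equality at X = Y. Testing with a function close to the solution therefore loses nothing to first
  order.\<close>

lemma Young_inner:
  fixes X Y :: "'b::real_inner"
  assumes p: "1 < p"
  shows "norm X powr (p - 2) * (X \<bullet> Y) \<le> (1 - 1 / p) * norm X powr p + norm Y powr p / p"
    and "\<bar>norm X powr (p - 2) * (X \<bullet> Y)\<bar> \<le> norm X powr p + norm Y powr p"
proof -
  have abs: "\<bar>norm X powr (p - 2) * (X \<bullet> Y)\<bar> \<le> norm X powr (p - 1) * norm Y"
  proof (cases "X = 0")
    case False
    have "\<bar>norm X powr (p - 2) * (X \<bullet> Y)\<bar> \<le> norm X powr (p - 2) * (norm X * norm Y)"
      by (simp add: abs_mult Cauchy_Schwarz_ineq2 mult_left_mono)
    also have "\<dots> = norm X powr (p - 2 + 1) * norm Y" using False by (subst powr_add) simp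
    finally show ?thesis by simp
  qed simp
  also have y: "\<dots> \<le> (1 - 1 / p) * norm X powr p + norm Y powr p / p"
    using p by (intro Young_powr) auto
  finally show "norm X powr (p - 2) * (X \<bullet> Y) \<le> (1 - 1 / p) * norm X powr p + norm Y powr p / p" by linarith
  have "(1 - 1 / p) * norm X powr p \<le> 1 * norm X powr p" using p by (intro mult_right_mono) auto
  moreover have "norm Y powr p / p \<le> norm Y powr p" using p by (simp add: divide_le_eq mult_le_cancel_left1)
  ultimately show "\<bar>norm X powr (p - 2) * (X \<bullet> Y)\<bar> \<le> norm X powr p + norm Y powr p"
    using abs y by linarith
qed

text \<open>The right-hand side may be infinite, so that the power need not be known to be
  integrable along an individual line.\<close>

lemma Jensen_powr_interval:
  fixes f :: "real \<Rightarrow> real"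
  assumes p: "1 < p" and ab: "a < b" and f: "set_integrable lborel {a..b} f"
  shows "ennreal ((LINT r:{a..b}|lborel. \<bar>f r\<bar>) powr p)
    \<le> ennreal ((b - a) powr (p - 1)) * (\<integral>\<^sup>+r. ennreal (indicator {a..b} r * \<bar>f r\<bar> powr p) \<partial>lborel)"
proof (cases "(\<integral>\<^sup>+r. ennreal (indicator {a..b} r * \<bar>f r\<bar> powr p) \<partial>lborel) = \<infinity>")
  case True
  then show ?thesis using ab by (simp add: ennreal_mult_top)
next
  case False
  define A where "A = (LINT r:{a..b}|lborel. \<bar>f r\<bar>)"
  define L where "L = b - a"
  have L: "L > 0" using ab by (simp add: L_def)
  have A: "A \<ge> 0" unfolding A_def set_lebesgue_integral_def by (intro integral_nonneg_AE) auto
  have m: "(\<lambda>r. indicator {a..b} r * f r) \<in> borel_measurable lborel"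
    using f unfolding set_integrable_def by (auto dest: borel_measurable_integrable)
  have eq: "indicator {a..b} r * \<bar>f r\<bar> powr p = \<bar>indicator {a..b} r * f r\<bar> powr p" for r
    by (auto split: split_indicator)
  have m2: "(\<lambda>r. indicator {a..b} r * \<bar>f r\<bar> powr p) \<in> borel_measurable lborel"
    unfolding eq using m by measurable
  have int: "integrable lborel (\<lambda>r. indicator {a..b} r * \<bar>f r\<bar> powr p)"
    using False m2 by (intro integrableI_nonneg) (auto simp: less_top)
  define B where "B = (\<integral>r. indicator {a..b} r * \<bar>f r\<bar> powr p \<partial>lborel)"
  have nnB: "(\<integral>\<^sup>+r. ennreal (indicator {a..b} r * \<bar>f r\<bar> powr p) \<partial>lborel) = ennreal B"
    unfolding B_def using int by (intro nn_integral_eq_integral) auto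
  have fa: "integrable lborel (\<lambda>r. indicator {a..b} r * \<bar>f r\<bar>)"
    using set_integrable_abs[OF f] by (simp add: set_integrable_def)
  have ic: "integrable lborel (\<lambda>r. indicator {a..b} r * c)" for c :: real
    by (intro integrable_mult_left integrable_real_indicator) (auto simp: emeasure_lborel_Icc_eq)
  \<comment> \<open>Young's inequality at the mean \<open>A / L\<close> is the tangent line of the
    power function there; integrating it is Jensen's inequality.\<close>
  have "(A / L) powr (p - 1) * A = (\<integral>r. (A / L) powr (p - 1) * (indicator {a..b} r * \<bar>f r\<bar>) \<partial>lborel)"
    by (simp add: A_def set_lebesgue_integral_def)
  also have "\<dots> \<le> (\<integral>r. indicator {a..b} r * ((1 - 1 / p) * (A / L) powr p) + (indicator {a..b} r * \<bar>f r\<bar> powr p) / p \<partial>lborel)"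
  proof (rule integral_mono)
    fix r
    show "(A / L) powr (p - 1) * (indicator {a..b} r * \<bar>f r\<bar>)
       \<le> indicator {a..b} r * ((1 - 1 / p) * (A / L) powr p) + (indicator {a..b} r * \<bar>f r\<bar> powr p) / p"
      using Young_powr[OF p, of "A / L" "\<bar>f r\<bar>"] A L by (auto split: split_indicator)
  qed (use fa int ic in auto)
  also have "\<dots> = L * ((1 - 1 / p) * (A / L) powr p) + B / p"
    unfolding B_def using int ic ab by (subst Bochner_Integration.integral_add) (auto simp: L_def)
  also have "(A / L) powr (p - 1) * A = L * (A / L) powr p"
  proof (cases "A = 0")
    case False
    then have "(A / L) powr p = (A / L) powr (p - 1) * (A / L)"
      using A L by (subst powr_add[of _ "p - 1" 1, simplified]) (simp add: powr_one)
    then show ?thesis using L by simp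
  qed simp
  finally have "L * (A / L) powr p / p \<le> B / p" by (simp add: algebra_simps)
  then have "L * (A / L) powr p \<le> B" using p by (simp add: divide_le_cancel)
  then have "L powr (p - 1) * (L * (A / L) powr p) \<le> L powr (p - 1) * B" by (intro mult_left_mono) auto
  also have "L powr (p - 1) * (L * (A / L) powr p) = A powr p"
    using L A by (simp add: powr_divide powr_diff)
  finally show ?thesis unfolding nnB A_def[symmetric] L_def[symmetric]
    by (simp add: ennreal_mult'[symmetric] ennreal_leI)
qed

section \<open>Local integrability and the chain rule\<close>

lemma loc_integrable_bound:
  fixes f :: "'a::euclidean_space \<Rightarrow> 'b::{banach,second_countable_topology}" and h :: "'a \<Rightarrow> real"
  assumes f: "f \<in> borel_measurable borel" and h: "loc_integrable h" and le: "\<And>x. norm (f x) \<le> h x"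
  shows "loc_integrable f"
  unfolding loc_integrable_def
proof (intro conjI allI impI)
  show "f \<in> borel_measurable lborel" using f by simp
  fix K :: "'a set" assume K: "compact K"
  then have [measurable]: "K \<in> sets borel" by (rule borel_compact)
  note f[measurable]
  have "integrable lborel (\<lambda>x. indicator K x *\<^sub>R h x)" using h K by (simp add: loc_integrable_def set_integrable_def)
  then show "set_integrable lborel K f" unfolding set_integrable_def
  proof (rule Bochner_Integration.integrable_bound)
    show "AE x in lborel. norm (indicator K x *\<^sub>R f x) \<le> norm (indicator K x *\<^sub>R h x)"
      using le by (intro AE_I2) (auto split: split_indicator intro: order.trans[OF _ abs_ge_self])
  qed measurable
qed

lemma loc_integrable_const: "loc_integrable (\<lambda>x::'a::euclidean_space. c::real)"
  unfolding loc_integrable_def set_integrable_def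
  using emeasure_compact_finite
  by (auto intro!: integrable_mult_left integrable_real_indicator simp: borel_compact)

lemma loc_integrable_add:
  fixes f g :: "'a::euclidean_space \<Rightarrow> real"
  assumes "loc_integrable f" "loc_integrable g" shows "loc_integrable (\<lambda>x. f x + g x)"
  using assms unfolding loc_integrable_def by (auto intro: set_integral_add)

lemma integrable_imp_loc_integrable:
  fixes f :: "'a::euclidean_space \<Rightarrow> real"
  assumes "integrable lborel f" shows "loc_integrable f"
  unfolding loc_integrable_def set_integrable_def
  using assms integrable_mult_indicator[OF _ assms] borel_compact borel_measurable_integrable[OF assms]
  by (metis measurable_lborel1 sets_lborel)

lemma powr_integrable_imp_loc_integrable:
  fixes f :: "'a::euclidean_space \<Rightarrow> 'b::{banach,second_countable_topology}"
  assumes f: "f \<in> borel_measurable borel" and p: "1 \<le> p" and int: "integrable lborel (\<lambda>x. norm (f x) powr p)"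
  shows "loc_integrable f"
proof (rule loc_integrable_bound[OF f])
  show "loc_integrable (\<lambda>x. 1 + norm (f x) powr p)"
    by (intro loc_integrable_add loc_integrable_const integrable_imp_loc_integrable int)
  fix x show "norm (f x) \<le> 1 + norm (f x) powr p"
  proof (cases "norm (f x) \<le> 1")
    case False
    then have "norm (f x) powr 1 \<le> norm (f x) powr p" using p by (intro powr_mono) auto
    then show ?thesis by simp
  qed (simp add: add_increasing2)
qed

text \<open>On almost every line this is the one-dimensional chain rule; the bound on
  \<open>F'\<close> keeps the composition and its gradient locally integrable.\<close>

lemma weak_gradient_chain:
  fixes u :: "'a::euclidean_space \<Rightarrow> real"
  assumes w: "weak_gradient u g"
    and F: "\<And>x. (F has_real_derivative F' x) (at x)" and F': "continuous_on UNIV F'"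
    and L: "\<And>x. \<bar>F' x\<bar> \<le> L"
  shows "weak_gradient (\<lambda>x. F (u x)) (\<lambda>x. F' (u x) *\<^sub>R g x)"
proof (rule weak_gradientI_ac_on_line)
  have u: "loc_integrable u" and g: "loc_integrable g" using w by (auto simp: weak_gradient_def)
  have [measurable]: "u \<in> borel_measurable borel" "g \<in> borel_measurable borel" using u g by (auto simp: loc_integrable_def)
  have [measurable]: "F \<in> borel_measurable borel" "F' \<in> borel_measurable borel"
    using F F' by (auto intro!: borel_measurable_continuous_onI continuous_at_imp_continuous_on DERIV_isCont)
  have abs: "loc_integrable (\<lambda>x. c * norm (f x))" if "loc_integrable f" for f :: "'a \<Rightarrow> 'b::{banach,second_countable_topology}" and c
    using that unfolding loc_integrable_def by (auto intro!: set_integrable_mult_right set_integrable_norm)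
  show "loc_integrable (\<lambda>x. F (u x))"
  proof (rule loc_integrable_bound)
    show "loc_integrable (\<lambda>x. \<bar>F 0\<bar> + L * norm (u x))" by (intro loc_integrable_add loc_integrable_const abs u)
    fix x
    obtain z where "F (u x) - F 0 = F' z * (u x - 0)" using MVT_closed_segment[OF F] by blast
    then have "\<bar>F (u x) - F 0\<bar> \<le> L * \<bar>u x\<bar>" using L[of z] by (simp add: abs_mult mult_right_mono)
    then show "norm (F (u x)) \<le> \<bar>F 0\<bar> + L * norm (u x)" by auto
  qed simp
  show "loc_integrable (\<lambda>x. F' (u x) *\<^sub>R g x)"
    by (rule loc_integrable_bound[OF _ abs[OF g, of L]]) (auto intro!: mult_right_mono L)
  fix i :: 'a
  show "AE x in lborel. ac_on_line i (\<lambda>x. F (u x)) (\<lambda>x. F' (u x) *\<^sub>R g x \<bullet> i) x"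
    using weak_gradient_ac_on_line[OF w, of i]
    by eventually_elim (simp, rule ac_on_line_chain[OF _ _ F F'], auto)
qed

section \<open>Increments in L^p\<close>

lemma nn_integral_line_shift:
  fixes c :: "'a::euclidean_space \<Rightarrow> real"
  assumes [measurable]: "c \<in> borel_measurable borel" and ab: "a \<le> b"
  shows "(\<integral>\<^sup>+x. (\<integral>\<^sup>+r. ennreal (indicator {a..b} r * \<bar>c (x + r *\<^sub>R e)\<bar> powr p) \<partial>lborel) \<partial>lborel)
    = ennreal (b - a) * (\<integral>\<^sup>+x. ennreal (\<bar>c x\<bar> powr p) \<partial>lborel)"
proof -
  have "(\<integral>\<^sup>+x. (\<integral>\<^sup>+r. ennreal (indicator {a..b} r * \<bar>c (x + r *\<^sub>R e)\<bar> powr p) \<partial>lborel) \<partial>lborel)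
    = (\<integral>\<^sup>+r. (\<integral>\<^sup>+x. ennreal (indicator {a..b} r * \<bar>c (x + r *\<^sub>R e)\<bar> powr p) \<partial>lborel) \<partial>lborel)"
    by (rule lborel_pair.Fubini') simp
  also have "\<dots> = (\<integral>\<^sup>+r. indicator {a..b} r * (\<integral>\<^sup>+x. ennreal (\<bar>c x\<bar> powr p) \<partial>lborel) \<partial>lborel)"
  proof (intro nn_integral_cong)
    fix r
    have "(\<integral>\<^sup>+x. ennreal (\<bar>c (x + r *\<^sub>R e)\<bar> powr p) \<partial>lborel) = (\<integral>\<^sup>+x. ennreal (\<bar>c x\<bar> powr p) \<partial>lborel)"
      using nn_integral_lborel_translate[of "\<lambda>x. ennreal (\<bar>c x\<bar> powr p)"] by simp
    then show "(\<integral>\<^sup>+x. ennreal (indicator {a..b} r * \<bar>c (x + r *\<^sub>R e)\<bar> powr p) \<partial>lborel)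
       = indicator {a..b} r * (\<integral>\<^sup>+x. ennreal (\<bar>c x\<bar> powr p) \<partial>lborel)"
      by (auto split: split_indicator)
  qed
  also have "\<dots> = ennreal (b - a) * (\<integral>\<^sup>+x. ennreal (\<bar>c x\<bar> powr p) \<partial>lborel)"
    using ab by (subst nn_integral_multc) auto
  finally show ?thesis .
qed

text \<open>Jensen along the segment from \<open>x\<close> to \<open>x + e\<close>, then integration
  in \<open>x\<close>, where every point of the segment contributes the same integral.\<close>

lemma translation_estimate:
  fixes u :: "'a::euclidean_space \<Rightarrow> real"
  assumes w: "weak_gradient u g" and p: "1 < p"
  shows "(\<integral>\<^sup>+x. ennreal (\<bar>u (x + e) - u x\<bar> powr p) \<partial>lborel)
    \<le> ennreal (norm e powr p) * (\<integral>\<^sup>+x. ennreal (norm (g x) powr p) \<partial>lborel)"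
proof -
  have g: "loc_integrable g" using w by (auto simp: weak_gradient_def)
  have [measurable]: "g \<in> borel_measurable borel" using g by (auto simp: loc_integrable_def)
  have "AE x in lborel. u (x + e) - u x = (LINT r:{0..1}|lborel. g (x + r *\<^sub>R e) \<bullet> e)"
    using weak_gradient_line_increment[OF w, of 0 1 e] by simp
  moreover note loc_integrable_AE_lines[OF loc_integrable_inner[OF g, of e], of e]
  ultimately have "AE x in lborel. ennreal (\<bar>u (x + e) - u x\<bar> powr p)
     \<le> (\<integral>\<^sup>+r. ennreal (indicator {0..1} r * \<bar>g (x + r *\<^sub>R e) \<bullet> e\<bar> powr p) \<partial>lborel)"
  proof eventually_elim
    case (elim x)
    have si: "set_integrable lborel {0..1} (\<lambda>r. g (x + r *\<^sub>R e) \<bullet> e)"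
      by (rule set_integrable_subset[OF elim(2)[rule_format, of 1]]) auto
    have "\<bar>u (x + e) - u x\<bar> \<le> (LINT r:{0..1}|lborel. \<bar>g (x + r *\<^sub>R e) \<bullet> e\<bar>)"
      unfolding elim(1) using set_integral_norm_bound[OF si] by simp
    then have "ennreal (\<bar>u (x + e) - u x\<bar> powr p) \<le> ennreal ((LINT r:{0..1}|lborel. \<bar>g (x + r *\<^sub>R e) \<bullet> e\<bar>) powr p)"
      using p by (intro ennreal_leI powr_mono2) auto
    also note Jensen_powr_interval[OF p _ si]
    finally show ?case by simp
  qed
  then have "(\<integral>\<^sup>+x. ennreal (\<bar>u (x + e) - u x\<bar> powr p) \<partial>lborel)
    \<le> (\<integral>\<^sup>+x. (\<integral>\<^sup>+r. ennreal (indicator {0..1} r * \<bar>g (x + r *\<^sub>R e) \<bullet> e\<bar> powr p) \<partial>lborel) \<partial>lborel)"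
    by (rule nn_integral_mono_AE)
  also have "\<dots> = (\<integral>\<^sup>+x. ennreal (\<bar>g x \<bullet> e\<bar> powr p) \<partial>lborel)"
    using nn_integral_line_shift[of "\<lambda>x. g x \<bullet> e" 0 1 e p] by simp
  also have "\<dots> \<le> (\<integral>\<^sup>+x. ennreal (norm e powr p) * ennreal (norm (g x) powr p) \<partial>lborel)"
  proof (rule nn_integral_mono)
    fix x
    have "\<bar>g x \<bullet> e\<bar> powr p \<le> (norm (g x) * norm e) powr p"
      using p by (intro powr_mono2 Cauchy_Schwarz_ineq2) auto
    then show "ennreal (\<bar>g x \<bullet> e\<bar> powr p) \<le> ennreal (norm e powr p) * ennreal (norm (g x) powr p)"
      by (simp add: ennreal_mult[symmetric] powr_mult ennreal_leI mult.commute)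
  qed
  also have "\<dots> = ennreal (norm e powr p) * (\<integral>\<^sup>+x. ennreal (norm (g x) powr p) \<partial>lborel)"
    by (rule nn_integral_cmult) simp
  finally show ?thesis .
qed

text \<open>The displacement depends on the point, so increments for fixed shifts do not apply;
  absolute continuity on lines at both end points does. The hypothesis \<open>ns\<close> keeps the
  moved point out of the exceptional null set. Enlarging the segment to [-d, d] frees the bound from
  \<open>x\<close> and produces the factor 2 d.\<close>

lemma variable_shift_estimate:
  fixes u \<rho> :: "'a::euclidean_space \<Rightarrow> real"
  assumes w: "weak_gradient u g" and p: "1 < p" and i: "i \<in> Basis" and d: "0 < d"
    and \<rho>: "\<And>x. \<bar>\<rho> x\<bar> \<le> d" and ns: "\<And>P. AE x in lborel. P x \<Longrightarrow> AE x in lborel. P (x + \<rho> x *\<^sub>R i)"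
  shows "(\<integral>\<^sup>+x. ennreal (\<bar>u (x + \<rho> x *\<^sub>R i) - u x\<bar> powr p) \<partial>lborel)
    \<le> ennreal ((2 * d) powr p) * (\<integral>\<^sup>+x. ennreal (norm (g x) powr p) \<partial>lborel)"
proof -
  have g: "loc_integrable g" using w by (auto simp: weak_gradient_def)
  have [measurable]: "g \<in> borel_measurable borel" using g by (auto simp: loc_integrable_def)
  define c where "c x = g x \<bullet> i" for x
  have c: "loc_integrable c" unfolding c_def by (rule loc_integrable_inner[OF g])
  have ac: "AE x in lborel. ac_on_line i u c x" unfolding c_def using weak_gradient_ac_on_line[OF w] .
  from ns[OF ac] ac loc_integrable_AE_lines[OF c, of i]
  have "AE x in lborel. ennreal (\<bar>u (x + \<rho> x *\<^sub>R i) - u x\<bar> powr p)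
     \<le> ennreal ((2 * d) powr (p - 1)) * (\<integral>\<^sup>+r. ennreal (indicator {-d..d} r * \<bar>c (x + r *\<^sub>R i)\<bar> powr p) \<partial>lborel)"
  proof eventually_elim
    case (elim x)
    let ?r = "\<rho> x"
    have si: "set_integrable lborel {a..b} (\<lambda>r. c (x + r *\<^sub>R i))" for a b
    proof -
      obtain n where n: "max \<bar>a\<bar> \<bar>b\<bar> \<le> real n" using real_arch_simple by blast
      then have "{a..b} \<subseteq> {- real n..real n}" by auto
      then show ?thesis by (rule set_integrable_subset[OF elim(3)[rule_format], rotated]) simp
    qed
    from elim(2) obtain U where U: "is_primitive U (\<lambda>r. c (x + r *\<^sub>R i))" "U 0 = u x"
      "AE r in lborel. u (x + r *\<^sub>R i) = U r" unfolding ac_on_line_def by blast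
    have Ur: "u (x + ?r *\<^sub>R i) = U ?r"
      using ac_on_line_value[OF elim(1) U] .
    have "\<bar>u (x + ?r *\<^sub>R i) - u x\<bar> \<le> (LINT r:{min 0 ?r..max 0 ?r}|lborel. \<bar>c (x + r *\<^sub>R i)\<bar>)"
    proof -
      have "\<bar>u (x + ?r *\<^sub>R i) - u x\<bar> = \<bar>U (max 0 ?r) - U (min 0 ?r)\<bar>"
        unfolding Ur U(2)[symmetric] by (auto simp: max_def min_def)
      also have "\<dots> = \<bar>LINT r:{min 0 ?r..max 0 ?r}|lborel. c (x + r *\<^sub>R i)\<bar>"
        using is_primitiveD(2)[OF U(1), of "min 0 ?r" "max 0 ?r"] by simp
      also have "\<dots> \<le> (LINT r:{min 0 ?r..max 0 ?r}|lborel. \<bar>c (x + r *\<^sub>R i)\<bar>)"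
        using set_integral_norm_bound[OF si] by simp
      finally show ?thesis .
    qed
    also have "\<dots> \<le> (LINT r:{-d..d}|lborel. \<bar>c (x + r *\<^sub>R i)\<bar>)"
      unfolding set_lebesgue_integral_def
      using set_integrable_abs[OF si] \<rho>[of x] d unfolding set_integrable_def
      by (intro integral_mono) (auto split: split_indicator simp: min_def max_def split: if_splits)
    finally have "ennreal (\<bar>u (x + ?r *\<^sub>R i) - u x\<bar> powr p) \<le> ennreal ((LINT r:{-d..d}|lborel. \<bar>c (x + r *\<^sub>R i)\<bar>) powr p)"
      using p by (intro ennreal_leI powr_mono2) auto
    also note Jensen_powr_interval[OF p _ si]
    finally show ?case using d by simp
  qed
  then have "(\<integral>\<^sup>+x. ennreal (\<bar>u (x + \<rho> x *\<^sub>R i) - u x\<bar> powr p) \<partial>lborel)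
    \<le> (\<integral>\<^sup>+x. ennreal ((2 * d) powr (p - 1)) * (\<integral>\<^sup>+r. ennreal (indicator {-d..d} r * \<bar>c (x + r *\<^sub>R i)\<bar> powr p) \<partial>lborel) \<partial>lborel)"
    by (rule nn_integral_mono_AE)
  also have "\<dots> = ennreal ((2 * d) powr (p - 1)) * (\<integral>\<^sup>+x. (\<integral>\<^sup>+r. ennreal (indicator {-d..d} r * \<bar>c (x + r *\<^sub>R i)\<bar> powr p) \<partial>lborel) \<partial>lborel)"
    unfolding c_def by (rule nn_integral_cmult) simp
  also have "\<dots> = ennreal ((2 * d) powr (p - 1)) * (ennreal (d - (- d)) * (\<integral>\<^sup>+x. ennreal (\<bar>c x\<bar> powr p) \<partial>lborel))"
    by (subst nn_integral_line_shift) (use d c in \<open>auto simp: loc_integrable_def\<close>)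
  also have "\<dots> \<le> ennreal ((2 * d) powr (p - 1)) * (ennreal (d - (- d)) * (\<integral>\<^sup>+x. ennreal (norm (g x) powr p) \<partial>lborel))"
    using p i Basis_le_norm[OF i] by (intro mult_left_mono nn_integral_mono ennreal_leI powr_mono2) (auto simp: c_def)
  also have "\<dots> = ennreal ((2 * d) powr (p - 1) * (2 * d)) * (\<integral>\<^sup>+x. ennreal (norm (g x) powr p) \<partial>lborel)"
    using d by (simp add: ennreal_mult mult.assoc)
  also have "(2 * d) powr (p - 1) * (2 * d) = (2 * d) powr p" using d by (simp add: powr_diff)
  finally show ?thesis .
qed

section \<open>Higher integrability of weak solutions\<close>

text \<open>The square makes the positive part C^1, as the chain rule asks, and the quotient keeps
  it bounded.\<close>

definition cutoff_aux :: "real \<Rightarrow> real" where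
  "cutoff_aux y = (max 0 y)\<^sup>2 / (1 + (max 0 y)\<^sup>2)"

definition cutoff_aux' :: "real \<Rightarrow> real" where
  "cutoff_aux' y = 2 * max 0 y / (1 + (max 0 y)\<^sup>2)\<^sup>2"

lemma max_square_has_derivative: "((\<lambda>y::real. (max 0 y)\<^sup>2) has_real_derivative 2 * max 0 y) (at y)"
proof -
  consider "y < 0" | "y = 0" | "y > 0" by linarith
  then show ?thesis
  proof cases
    case 1
    have "((\<lambda>_. 0) has_real_derivative 0) (at y)" by simp
    then have "((\<lambda>y::real. (max 0 y)\<^sup>2) has_real_derivative 0) (at y)"
      by (rule has_field_derivative_transform_within[where d = "- y"]) (use 1 in \<open>auto simp: dist_real_def\<close>)
    with 1 show ?thesis by simp
  next
    case 2
    have "((\<lambda>h::real. (max 0 h)\<^sup>2 / h) \<longlongrightarrow> 0) (at 0)"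
    proof (rule Lim_null_comparison)
      show "\<forall>\<^sub>F h in at 0. norm ((max 0 h)\<^sup>2 / h) \<le> \<bar>h\<bar>"
        by (rule always_eventually) (auto simp: max_def power2_eq_square)
      show "((\<lambda>h::real. \<bar>h\<bar>) \<longlongrightarrow> 0) (at 0)" by (auto intro!: tendsto_eq_intros)
    qed
    with 2 show ?thesis by (simp add: has_field_derivative_iff)
  next
    case 3
    have "((\<lambda>y. y\<^sup>2) has_real_derivative 2 * y) (at y)" by (auto intro!: derivative_eq_intros)
    then have "((\<lambda>y::real. (max 0 y)\<^sup>2) has_real_derivative 2 * y) (at y)"
      by (rule has_field_derivative_transform_within[where d = y]) (use 3 in \<open>auto simp: dist_real_def\<close>)
    with 3 show ?thesis by simp
  qed
qed

lemma cutoff_aux_has_derivative: "(cutoff_aux has_real_derivative cutoff_aux' y) (at y)"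
proof -
  have pos: "1 + (max 0 y)\<^sup>2 \<noteq> 0" by (smt (verit) zero_le_power2)
  have d: "((\<lambda>y. 1 + (max 0 y)\<^sup>2) has_real_derivative 2 * max 0 y) (at y)"
    using DERIV_add[OF DERIV_const[of 1] max_square_has_derivative[of y]] by simp
  have "((\<lambda>y. (max 0 y)\<^sup>2 / (1 + (max 0 y)\<^sup>2)) has_real_derivative
     (2 * max 0 y * (1 + (max 0 y)\<^sup>2) - (max 0 y)\<^sup>2 * (2 * max 0 y)) / ((1 + (max 0 y)\<^sup>2) * (1 + (max 0 y)\<^sup>2))) (at y)"
    by (rule DERIV_divide[OF max_square_has_derivative d pos])
  then show ?thesis
    unfolding cutoff_aux_def[abs_def] cutoff_aux'_def by (simp add: algebra_simps power2_eq_square)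
qed

text \<open>Odd, bounded by 1, zero on [-1, 1] and of size at least 1/2 beyond 2:
  \<open>l * cutoff (u x / l)\<close> vanishes where |u| \<le> l and has size at least l / 2 where
  |u| \<ge> 2 l.\<close>

definition cutoff :: "real \<Rightarrow> real" where
  "cutoff x = cutoff_aux (x - 1) - cutoff_aux (- x - 1)"

definition cutoff' :: "real \<Rightarrow> real" where
  "cutoff' x = cutoff_aux' (x - 1) + cutoff_aux' (- x - 1)"

lemma cutoff_has_derivative: "(cutoff has_real_derivative cutoff' x) (at x)"
proof -
  have "((\<lambda>x. cutoff_aux (x - 1)) has_real_derivative cutoff_aux' (x - 1) * 1) (at x)"
    by (rule DERIV_chain2[OF cutoff_aux_has_derivative]) (auto intro!: derivative_eq_intros)
  moreover have "((\<lambda>x. cutoff_aux (- x - 1)) has_real_derivative cutoff_aux' (- x - 1) * (- 1)) (at x)"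
    by (rule DERIV_chain2[OF cutoff_aux_has_derivative]) (auto intro!: derivative_eq_intros)
  ultimately show ?thesis
    unfolding cutoff_def[abs_def] cutoff'_def by (auto intro: DERIV_cong[OF DERIV_diff])
qed

lemma cutoff'_continuous: "continuous_on S cutoff'"
proof -
  have "1 + (max 0 y)\<^sup>2 \<noteq> 0" for y :: real by (smt (verit) zero_le_power2)
  then show ?thesis
    unfolding cutoff'_def[abs_def] cutoff_aux'_def by (intro continuous_intros) auto
qed

lemma cutoff_aux'_bounds: "0 \<le> cutoff_aux' y" "cutoff_aux' y \<le> 2"
proof -
  define m where "m = max 0 y"
  have m: "m \<ge> 0" by (simp add: m_def)
  show "0 \<le> cutoff_aux' y" unfolding cutoff_aux'_def by simp
  have "m \<le> 1 + m\<^sup>2" using zero_le_power2[of "m - 1"] m by (simp add: power2_eq_square algebra_simps)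
  also have "\<dots> \<le> (1 + m\<^sup>2)\<^sup>2" by (simp add: self_le_power)
  finally have "2 * m \<le> 2 * (1 + m\<^sup>2)\<^sup>2" by simp
  then show "cutoff_aux' y \<le> 2"
    unfolding cutoff_aux'_def m_def[symmetric]
    using add_pos_nonneg[of 1 "m\<^sup>2"] by (simp add: pos_divide_le_eq)
qed

lemma cutoff'_bounds: "0 \<le> cutoff' x" "cutoff' x \<le> 4"
  using cutoff_aux'_bounds[of "x - 1"] cutoff_aux'_bounds[of "- x - 1"] by (auto simp: cutoff'_def)

lemma cutoff_aux_bounds: "0 \<le> cutoff_aux y" "cutoff_aux y \<le> 1"
  unfolding cutoff_aux_def by (auto simp: divide_le_eq add_pos_nonneg)

lemma cutoff_aux_eq_0: "y \<le> 0 \<Longrightarrow> cutoff_aux y = 0"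
  by (simp add: cutoff_aux_def)

lemma cutoff_eq_0: "\<bar>x\<bar> \<le> 1 \<Longrightarrow> cutoff x = 0"
  by (simp add: cutoff_def cutoff_aux_eq_0)

lemma cutoff_le_1: "\<bar>cutoff x\<bar> \<le> 1"
  using cutoff_aux_bounds[of "x - 1"] cutoff_aux_bounds[of "- x - 1"] by (auto simp: cutoff_def)

lemma cutoff_ge_half:
  assumes "2 \<le> \<bar>x\<bar>" shows "1 / 2 \<le> \<bar>cutoff x\<bar>"
proof -
  have half: "1 / 2 \<le> cutoff_aux y" if "1 \<le> y" for y
  proof -
    have "1 \<le> y\<^sup>2" using that by (simp add: one_le_power)
    then show ?thesis using that add_pos_nonneg[of 1 "y\<^sup>2"] by (simp add: cutoff_aux_def pos_le_divide_eq)
  qed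
  show ?thesis
  proof (cases "0 \<le> x")
    case True
    then show ?thesis using half[of "x - 1"] cutoff_aux_eq_0[of "- x - 1"] assms by (simp add: cutoff_def)
  next
    case False
    then show ?thesis using half[of "- x - 1"] cutoff_aux_eq_0[of "x - 1"] assms by (simp add: cutoff_def)
  qed
qed

lemma cutoff_mono: "0 \<le> (cutoff x - cutoff y) * (x - y)"
proof -
  obtain z where "cutoff x - cutoff y = cutoff' z * (x - y)"
    using MVT_closed_segment[of cutoff cutoff' y x] cutoff_has_derivative by blast
  then show ?thesis using cutoff'_bounds(1)[of z] by (simp add: mult.assoc)
qed

text \<open>At least half of the translations from a ball with twice the volume of the support \<open>A\<close> move a
  given point out of \<open>A\<close>; the exponent \<open>p / N\<close> comes from the radius of that ball.\<close>

lemma level_set_estimate: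
  fixes v :: "'a::euclidean_space \<Rightarrow> real"
  assumes w: "weak_gradient v h" and p: "1 < p" and int: "integrable lborel (\<lambda>x. norm (h x) powr p)"
    and A: "A \<in> sets borel" "emeasure lborel A < \<infinity>" "\<And>x. x \<notin> A \<Longrightarrow> v x = 0"
    and B: "B \<in> sets borel" "B \<subseteq> A" "\<And>x. x \<in> B \<Longrightarrow> c \<le> \<bar>v x\<bar>" and c: "0 < c"
  shows "measure lborel B * c powr p \<le>
    2 * (2 / unit_ball_vol (real DIM('a))) powr (p / real DIM('a)) *
    measure lborel A powr (p / real DIM('a)) * (\<integral>x. norm (h x) powr p \<partial>lborel)"
proof -
  define N where "N = real DIM('a)"
  have N: "N > 0" by (simp add: N_def)
  define m where "m = measure lborel A"
  define G where "G = (\<integral>x. norm (h x) powr p \<partial>lborel)"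
  have G: "G \<ge> 0" unfolding G_def by (intro integral_nonneg_AE) auto
  have nnG: "(\<integral>\<^sup>+x. ennreal (norm (h x) powr p) \<partial>lborel) = ennreal G"
    unfolding G_def using int by (intro nn_integral_eq_integral) auto
  have em: "emeasure lborel A = ennreal m"
    unfolding m_def using A(2) by (intro emeasure_eq_ennreal_measure) auto
  have mB: "measure lborel B \<le> m" unfolding m_def
    using A B by (intro measure_mono_fmeasurable) (auto simp: fmeasurable_def)
  have eB: "emeasure lborel B = ennreal (measure lborel B)"
    using emeasure_mono[OF B(2), of lborel] A by (intro emeasure_eq_ennreal_measure) auto
  have [measurable]: "v \<in> borel_measurable borel" "A \<in> sets borel" "B \<in> sets borel"
    using w A B by (auto simp: weak_gradient_def loc_integrable_def)
  show ?thesis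
  proof (cases "m = 0")
    case True
    then show ?thesis using mB by (simp add: m_def[symmetric] measure_le_0_iff)
  next
    case False
    then have m: "m > 0" unfolding m_def by (simp add: zero_less_measure_iff)
    define V where "V = unit_ball_vol N"
    have V: "V > 0" unfolding V_def using N by simp
    define \<rho> where "\<rho> = (2 * m / V) powr (1 / N)"
    have \<rho>: "\<rho> > 0" unfolding \<rho>_def using m V by simp
    have eQ: "emeasure lborel (ball (0::'a) \<rho>) = ennreal (2 * m)"
    proof -
      have "\<rho> ^ DIM('a) = \<rho> powr N" using \<rho> by (simp add: N_def powr_realpow)
      also have "\<dots> = 2 * m / V" unfolding \<rho>_def using N m V by (simp add: powr_powr)
      finally show ?thesis using \<rho> V by (subst emeasure_ball) (auto simp: V_def N_def)
    qed
    have [measurable]: "ball (0::'a) \<rho> \<in> sets borel" by simp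
    \<comment> \<open>This double integral is estimated twice: integrating in \<open>x\<close> first
      gives the upper bound by translations, integrating in \<open>e\<close> first gives the lower
      bound on \<open>B\<close>.\<close>
    let ?I = "\<integral>\<^sup>+e. (\<integral>\<^sup>+x. indicator (ball 0 \<rho>) e * ennreal (\<bar>v (x + e) - v x\<bar> powr p) \<partial>lborel) \<partial>(lborel::'a measure)"
    have "?I \<le> (\<integral>\<^sup>+e. indicator (ball 0 \<rho>) e * ennreal (\<rho> powr p * G) \<partial>(lborel::'a measure))"
    proof (rule nn_integral_mono)
      fix e :: 'a
      show "(\<integral>\<^sup>+x. indicator (ball 0 \<rho>) e * ennreal (\<bar>v (x + e) - v x\<bar> powr p) \<partial>lborel)
        \<le> indicator (ball 0 \<rho>) e * ennreal (\<rho> powr p * G)"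
      proof (cases "e \<in> ball 0 \<rho>")
        case True
        have "(\<integral>\<^sup>+x. ennreal (\<bar>v (x + e) - v x\<bar> powr p) \<partial>lborel) \<le> ennreal (norm e powr p) * ennreal G"
          using translation_estimate[OF w p, of e] by (simp add: nnG)
        also have "\<dots> \<le> ennreal (\<rho> powr p * G)"
          using True p G by (subst ennreal_mult[symmetric]) (auto intro!: ennreal_leI mult_right_mono powr_mono2)
        finally show ?thesis using True by simp
      qed simp
    qed
    also have "\<dots> = ennreal (2 * m) * ennreal (\<rho> powr p * G)"
      by (simp add: nn_integral_multc eQ)
    finally have upper: "?I \<le> ennreal (2 * m * (\<rho> powr p * G))"
      using m G by (simp add: ennreal_mult)
    have "ennreal (m * c powr p * measure lborel B) = (\<integral>\<^sup>+x. ennreal (m * c powr p) * indicator B x \<partial>lborel)"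
      using m by (simp add: nn_integral_cmult_indicator eB ennreal_mult)
    also have "\<dots> \<le> (\<integral>\<^sup>+x. (\<integral>\<^sup>+e. indicator (ball 0 \<rho>) e * ennreal (\<bar>v (x + e) - v x\<bar> powr p) \<partial>lborel) \<partial>lborel)"
    proof (rule nn_integral_mono)
      fix x
      show "ennreal (m * c powr p) * indicator B x \<le> (\<integral>\<^sup>+e. indicator (ball 0 \<rho>) e * ennreal (\<bar>v (x + e) - v x\<bar> powr p) \<partial>lborel)"
      proof (cases "x \<in> B")
        case True
        let ?S = "{e. x + e \<in> A}"
        have [measurable]: "?S \<in> sets borel" by measurable
        have "emeasure lborel ?S = (\<integral>\<^sup>+e. indicator A (e + x) \<partial>lborel)"
        proof -
          have "emeasure lborel ?S = (\<integral>\<^sup>+e. indicator ?S e \<partial>lborel)" by simp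
          also have "\<dots> = (\<integral>\<^sup>+e. indicator A (e + x) \<partial>lborel)"
            by (intro nn_integral_cong) (simp add: indicator_def add.commute)
          finally show ?thesis .
        qed
        also have "\<dots> = ennreal m" using nn_integral_lborel_translate[of "indicator A" x] by (simp add: em)
        finally have eS: "emeasure lborel ?S = ennreal m" .
        have "ennreal (2 * m) \<le> emeasure lborel (ball 0 \<rho> - ?S) + emeasure lborel ?S"
          unfolding eQ[symmetric] by (rule order.trans[OF emeasure_mono emeasure_subadditive]) auto
        then have "ennreal (2 * m) - ennreal m \<le> emeasure lborel (ball 0 \<rho> - ?S)"
          unfolding eS by (subst ennreal_minus_le_iff) (auto simp: add.commute)
        then have "ennreal m \<le> emeasure lborel (ball 0 \<rho> - ?S)"
          using m by (simp add: ennreal_minus)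
        then have "ennreal (m * c powr p) \<le> ennreal (c powr p) * emeasure lborel (ball 0 \<rho> - ?S)"
          using m by (subst mult.commute) (simp only: ennreal_mult less_imp_le powr_ge_zero, rule mult_left_mono, auto)
        also have "\<dots> = (\<integral>\<^sup>+e. ennreal (c powr p) * indicator (ball 0 \<rho> - ?S) e \<partial>lborel)"
          by (simp add: nn_integral_cmult_indicator)
        also have "\<dots> \<le> (\<integral>\<^sup>+e. indicator (ball 0 \<rho>) e * ennreal (\<bar>v (x + e) - v x\<bar> powr p) \<partial>lborel)"
        proof (rule nn_integral_mono)
          fix e
          have "c powr p \<le> \<bar>v (x + e) - v x\<bar> powr p" if "x + e \<notin> A"
            using A(3)[OF that] B(3)[OF True] c p by (intro powr_mono2) auto
          then show "ennreal (c powr p) * indicator (ball 0 \<rho> - ?S) e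
             \<le> indicator (ball 0 \<rho>) e * ennreal (\<bar>v (x + e) - v x\<bar> powr p)"
            by (auto split: split_indicator intro: ennreal_leI)
        qed
        finally show ?thesis using True by simp
      qed simp
    qed
    also have "\<dots> = ?I" by (rule lborel_pair.Fubini') simp
    also note upper
    finally have "m * c powr p * measure lborel B \<le> 2 * m * (\<rho> powr p * G)"
      using m \<rho> G by (subst (asm) ennreal_le_iff) auto
    then have "c powr p * measure lborel B \<le> 2 * (\<rho> powr p * G)" using m by (simp add: mult.assoc mult.left_commute[of _ m])
    moreover have "\<rho> powr p = (2 / V) powr (p / N) * m powr (p / N)"
      unfolding \<rho>_def using m V by (simp add: powr_powr powr_mult[symmetric] powr_divide)
    ultimately show ?thesis unfolding G_def[symmetric] m_def[symmetric] N_def[symmetric] V_def[symmetric] by (simp add: mult_ac)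
  qed
qed

section \<open>Dyadic iteration of tails\<close>

lemma dyadic_level:
  fixes U :: real
  assumes "2 ^ K < U"
  obtains k where "2 ^ (K + k) < U" "U \<le> 2 ^ (K + k + 1)"
proof -
  obtain n :: nat where n: "U < 2 ^ n" using real_arch_pow[of 2 U] by auto
  define j where "j = (LEAST j. U \<le> 2 ^ j)"
  have j: "U \<le> 2 ^ j" unfolding j_def by (rule LeastI[of _ n]) (use n in simp)
  have lt: "2 ^ i < U" if "i < j" for i using not_less_Least[of i] that unfolding j_def by force
  have "K < j"
  proof (rule ccontr)
    assume "\<not> K < j"
    then have "(2::real) ^ j \<le> 2 ^ K" by (intro power_increasing) auto
    with j assms show False by simp
  qed
  then show ?thesis using that[of "j - 1 - K"] lt[of "j - 1"] j by simp
qed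

text \<open>The bound by \<open>2 ^ (K + n)\<close> strengthens the induction: when the next level
  is still below \<open>U\<close>, it turns into the bound by \<open>2 * U\<close>.\<close>

lemma dyadic_sum_upper:
  fixes U :: real
  assumes "0 \<le> U"
  shows "(\<Sum>k<n. 2 ^ (K + k) * indicator {2 ^ (K + k)<..} U) \<le> 2 * U
       \<and> (\<Sum>k<n. 2 ^ (K + k) * indicator {2 ^ (K + k)<..} U) \<le> (2 ^ (K + n) :: real)"
proof (induction n)
  case 0
  then show ?case using assms by simp
next
  case (Suc n)
  show ?case
  proof (cases "2 ^ (K + n) < U")
    case True
    then show ?thesis using Suc by (simp del: power_Suc add: power_add) (simp add: power_add)
  next
    case False
    have "(2::real) ^ (K + n) \<le> 2 ^ (K + Suc n)" by (intro power_increasing) auto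
    with False Suc show ?thesis by simp
  qed
qed

lemma ennreal_suminf_single_le: "f k \<le> suminf f" for f :: "nat \<Rightarrow> ennreal"
  using sum_le_suminf[of f "{k}"] by simp

text \<open>The level inequalities are summed over k \<ge> K. On the left every value of
  \<open>U\<close> above \<open>2 ^ Suc K\<close> is at most four times the level it is charged to,
  hence 4^q. On the right the levels below \<open>U\<close> add up geometrically to at most 2 U,
  which raises U^(q-1) to U^q.\<close>

lemma level_iteration_step:
  fixes U :: "'a::euclidean_space \<Rightarrow> real"
  assumes [measurable]: "U \<in> borel_measurable borel" and U: "\<And>x. 0 \<le> U x"
    and q: "1 \<le> q" and C: "0 \<le> C"
    and le: "\<And>k. K \<le> k \<Longrightarrow> ennreal ((2 ^ k) powr q) * emeasure lborel {x. 2 * 2 ^ k < U x}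
       \<le> ennreal C * (ennreal (2 ^ k) * (\<integral>\<^sup>+x. ennreal (indicator {2 ^ k<..} (U x) * U x powr (q - 1)) \<partial>lborel))"
  shows "(\<integral>\<^sup>+x. ennreal (indicator {2 ^ Suc K<..} (U x) * U x powr q) \<partial>lborel)
    \<le> ennreal (2 * 4 powr q * C) * (\<integral>\<^sup>+x. ennreal (indicator {2 ^ K<..} (U x) * U x powr q) \<partial>lborel)"
proof -
  let ?l = "\<lambda>k. (2::real) ^ (K + k)"
  have "(\<integral>\<^sup>+x. ennreal (indicator {2 ^ Suc K<..} (U x) * U x powr q) \<partial>lborel)
    \<le> (\<integral>\<^sup>+x. ennreal (4 powr q) * (\<Sum>k. ennreal (?l k powr q) * indicator {x. 2 * ?l k < U x} x) \<partial>lborel)"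
  proof (rule nn_integral_mono)
    fix x
    show "ennreal (indicator {2 ^ Suc K<..} (U x) * U x powr q)
      \<le> ennreal (4 powr q) * (\<Sum>k. ennreal (?l k powr q) * indicator {x. 2 * ?l k < U x} x)"
    proof (cases "2 ^ Suc K < U x")
      case True
      then obtain k where k: "2 ^ (Suc K + k) < U x" "U x \<le> 2 ^ (Suc K + k + 1)" by (rule dyadic_level)
      have "U x powr q \<le> (4 * ?l k) powr q" using k U q by (intro powr_mono2) (auto simp: power_add)
      also have "\<dots> = 4 powr q * ?l k powr q" by (rule powr_mult)
      finally have "ennreal (U x powr q) \<le> ennreal (4 powr q) * ennreal (?l k powr q)"
        by (simp add: ennreal_mult[symmetric] ennreal_leI)
      also have "\<dots> = ennreal (4 powr q) * (ennreal (?l k powr q) * indicator {x. 2 * ?l k < U x} x)"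
        using k(1) by simp
      also have "\<dots> \<le> ennreal (4 powr q) * (\<Sum>k. ennreal (?l k powr q) * indicator {x. 2 * ?l k < U x} x)"
        by (intro mult_left_mono ennreal_suminf_single_le) auto
      finally show ?thesis using True by simp
    qed simp
  qed
  also have "\<dots> = ennreal (4 powr q) * (\<Sum>k. ennreal (?l k powr q) * emeasure lborel {x. 2 * ?l k < U x})"
    by (subst nn_integral_cmult, measurable) (subst nn_integral_suminf, auto simp: nn_integral_cmult_indicator)
  also have "\<dots> \<le> ennreal (4 powr q) * (\<Sum>k. ennreal C * (ennreal (?l k) * (\<integral>\<^sup>+x. ennreal (indicator {?l k<..} (U x) * U x powr (q - 1)) \<partial>lborel)))"
    by (intro mult_left_mono suminf_le le) auto
  also have "\<dots> = ennreal (4 powr q) * (ennreal C * (\<integral>\<^sup>+x. (\<Sum>k. ennreal (?l k) * ennreal (indicator {?l k<..} (U x) * U x powr (q - 1))) \<partial>lborel))"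
    by (simp add: nn_integral_suminf nn_integral_cmult)
  also have "\<dots> \<le> ennreal (4 powr q) * (ennreal C * (\<integral>\<^sup>+x. ennreal 2 * ennreal (indicator {2 ^ K<..} (U x) * U x powr q) \<partial>lborel))"
  proof (intro mult_left_mono nn_integral_mono)
    fix x
    show "(\<Sum>k. ennreal (?l k) * ennreal (indicator {?l k<..} (U x) * U x powr (q - 1)))
       \<le> ennreal 2 * ennreal (indicator {2 ^ K<..} (U x) * U x powr q)"
    proof (cases "2 ^ K < U x")
      case True
      have "(\<Sum>k<n. ennreal (?l k) * ennreal (indicator {?l k<..} (U x) * U x powr (q - 1))) \<le> ennreal 2 * ennreal (U x powr q)" for n
      proof -
        have "(\<Sum>k<n. ennreal (?l k) * ennreal (indicator {?l k<..} (U x) * U x powr (q - 1)))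
          = ennreal (\<Sum>k<n. ?l k * indicator {?l k<..} (U x) * U x powr (q - 1))"
          by (subst sum_ennreal[symmetric]) (auto simp: ennreal_mult[symmetric] mult.assoc)
        also have "\<dots> = ennreal ((\<Sum>k<n. ?l k * indicator {?l k<..} (U x)) * U x powr (q - 1))"
          by (simp only: sum_distrib_right)
        also have "\<dots> \<le> ennreal (2 * U x * U x powr (q - 1))"
          using dyadic_sum_upper[OF U[of x], of K n] by (intro ennreal_leI mult_right_mono) auto
        also have "2 * U x * U x powr (q - 1) = 2 * U x powr q"
          using U[of x] True by (cases "U x = 0") (auto simp: powr_diff)
        finally show ?thesis by (simp add: ennreal_mult)
      qed
      then have "(\<Sum>k. ennreal (?l k) * ennreal (indicator {?l k<..} (U x) * U x powr (q - 1))) \<le> ennreal 2 * ennreal (U x powr q)"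
        by (intro suminf_le_const) auto
      with True show ?thesis by simp
    next
      case False
      have "\<not> ?l k < U x" for k
      proof -
        have "(2::real) ^ K \<le> ?l k" by (intro power_increasing) auto
        with False show ?thesis by linarith
      qed
      then show ?thesis by simp
    qed
  qed auto
  also have "\<dots> = ennreal (2 * 4 powr q * C) * (\<integral>\<^sup>+x. ennreal (indicator {2 ^ K<..} (U x) * U x powr q) \<partial>lborel)"
    using C by (subst nn_integral_cmult) (auto simp: ennreal_mult mult_ac)
  finally show ?thesis .
qed

text \<open>The recursion is superlinear: the tail at K + 1 is at most a constant times the power 1
  + \<theta> of the tail at K. Since the tails tend to 0, so does the ratio of consecutive ones, and
  this beats the weights 2^(k (r - q)) of the power \<open>r\<close>.\<close>

lemma level_iteration:
  fixes U :: "'a::euclidean_space \<Rightarrow> real"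
  assumes meas: "U \<in> borel_measurable borel" and U: "\<And>x. 0 \<le> U x"
    and q: "1 \<le> q" and int: "integrable lborel (\<lambda>x. U x powr q)" and \<theta>: "0 < \<theta>" and C: "0 \<le> C"
    and le: "\<And>k. (2 ^ k) powr q * measure lborel {x. 2 * 2 ^ k < U x}
       \<le> C * (\<integral>x. indicator {2 ^ k<..} (U x) * U x powr q \<partial>lborel) powr \<theta> *
          (2 ^ k * (\<integral>x. indicator {2 ^ k<..} (U x) * U x powr (q - 1) \<partial>lborel))"
    and r: "q \<le> r"
  shows "integrable lborel (\<lambda>x. U x powr r)"
proof -
  note [measurable] = meas
  define t where "t k = (\<integral>x. indicator {2 ^ k<..} (U x) * U x powr q \<partial>lborel)" for k :: nat
  have tint: "integrable lborel (\<lambda>x. indicator {2 ^ k<..} (U x) * U x powr q)" for k :: nat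
    by (rule Bochner_Integration.integrable_bound[OF int]) (auto split: split_indicator)
  have t0: "0 \<le> t k" for k unfolding t_def by (intro integral_nonneg_AE) auto
  have nnt: "(\<integral>\<^sup>+x. ennreal (indicator {2 ^ k<..} (U x) * U x powr q) \<partial>lborel) = ennreal (t k)" for k
    unfolding t_def by (intro nn_integral_eq_integral tint) auto
  have tmono: "t l \<le> t k" if "k \<le> l" for k l
    unfolding t_def
  proof (rule integral_mono[OF tint tint])
    fix x
    have "(2::real) ^ k \<le> 2 ^ l" using that by (intro power_increasing) auto
    then have "2 ^ l < U x \<Longrightarrow> 2 ^ k < U x" by linarith
    then show "indicator {2 ^ l<..} (U x) * U x powr q \<le> indicator {2 ^ k<..} (U x) * U x powr q"
      by (auto split: split_indicator)
  qed
  have tlim: "t \<longlonglongrightarrow> 0"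
  proof -
    have "t \<longlonglongrightarrow> (\<integral>x. 0 \<partial>(lborel::'a measure))"
      unfolding t_def
    proof (rule integral_dominated_convergence[where w = "\<lambda>x. U x powr q"])
      show "AE x in lborel. (\<lambda>k. indicator {2 ^ k<..} (U x) * U x powr q) \<longlonglongrightarrow> 0"
      proof (rule AE_I2)
        fix x
        obtain n :: nat where n: "U x < 2 ^ n" using real_arch_pow[of 2 "U x"] by auto
        have "\<forall>\<^sub>F k in sequentially. indicator {2 ^ k<..} (U x) * U x powr q = 0"
        proof (rule eventually_sequentiallyI[of n])
          fix k assume "n \<le> k"
          then have "(2::real) ^ n \<le> 2 ^ k" by (intro power_increasing) auto
          then have "\<not> 2 ^ k < U x" using n by linarith
          then show "indicator {2 ^ k<..} (U x) * U x powr q = 0" by simp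
        qed
        then show "(\<lambda>k. indicator {2 ^ k<..} (U x) * U x powr q) \<longlonglongrightarrow> 0" by (rule tendsto_eventually)
      qed
    qed (use int in \<open>auto split: split_indicator\<close>)
    then show ?thesis by simp
  qed
  have emf: "emeasure lborel {x. 2 * 2 ^ k < U x} = ennreal (measure lborel {x. 2 * 2 ^ k < U x})" for k :: nat
  proof (rule emeasure_eq_ennreal_measure)
    have "emeasure lborel {x. 2 * 2 ^ k < U x} \<le> (\<integral>\<^sup>+x. ennreal (U x powr q) \<partial>lborel)"
    proof (subst nn_integral_indicator[symmetric])
      show "(\<integral>\<^sup>+x. indicator {x. 2 * 2 ^ k < U x} x \<partial>lborel) \<le> (\<integral>\<^sup>+x. ennreal (U x powr q) \<partial>lborel)"
      proof (rule nn_integral_mono)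
        fix x
        have "1 \<le> U x powr q" if "2 * 2 ^ k < U x"
        proof -
          have "(1::real) \<le> 2 ^ k" by simp
          with that have "1 \<le> U x" by linarith
          then show ?thesis using q by (intro ge_one_powr_ge_zero) auto
        qed
        then show "indicator {x. 2 * 2 ^ k < U x} x \<le> ennreal (U x powr q)" by (auto split: split_indicator)
      qed
    qed simp
    also have "\<dots> < \<infinity>" using int by (simp add: nn_integral_eq_integral)
    finally show "emeasure lborel {x. 2 * 2 ^ k < U x} \<noteq> top" by simp
  qed
  have int1: "integrable lborel (\<lambda>x. indicator {2 ^ k<..} (U x) * U x powr (q - 1))" for k :: nat
  proof (rule Bochner_Integration.integrable_bound[OF int])
    show "AE x in lborel. norm (indicator {2 ^ k<..} (U x) * U x powr (q - 1)) \<le> norm (U x powr q)"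
    proof (rule AE_I2)
      fix x
      have "U x powr (q - 1) \<le> U x powr q" if "2 ^ k < U x"
      proof -
        have "(1::real) \<le> 2 ^ k" by simp
        with that have "1 \<le> U x" by linarith
        then show ?thesis by (intro powr_mono) auto
      qed
      then show "norm (indicator {2 ^ k<..} (U x) * U x powr (q - 1)) \<le> norm (U x powr q)"
        by (auto split: split_indicator)
    qed
  qed simp
  have step: "t (Suc K) \<le> 2 * 4 powr q * (C * t K powr \<theta>) * t K" for K
  proof -
    have "ennreal (t (Suc K)) \<le> ennreal (2 * 4 powr q * (C * t K powr \<theta>)) * ennreal (t K)"
      unfolding nnt[symmetric]
    proof (rule level_iteration_step[OF meas U q])
      show "0 \<le> C * t K powr \<theta>" using C by simp
      fix k assume k: "K \<le> k"
      define I where "I = (\<integral>x. indicator {2 ^ k<..} (U x) * U x powr (q - 1) \<partial>lborel)"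
      have I: "0 \<le> I" unfolding I_def by (intro integral_nonneg_AE) auto
      have nnI: "(\<integral>\<^sup>+x. ennreal (indicator {2 ^ k<..} (U x) * U x powr (q - 1)) \<partial>lborel) = ennreal I"
        unfolding I_def by (intro nn_integral_eq_integral int1) auto
      have "(2 ^ k) powr q * measure lborel {x. 2 * 2 ^ k < U x} \<le> C * t k powr \<theta> * (2 ^ k * I)"
        using le[of k] by (simp add: t_def I_def)
      also have "\<dots> \<le> C * t K powr \<theta> * (2 ^ k * I)"
        using tmono[OF k] t0 \<theta> C I by (intro mult_right_mono mult_left_mono powr_mono2) auto
      finally show "ennreal ((2 ^ k) powr q) * emeasure lborel {x. 2 * 2 ^ k < U x}
        \<le> ennreal (C * t K powr \<theta>) * (ennreal (2 ^ k) * (\<integral>\<^sup>+x. ennreal (indicator {2 ^ k<..} (U x) * U x powr (q - 1)) \<partial>lborel))"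
        unfolding nnI emf using I C by (simp add: ennreal_mult[symmetric] ennreal_leI)
    qed
    then show ?thesis using t0 C by (simp add: ennreal_mult'[symmetric] ennreal_le_iff)
  qed
  \<comment> \<open>Half the inverse of the growth factor of the weights, so that the series at the
    end has ratio 1/2.\<close>
  define \<delta> where "\<delta> = 1 / (2 * 2 powr (r - q))"
  have \<delta>: "\<delta> > 0" by (simp add: \<delta>_def)
  have "(\<lambda>K. 2 * 4 powr q * (C * t K powr \<theta>)) \<longlonglongrightarrow> 2 * 4 powr q * (C * 0 powr \<theta>)"
    using tlim t0 \<theta> by (intro tendsto_intros tendsto_powr2) auto
  then have "\<forall>\<^sub>F K in sequentially. 2 * 4 powr q * (C * t K powr \<theta>) < \<delta>"
    using \<delta> by (intro order_tendstoD(2)) auto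
  then obtain K0 where K0: "\<And>K. K0 \<le> K \<Longrightarrow> 2 * 4 powr q * (C * t K powr \<theta>) < \<delta>"
    by (auto simp: eventually_sequentially)
  have decay: "t (K0 + k) \<le> \<delta> ^ k * t K0" for k
  proof (induction k)
    case (Suc k)
    have "t (K0 + Suc k) \<le> 2 * 4 powr q * (C * t (K0 + k) powr \<theta>) * t (K0 + k)" using step[of "K0 + k"] by simp
    also have "\<dots> \<le> \<delta> * t (K0 + k)" using K0[of "K0 + k"] t0 by (intro mult_right_mono) auto
    also have "\<dots> \<le> \<delta> * (\<delta> ^ k * t K0)" using Suc \<delta> by (intro mult_left_mono) auto
    finally show ?case by (simp add: mult_ac)
  qed simp
  let ?c = "\<lambda>k. (2 ^ (K0 + k + 1)) powr (r - q)"
  \<comment> \<open>Values up to \<open>2 ^ K0\<close> are controlled by the power \<open>q\<close>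
    alone; each larger value is charged to the tail that starts at its own dyadic layer.\<close>
  have ptw: "ennreal (U x powr r) \<le> ennreal ((2 ^ K0) powr (r - q)) * ennreal (U x powr q)
     + (\<Sum>k. ennreal (?c k) * ennreal (indicator {2 ^ (K0 + k)<..} (U x) * U x powr q))" for x
  proof (cases "2 ^ K0 < U x")
    case True
    then obtain k where k: "2 ^ (K0 + k) < U x" "U x \<le> 2 ^ (K0 + k + 1)" by (rule dyadic_level)
    have "U x powr r = U x powr (r - q) * U x powr q" by (simp add: powr_add[symmetric])
    also have "\<dots> \<le> ?c k * U x powr q" using k U r by (intro mult_right_mono powr_mono2) auto
    finally have "ennreal (U x powr r) \<le> ennreal (?c k) * ennreal (indicator {2 ^ (K0 + k)<..} (U x) * U x powr q)"
      using k by (simp add: ennreal_mult[symmetric] ennreal_leI)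
    also have "\<dots> \<le> (\<Sum>k. ennreal (?c k) * ennreal (indicator {2 ^ (K0 + k)<..} (U x) * U x powr q))"
      by (rule ennreal_suminf_single_le)
    finally show ?thesis by (simp add: add_increasing)
  next
    case False
    have "U x powr r = U x powr (r - q) * U x powr q" by (simp add: powr_add[symmetric])
    also have "\<dots> \<le> (2 ^ K0) powr (r - q) * U x powr q" using False U r by (intro mult_right_mono powr_mono2) auto
    finally have "ennreal (U x powr r) \<le> ennreal ((2 ^ K0) powr (r - q)) * ennreal (U x powr q)"
      by (simp add: ennreal_mult[symmetric] ennreal_leI)
    then show ?thesis by (simp add: add_increasing2)
  qed
  have "(\<integral>\<^sup>+x. ennreal (U x powr r) \<partial>lborel) \<le> (\<integral>\<^sup>+x. (ennreal ((2 ^ K0) powr (r - q)) * ennreal (U x powr q)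
     + (\<Sum>k. ennreal (?c k) * ennreal (indicator {2 ^ (K0 + k)<..} (U x) * U x powr q))) \<partial>lborel)"
    by (intro nn_integral_mono ptw)
  also have "\<dots> = ennreal ((2 ^ K0) powr (r - q)) * (\<integral>\<^sup>+x. ennreal (U x powr q) \<partial>lborel)
     + (\<Sum>k. ennreal (?c k) * ennreal (t (K0 + k)))"
    by (subst nn_integral_add) (auto simp: nn_integral_cmult nn_integral_suminf nnt)
  also have "\<dots> < \<infinity>"
  proof -
    have c: "?c k = (2 ^ (K0 + 1)) powr (r - q) * (2 powr (r - q)) ^ k" for k
    proof -
      have "(2::real) ^ (K0 + k + 1) = 2 ^ (K0 + 1) * 2 ^ k" by (simp add: power_add)
      then have "?c k = (2 ^ (K0 + 1)) powr (r - q) * (2 ^ k) powr (r - q)" by (simp only: powr_mult)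
      also have "((2::real) ^ k) powr (r - q) = (2 powr (r - q)) ^ k"
        by (simp add: powr_realpow[symmetric] powr_powr mult.commute)
      finally show ?thesis .
    qed
    have "(\<Sum>k. ennreal (?c k) * ennreal (t (K0 + k))) \<le> (\<Sum>k. ennreal ((2 ^ (K0 + 1)) powr (r - q) * t K0 * (1 / 2) ^ k))"
    proof (intro suminf_le)
      fix k
      have "?c k * t (K0 + k) \<le> ?c k * (\<delta> ^ k * t K0)" by (intro mult_left_mono decay) auto
      also have "\<dots> = (2 ^ (K0 + 1)) powr (r - q) * t K0 * (2 powr (r - q) * \<delta>) ^ k"
        unfolding c by (simp add: power_mult_distrib)
      also have "2 powr (r - q) * \<delta> = 1 / 2" by (simp add: \<delta>_def)
      finally show "ennreal (?c k) * ennreal (t (K0 + k)) \<le> ennreal ((2 ^ (K0 + 1)) powr (r - q) * t K0 * (1 / 2) ^ k)"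
        using t0 by (simp add: ennreal_mult[symmetric] ennreal_leI)
    qed auto
    also have "\<dots> = ennreal (\<Sum>k. (2 ^ (K0 + 1)) powr (r - q) * t K0 * (1 / 2) ^ k)"
      using t0 by (intro suminf_ennreal2 summable_mult summable_geometric; simp)
    finally have "(\<Sum>k. ennreal (?c k) * ennreal (t (K0 + k))) < \<infinity>" by (rule le_less_trans) simp
    moreover have "(\<integral>\<^sup>+x. ennreal (U x powr q) \<partial>lborel) < \<infinity>" using int by (simp add: nn_integral_eq_integral)
    ultimately show ?thesis by (simp add: ennreal_mult_less_top)
  qed
  finally show ?thesis by (intro integrableI_nonneg) auto
qed

section \<open>Truncated energies of a weak solution\<close>

lemma crit_exp_facts:
  assumes "1 < p" "p < real DIM('a::euclidean_space)"
  shows "p < crit_exp TYPE('a) p" "1 < crit_exp TYPE('a) p"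
    "crit_exp TYPE('a) p * (p / real DIM('a)) = crit_exp TYPE('a) p - p"
    "real DIM('a) / crit_exp TYPE('a) p = (real DIM('a) - p) / p"
proof -
  let ?N = "real DIM('a)"
  show *: "p < crit_exp TYPE('a) p" using assms by (simp add: crit_exp_def field_simps)
  then show "1 < crit_exp TYPE('a) p" using assms by simp
  show "crit_exp TYPE('a) p * (p / ?N) = crit_exp TYPE('a) p - p" "?N / crit_exp TYPE('a) p = (?N - p) / p"
    using assms by (auto simp: crit_exp_def divide_simps) (auto simp: algebra_simps)
qed

lemma gagliardo_measurable:
  fixes u :: "'a::euclidean_space \<Rightarrow> real"
  assumes [measurable]: "u \<in> borel_measurable borel"
  shows "gagliardo_integrand s p u \<in> borel_measurable (lborel \<Otimes>\<^sub>M lborel)"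
proof -
  have "(\<lambda>(x, y). \<bar>u x - u y\<bar> powr p / norm (x - y) powr (real DIM('a) + s * p)) \<in> borel_measurable (borel \<Otimes>\<^sub>M borel)"
    by measurable
  then show ?thesis unfolding gagliardo_integrand_def by simp
qed

text \<open>\<open>F 0 = 0\<close> reduces the L^q bound to the Lipschitz bound; the whole space has
  infinite measure, so nonzero constants are not in L^q.\<close>

lemma W_space_comp_Lipschitz:
  fixes u :: "'a::euclidean_space \<Rightarrow> real"
  assumes u: "u \<in> W_space s p" and p: "1 < p" "p < real DIM('a)"
    and F: "\<And>x. (F has_real_derivative F' x) (at x)" "continuous_on UNIV F'" "\<And>x. \<bar>F' x\<bar> \<le> L"
    and F0: "F 0 = 0" and g: "weak_gradient u g" "integrable lborel (\<lambda>x. norm (g x) powr p)"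
  shows "(\<lambda>x. F (u x)) \<in> W_space s p" "weak_gradient (\<lambda>x. F (u x)) (\<lambda>x. F' (u x) *\<^sub>R g x)"
    "integrable lborel (\<lambda>x. norm (F' (u x) *\<^sub>R g x) powr p)"
proof -
  show wg: "weak_gradient (\<lambda>x. F (u x)) (\<lambda>x. F' (u x) *\<^sub>R g x)"
    by (rule weak_gradient_chain[OF g(1) F])
  have [measurable]: "u \<in> borel_measurable borel" "g \<in> borel_measurable borel"
    using g by (auto simp: weak_gradient_def loc_integrable_def)
  have [measurable]: "F \<in> borel_measurable borel" "F' \<in> borel_measurable borel"
    using F by (auto intro!: borel_measurable_continuous_onI continuous_at_imp_continuous_on DERIV_isCont)
  have L: "0 \<le> L" using F(3)[of 0] by linarith
  have Lip: "\<bar>F a - F b\<bar> \<le> L * \<bar>a - b\<bar>" for a b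
  proof -
    obtain z where "F a - F b = F' z * (a - b)" using MVT_closed_segment[OF F(1)] by blast
    then show ?thesis using F(3)[of z] by (simp add: abs_mult mult_right_mono)
  qed
  have pw: "\<bar>F a - F b\<bar> powr r \<le> L powr r * \<bar>a - b\<bar> powr r" if "0 \<le> r" for a b r
    using powr_mono2[OF that _ Lip[of a b]] by (simp add: powr_mult)
  let ?q = "crit_exp TYPE('a) p"
  have uq: "integrable lborel (\<lambda>x. \<bar>u x\<bar> powr ?q)" and ug: "integrable (lborel \<Otimes>\<^sub>M lborel) (gagliardo_integrand s p u)"
    using u by (auto simp: W_space_def in_Lp_def)
  have q: "0 \<le> ?q" using crit_exp_facts[where 'a='a, OF p] by simp
  have "in_Lp ?q (\<lambda>x. F (u x))"
    unfolding in_Lp_def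
  proof
    show "integrable lborel (\<lambda>x. \<bar>F (u x)\<bar> powr ?q)"
      by (rule Bochner_Integration.integrable_bound[OF integrable_mult_right[OF uq, of "L powr ?q"]])
        (use pw[OF q, of "u _" 0] F0 in auto)
  qed simp
  moreover show wi: "integrable lborel (\<lambda>x. norm (F' (u x) *\<^sub>R g x) powr p)"
  proof (rule Bochner_Integration.integrable_bound[OF integrable_mult_right[OF g(2), of "L powr p"]])
    show "AE x in lborel. norm (norm (F' (u x) *\<^sub>R g x) powr p) \<le> norm (L powr p * norm (g x) powr p)"
    proof (rule AE_I2)
      fix x
      have "(\<bar>F' (u x)\<bar> * norm (g x)) powr p \<le> (L * norm (g x)) powr p"
        using F(3)[of "u x"] p by (intro powr_mono2 mult_right_mono) auto
      then show "norm (norm (F' (u x) *\<^sub>R g x) powr p) \<le> norm (L powr p * norm (g x) powr p)"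
        by (simp add: powr_mult)
    qed
  qed simp
  moreover have "integrable (lborel \<Otimes>\<^sub>M lborel) (gagliardo_integrand s p (\<lambda>x. F (u x)))"
  proof (rule Bochner_Integration.integrable_bound[OF integrable_mult_right[OF ug, of "L powr p"]])
    show "AE z in lborel \<Otimes>\<^sub>M lborel. norm (gagliardo_integrand s p (\<lambda>x. F (u x)) z) \<le> norm (L powr p * gagliardo_integrand s p u z)"
    proof (rule AE_I2)
      fix z :: "'a \<times> 'a"
      show "norm (gagliardo_integrand s p (\<lambda>x. F (u x)) z) \<le> norm (L powr p * gagliardo_integrand s p u z)"
        using pw[of p "u (fst z)" "u (snd z)"] p
        by (auto simp: gagliardo_integrand_def split_beta' intro!: divide_right_mono)
    qed
  qed (auto intro!: gagliardo_measurable)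
  ultimately show "(\<lambda>x. F (u x)) \<in> W_space s p"
    using wg unfolding W_space_def by (auto intro!: gagliardo_measurable)
qed

lemma scaled_cutoff:
  fixes l :: real
  assumes l: "0 < l"
  shows "((\<lambda>x. l * cutoff (x / l)) has_real_derivative cutoff' (x / l)) (at x)"
    "continuous_on UNIV (\<lambda>x. cutoff' (x / l))" "\<bar>cutoff' (x / l)\<bar> \<le> 4" "l * cutoff (0 / l) = 0"
proof -
  have "((\<lambda>x. x / l) has_real_derivative 1 / l) (at x)" using l by (auto intro!: derivative_eq_intros)
  from DERIV_cmult[OF DERIV_chain2[OF cutoff_has_derivative this], of l]
  show "((\<lambda>x. l * cutoff (x / l)) has_real_derivative cutoff' (x / l)) (at x)" using l by simp
  show "continuous_on UNIV (\<lambda>x. cutoff' (x / l))"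
    using l by (intro continuous_on_compose2[OF cutoff'_continuous[of UNIV]] continuous_intros) auto
  show "\<bar>cutoff' (x / l)\<bar> \<le> 4" using cutoff'_bounds[of "x / l"] by simp
  show "l * cutoff (0 / l) = 0" by (simp add: cutoff_eq_0)
qed

lemma weak_solution_energy_bound:
  fixes u :: "'a::euclidean_space \<Rightarrow> real"
  assumes sol: "weak_solution s p u" and p: "1 < p" "p < real DIM('a)"
    and g: "weak_gradient u g" "integrable lborel (\<lambda>x. norm (g x) powr p)" and l: "0 < l"
  shows "integrable lborel (\<lambda>x. cutoff' (u x / l) * norm (g x) powr p)"
    "(\<integral>x. cutoff' (u x / l) * norm (g x) powr p \<partial>lborel)
      \<le> l * (\<integral>x. indicator {l<..} \<bar>u x\<bar> * \<bar>u x\<bar> powr (crit_exp TYPE('a) p - 1) \<partial>lborel)"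
proof -
  let ?q = "crit_exp TYPE('a) p"
  note q = crit_exp_facts[where 'a='a, OF p]
  define F where "F x = l * cutoff (x / l)" for x
  define F' where "F' x = cutoff' (x / l)" for x
  note F = scaled_cutoff(1)[OF l, folded F_def F'_def]
  note F' = scaled_cutoff(2)[OF l, folded F'_def]
  note F'4 = scaled_cutoff(3)[OF l, folded F'_def]
  note F0 = scaled_cutoff(4)[OF l, folded F_def]
  have uW: "u \<in> W_space s p" using sol by (simp add: weak_solution_def)
  have [measurable]: "u \<in> borel_measurable borel" "g \<in> borel_measurable borel"
    using g by (auto simp: weak_gradient_def loc_integrable_def)
  have [measurable]: "cutoff' \<in> borel_measurable borel"
    using cutoff'_continuous by (rule borel_measurable_continuous_onI)
  have [measurable]: "F \<in> borel_measurable borel"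
    using F by (auto intro!: borel_measurable_continuous_onI continuous_at_imp_continuous_on DERIV_isCont)
  note W = W_space_comp_Lipschitz[OF uW p F F' F'4 F0 g]
  show "integrable lborel (\<lambda>x. cutoff' (u x / l) * norm (g x) powr p)"
    by (rule Bochner_Integration.integrable_bound[OF integrable_mult_right[OF g(2), of 4]])
      (use cutoff'_bounds in \<open>auto simp: abs_mult intro!: mult_right_mono\<close>)
  have eq: "(\<integral>x. norm (g x) powr (p - 2) * (g x \<bullet> (F' (u x) *\<^sub>R g x)) \<partial>lborel)
        + (\<integral>z. (case z of (x,y) \<Rightarrow>
              \<bar>u x - u y\<bar> powr (p - 2) * (u x - u y) * (F (u x) - F (u y))
                / norm (x - y) powr (real DIM('a) + s * p)) \<partial>(lborel \<Otimes>\<^sub>M lborel))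
        = (\<integral>x. \<bar>u x\<bar> powr (?q - 2) * u x * F (u x) \<partial>lborel)"
    using sol g(1) W(1,2) unfolding weak_solution_def by blast
  have "norm (g x) powr (p - 2) * (g x \<bullet> (F' (u x) *\<^sub>R g x)) = cutoff' (u x / l) * norm (g x) powr p" for x
  proof (cases "g x = 0")
    case False
    have "norm (g x) powr p = norm (g x) powr (p - 2) * norm (g x) powr 2"
      by (subst powr_add[symmetric]) simp
    also have "norm (g x) powr 2 = g x \<bullet> g x" using False by (simp add: powr_numeral power2_norm_eq_inner)
    finally show ?thesis by (simp add: F'_def)
  qed simp
  then have "(\<integral>x. cutoff' (u x / l) * norm (g x) powr p \<partial>lborel) = (\<integral>x. norm (g x) powr (p - 2) * (g x \<bullet> (F' (u x) *\<^sub>R g x)) \<partial>lborel)"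
    by simp
  also have "\<dots> \<le> (\<integral>x. \<bar>u x\<bar> powr (?q - 2) * u x * F (u x) \<partial>lborel)"
  proof -
    have "0 \<le> (\<integral>z. (case z of (x,y) \<Rightarrow>
              \<bar>u x - u y\<bar> powr (p - 2) * (u x - u y) * (F (u x) - F (u y))
                / norm (x - y) powr (real DIM('a) + s * p)) \<partial>(lborel \<Otimes>\<^sub>M lborel))"
    proof (rule integral_nonneg_AE, rule AE_I2)
      fix z :: "'a \<times> 'a"
      have "0 \<le> (a - b) * (F a - F b)" for a b
      proof -
        have "0 \<le> l * l * ((cutoff (a / l) - cutoff (b / l)) * (a / l - b / l))"
          using cutoff_mono[of "a / l" "b / l"] l by simp
        also have "\<dots> = (a - b) * (F a - F b)" using l by (simp add: F_def field_simps)
        finally show ?thesis .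
      qed
      then show "0 \<le> (case z of (x,y) \<Rightarrow>
              \<bar>u x - u y\<bar> powr (p - 2) * (u x - u y) * (F (u x) - F (u y))
                / norm (x - y) powr (real DIM('a) + s * p))"
        by (auto simp: split_beta' mult.assoc intro!: divide_nonneg_nonneg mult_nonneg_nonneg)
    qed
    with eq show ?thesis by linarith
  qed
  also have "\<dots> \<le> (\<integral>x. l * (indicator {l<..} \<bar>u x\<bar> * \<bar>u x\<bar> powr (?q - 1)) \<partial>lborel)"
  proof -
    have uq: "integrable lborel (\<lambda>x. \<bar>u x\<bar> powr ?q)" using uW by (auto simp: W_space_def in_Lp_def)
    have int: "integrable lborel (\<lambda>x. l * (indicator {l<..} \<bar>u x\<bar> * \<bar>u x\<bar> powr (?q - 1)))"
    proof (rule Bochner_Integration.integrable_bound[OF uq])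
      show "AE x in lborel. norm (l * (indicator {l<..} \<bar>u x\<bar> * \<bar>u x\<bar> powr (?q - 1))) \<le> norm (\<bar>u x\<bar> powr ?q)"
      proof (rule AE_I2)
        fix x
        have "l * \<bar>u x\<bar> powr (?q - 1) \<le> \<bar>u x\<bar> powr ?q" if "l < \<bar>u x\<bar>"
        proof -
          have "l * \<bar>u x\<bar> powr (?q - 1) \<le> \<bar>u x\<bar> * \<bar>u x\<bar> powr (?q - 1)"
            using that by (intro mult_right_mono) auto
          also have "\<dots> = \<bar>u x\<bar> powr ?q" using that l by (simp add: powr_diff)
          finally show ?thesis .
        qed
        then show "norm (l * (indicator {l<..} \<bar>u x\<bar> * \<bar>u x\<bar> powr (?q - 1))) \<le> norm (\<bar>u x\<bar> powr ?q)"
          using l by (auto split: split_indicator)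
      qed
    qed simp
    have le: "\<bar>\<bar>u x\<bar> powr (?q - 2) * u x * F (u x)\<bar> \<le> l * (indicator {l<..} \<bar>u x\<bar> * \<bar>u x\<bar> powr (?q - 1))" for x
    proof (cases "l < \<bar>u x\<bar>")
      case True
      then have "\<bar>\<bar>u x\<bar> powr (?q - 2) * u x * F (u x)\<bar> = \<bar>u x\<bar> powr (?q - 1) * \<bar>F (u x)\<bar>"
        using l by (simp add: abs_mult powr_diff power2_eq_square)
      also have "\<dots> \<le> \<bar>u x\<bar> powr (?q - 1) * l"
        using cutoff_le_1[of "u x / l"] l by (intro mult_left_mono) (auto simp: F_def abs_mult mult_left_le)
      finally show ?thesis using True by (simp add: mult.commute)
    next
      case False
      then have "F (u x) = 0" using l by (simp add: F_def cutoff_eq_0)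
      with False l show ?thesis by simp
    qed
    show ?thesis
    proof (rule integral_mono[OF _ int])
      show "integrable lborel (\<lambda>x. \<bar>u x\<bar> powr (?q - 2) * u x * F (u x))"
        by (rule Bochner_Integration.integrable_bound[OF int]) (use le in \<open>auto intro: order.trans[OF _ abs_ge_self]\<close>)
      show "\<bar>u x\<bar> powr (?q - 2) * u x * F (u x) \<le> l * (indicator {l<..} \<bar>u x\<bar> * \<bar>u x\<bar> powr (?q - 1))" for x
        using le[of x] by linarith
    qed
  qed
  finally show "(\<integral>x. cutoff' (u x / l) * norm (g x) powr p \<partial>lborel)
      \<le> l * (\<integral>x. indicator {l<..} \<bar>u x\<bar> * \<bar>u x\<bar> powr (?q - 1) \<partial>lborel)" by simp
qed

text \<open>The recursion holds with \<theta> = p / N. It combines the level set estimate between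
  the levels \<open>l\<close> and \<open>2 * l\<close>, the truncated energy bound, and Chebyshev's
  inequality for the larger level set.\<close>

lemma weak_solution_higher_integrability:
  fixes u :: "'a::euclidean_space \<Rightarrow> real"
  assumes sol: "weak_solution s p u" and p: "1 < p" "p < real DIM('a)" and r: "crit_exp TYPE('a) p \<le> r"
  shows "integrable lborel (\<lambda>x. \<bar>u x\<bar> powr r)"
proof -
  let ?q = "crit_exp TYPE('a) p" and ?N = "real DIM('a)"
  note q = crit_exp_facts[where 'a='a, OF p]
  have uW: "u \<in> W_space s p" using sol by (simp add: weak_solution_def)
  then obtain g where g: "weak_gradient u g" "integrable lborel (\<lambda>x. norm (g x) powr p)"
    and uq: "integrable lborel (\<lambda>x. \<bar>u x\<bar> powr ?q)" by (auto simp: W_space_def in_Lp_def)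
  have [measurable]: "u \<in> borel_measurable borel" "g \<in> borel_measurable borel"
    using g by (auto simp: weak_gradient_def loc_integrable_def)
  define K where "K = 2 * (2 / unit_ball_vol ?N) powr (p / ?N)"
  have K: "0 \<le> K" by (simp add: K_def)
  define C where "C = K * 4 powr (p - 1) * 2 powr p"
  have C: "0 \<le> C" using K by (simp add: C_def)
  show ?thesis
  proof (rule level_iteration[where q = ?q and \<theta> = "p / ?N" and C = C])
    show "1 \<le> ?q" "integrable lborel (\<lambda>x. \<bar>u x\<bar> powr ?q)" "0 < p / ?N" "0 \<le> C" "?q \<le> r"
      using q uq p r C by auto
    fix k :: nat
    define l where "l = (2::real) ^ k"
    have l: "0 < l" by (simp add: l_def)
    define T where "T = (\<integral>x. indicator {l<..} \<bar>u x\<bar> * \<bar>u x\<bar> powr ?q \<partial>lborel)"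
    define I where "I = (\<integral>x. indicator {l<..} \<bar>u x\<bar> * \<bar>u x\<bar> powr (?q - 1) \<partial>lborel)"
    have I: "0 \<le> I" unfolding I_def by (intro integral_nonneg_AE) auto
    have T: "0 \<le> T" unfolding T_def by (intro integral_nonneg_AE) auto
    let ?A = "{x. l < \<bar>u x\<bar>}" and ?B = "{x. 2 * l < \<bar>u x\<bar>}"
    define m where "m = measure lborel ?A"
    have Tint: "integrable lborel (\<lambda>x. indicator {l<..} \<bar>u x\<bar> * \<bar>u x\<bar> powr ?q)"
      by (rule Bochner_Integration.integrable_bound[OF uq]) (auto split: split_indicator)
    \<comment> \<open>Chebyshev's inequality; it also shows that the level set has finite
      measure.\<close>
    have "emeasure lborel ?A * ennreal (l powr ?q) \<le> ennreal T"
    proof -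
      have "emeasure lborel ?A * ennreal (l powr ?q) = (\<integral>\<^sup>+x. ennreal (l powr ?q) * indicator ?A x \<partial>lborel)"
        by (simp add: nn_integral_cmult_indicator mult.commute)
      also have "\<dots> \<le> (\<integral>\<^sup>+x. ennreal (indicator {l<..} \<bar>u x\<bar> * \<bar>u x\<bar> powr ?q) \<partial>lborel)"
        using l q by (intro nn_integral_mono) (auto split: split_indicator intro!: ennreal_leI powr_mono2)
      also have "\<dots> = ennreal T" unfolding T_def by (intro nn_integral_eq_integral Tint) auto
      finally show ?thesis .
    qed
    moreover from this have Afin: "emeasure lborel ?A < \<infinity>"
      using l by (auto simp: less_top[symmetric] ennreal_mult_eq_top_iff top_unique dest!: arg_cong[of _ top "\<lambda>x. x * ennreal (l powr ?q)"])
    moreover have em: "emeasure lborel ?A = ennreal m"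
      unfolding m_def using Afin by (intro emeasure_eq_ennreal_measure) auto
    ultimately have mT: "m * l powr ?q \<le> T" using T by (simp add: ennreal_mult'[symmetric] m_def)
    define F where "F x = l * cutoff (x / l)" for x
    define F' where "F' x = cutoff' (x / l)" for x
    note F = scaled_cutoff(1)[OF l, folded F_def F'_def]
    note F' = scaled_cutoff(2)[OF l, folded F'_def]
    note F'4 = scaled_cutoff(3)[OF l, folded F'_def]
    note F0 = scaled_cutoff(4)[OF l, folded F_def]
    note W = W_space_comp_Lipschitz[OF uW p F F' F'4 F0 g]
    note E = weak_solution_energy_bound[OF sol p g l]
    have "measure lborel ?B * (l / 2) powr p \<le> K * m powr (p / ?N) * (\<integral>x. norm (F' (u x) *\<^sub>R g x) powr p \<partial>lborel)"
      unfolding K_def m_def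
    proof (rule level_set_estimate[OF W(2) p(1) W(3)])
      show "F (u x) = 0" if "x \<notin> ?A" for x using that l by (simp add: F_def cutoff_eq_0)
      show "l / 2 \<le> \<bar>F (u x)\<bar>" if "x \<in> ?B" for x
        using cutoff_ge_half[of "u x / l"] that l by (simp add: F_def abs_mult field_simps)
    qed (use Afin l in auto)
    also have "\<dots> \<le> K * m powr (p / ?N) * (4 powr (p - 1) * (l * I))"
    proof -
      \<comment> \<open>The energy bound carries the first power of \<open>F'\<close>. Since
        \<open>F'\<close> lies between 0 and 4, its power \<open>p\<close> costs the factor 4^(p -
        1).\<close>
      have "(\<integral>x. norm (F' (u x) *\<^sub>R g x) powr p \<partial>lborel) \<le> (\<integral>x. 4 powr (p - 1) * (cutoff' (u x / l) * norm (g x) powr p) \<partial>lborel)"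
      proof (rule integral_mono[OF W(3)])
        fix x
        have "F' (u x) powr p \<le> 4 powr (p - 1) * F' (u x)"
        proof (cases "F' (u x) = 0")
          case False
          then have pos: "0 < F' (u x)" using cutoff'_bounds[of "u x / l"] by (simp add: F'_def)
          then have "F' (u x) powr p = F' (u x) powr (p - 1) * F' (u x)" by (simp add: powr_diff)
          also have "\<dots> \<le> 4 powr (p - 1) * F' (u x)"
            using pos F'4[of "u x"] p by (intro mult_right_mono powr_mono2) auto
          finally show ?thesis .
        qed simp
        then have "F' (u x) powr p * norm (g x) powr p \<le> 4 powr (p - 1) * F' (u x) * norm (g x) powr p"
          by (intro mult_right_mono) auto
        moreover have "0 \<le> F' (u x)" using cutoff'_bounds[of "u x / l"] by (simp add: F'_def)
        ultimately show "norm (F' (u x) *\<^sub>R g x) powr p \<le> 4 powr (p - 1) * (cutoff' (u x / l) * norm (g x) powr p)"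
          by (simp add: powr_mult F'_def mult.assoc)
      qed (use E(1) in simp)
      also have "\<dots> \<le> 4 powr (p - 1) * (l * I)" using E(2) by (simp add: I_def)
      finally show ?thesis using K by (intro mult_left_mono) auto
    qed
    finally have main: "measure lborel ?B * (l / 2) powr p \<le> K * m powr (p / ?N) * (4 powr (p - 1) * (l * I))" .
    \<comment> \<open>The weight is split so that l / 2, the size of the truncation on the smaller
      level set, appears to the power \<open>p\<close>.\<close>
    have "l powr ?q * measure lborel ?B = l powr (?q - p) * 2 powr p * (measure lborel ?B * (l / 2) powr p)"
      using l by (simp add: powr_divide powr_diff)
    also have "\<dots> \<le> l powr (?q - p) * 2 powr p * (K * m powr (p / ?N) * (4 powr (p - 1) * (l * I)))"
      by (intro mult_left_mono main) auto
    also have "\<dots> = C * (l powr (?q - p) * m powr (p / ?N)) * (l * I)" by (simp add: C_def mult_ac)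
    \<comment> \<open>Criticality enters here: q p / N = q - p, so l^(q - p) is exactly the factor
      that lets Chebyshev absorb the measure \<open>m\<close>.\<close>
    also have "l powr (?q - p) * m powr (p / ?N) = (m * l powr ?q) powr (p / ?N)"
      using l q(3) by (simp add: powr_mult powr_powr m_def mult.commute)
    also have "C * (m * l powr ?q) powr (p / ?N) * (l * I) \<le> C * T powr (p / ?N) * (l * I)"
      using mT C l I p by (intro mult_right_mono mult_left_mono powr_mono2) (auto simp: m_def)
    finally show "(2 ^ k) powr ?q * measure lborel {x. 2 * 2 ^ k < \<bar>u x\<bar>}
       \<le> C * (\<integral>x. indicator {2 ^ k<..} \<bar>u x\<bar> * \<bar>u x\<bar> powr ?q \<partial>lborel) powr (p / ?N) *
          (2 ^ k * (\<integral>x. indicator {2 ^ k<..} \<bar>u x\<bar> * \<bar>u x\<bar> powr (?q - 1) \<partial>lborel))"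
      unfolding T_def I_def l_def .
  qed auto
qed

section \<open>Deformation of one coordinate\<close>

text \<open>The explicit map is \<open>\<tau>\<close>, and compositions are taken with its inverse \<open>\<sigma>\<close>: in the integrals
  transformed back by \<open>\<tau>\<close> the Jacobian and the kernel are then explicit.\<close>

locale coord_change =
  fixes i :: "'a::euclidean_space" and \<tau> \<tau>' \<sigma> :: "real \<Rightarrow> real"
  assumes i: "i \<in> Basis"
    and \<tau>_deriv: "\<And>r. (\<tau> has_real_derivative \<tau>' r) (at r)"
    and \<tau>'_cont: "continuous_on UNIV \<tau>'"
    and \<tau>'_lower: "\<And>r. 1 / 2 \<le> \<tau>' r" and \<tau>'_upper: "\<And>r. \<tau>' r \<le> 3 / 2"
    and \<tau>_\<sigma>: "\<And>r. \<tau> (\<sigma> r) = r"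
begin

definition Psi :: "'a \<Rightarrow> 'a" where "Psi y = y + (\<tau> (y \<bullet> i) - y \<bullet> i) *\<^sub>R i"
definition Phi :: "'a \<Rightarrow> 'a" where "Phi x = x + (\<sigma> (x \<bullet> i) - x \<bullet> i) *\<^sub>R i"

lemma \<tau>'_pos: "0 < \<tau>' r" using \<tau>'_lower[of r] by simp

lemma \<tau>_diff:
  obtains z where "\<tau> a - \<tau> b = \<tau>' z * (a - b)"
  using MVT_closed_segment[OF \<tau>_deriv] by blast

lemma \<tau>_expand: "\<bar>a - b\<bar> / 2 \<le> \<bar>\<tau> a - \<tau> b\<bar>"
proof -
  obtain z where "\<tau> a - \<tau> b = \<tau>' z * (a - b)" by (rule \<tau>_diff)
  moreover have "(1 / 2) * \<bar>a - b\<bar> \<le> \<tau>' z * \<bar>a - b\<bar>" by (intro mult_right_mono \<tau>'_lower) auto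
  ultimately show ?thesis using \<tau>'_pos[of z] by (simp add: abs_mult)
qed

lemma \<sigma>_\<tau>: "\<sigma> (\<tau> r) = r"
  using \<tau>_expand[of "\<sigma> (\<tau> r)" r] by (simp add: \<tau>_\<sigma>)

lemma \<tau>_less_iff: "\<tau> a < \<tau> b \<longleftrightarrow> a < b"
proof -
  obtain z where "\<tau> a - \<tau> b = \<tau>' z * (a - b)" by (rule \<tau>_diff)
  then show ?thesis using \<tau>'_pos[of z] by (metis diff_less_0_iff_less mult_less_0_iff not_less_iff_gr_or_eq)
qed

lemma \<sigma>_continuous: "continuous_on UNIV \<sigma>"
proof (rule continuous_at_imp_continuous_on, rule ballI)
  fix r
  show "isCont \<sigma> r"
    unfolding isCont_def tendsto_iff eventually_at
  proof (intro allI impI)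
    fix e :: real assume "0 < e"
    have "dist (\<sigma> x) (\<sigma> r) < e" if "dist x r < e / 2" for x
      using \<tau>_expand[of "\<sigma> x" "\<sigma> r"] that by (simp add: \<tau>_\<sigma> dist_real_def)
    then show "\<exists>d>0. \<forall>x\<in>UNIV. x \<noteq> r \<and> dist x r < d \<longrightarrow> dist (\<sigma> x) (\<sigma> r) < e"
      using \<open>0 < e\<close> by (intro exI[of _ "e / 2"]) auto
  qed
qed

lemma \<sigma>_deriv: "(\<sigma> has_real_derivative 1 / \<tau>' (\<sigma> r)) (at r)"
proof -
  have "isCont \<sigma> r" using \<sigma>_continuous by (simp add: continuous_on_eq_continuous_at)
  then have "(\<sigma> has_real_derivative inverse (\<tau>' (\<sigma> r))) (at r)"
    using \<tau>'_pos[of "\<sigma> r"] \<tau>_\<sigma>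
    by (intro DERIV_inverse_function[where f = \<tau> and a = "r - 1" and b = "r + 1"] \<tau>_deriv) auto
  then show ?thesis by (simp add: inverse_eq_divide)
qed

lemma Psi_inner: "Psi y \<bullet> i = \<tau> (y \<bullet> i)" "j \<in> Basis \<Longrightarrow> j \<noteq> i \<Longrightarrow> Psi y \<bullet> j = y \<bullet> j"
  using i by (auto simp: Psi_def inner_add_left inner_Basis)

lemma Phi_inner: "Phi x \<bullet> i = \<sigma> (x \<bullet> i)" "j \<in> Basis \<Longrightarrow> j \<noteq> i \<Longrightarrow> Phi x \<bullet> j = x \<bullet> j"
  using i by (auto simp: Phi_def inner_add_left inner_Basis)

lemma Phi_Psi: "Phi (Psi y) = y"
  unfolding Phi_def Psi_inner \<sigma>_\<tau> by (simp add: Psi_def scaleR_add_left[symmetric])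

lemma measurable_1d [measurable]: "\<tau> \<in> borel_measurable borel" "\<tau>' \<in> borel_measurable borel" "\<sigma> \<in> borel_measurable borel"
  using \<tau>_deriv \<tau>'_cont \<sigma>_continuous
  by (auto intro!: borel_measurable_continuous_onI continuous_at_imp_continuous_on DERIV_isCont)

lemma measurable_maps [measurable]: "Psi \<in> borel_measurable borel" "Phi \<in> borel_measurable borel"
  unfolding Psi_def[abs_def] Phi_def[abs_def] by measurable

section \<open>Change of variables\<close>

lemma nn_integral_\<tau>:
  assumes "l \<le> u"
  shows "(\<integral>\<^sup>+r. ennreal (\<tau>' r * indicator {l<..<u} (\<tau> r)) \<partial>lborel) = ennreal (u - l)"
proof -
  let ?a = "\<sigma> l" and ?b = "\<sigma> u"
  have ab: "?a \<le> ?b" using assms \<tau>_less_iff[of ?b ?a] by (simp add: \<tau>_\<sigma> not_less[symmetric])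
  have "ennreal (u - l) = (\<integral>\<^sup>+x. ennreal (indicator {l<..<u} x * indicator {\<tau> ?a..\<tau> ?b} x) \<partial>lborel)"
  proof -
    have "(\<integral>\<^sup>+x. ennreal (indicator {l<..<u} x * indicator {\<tau> ?a..\<tau> ?b} x) \<partial>lborel) = (\<integral>\<^sup>+x. indicator {l<..<u} x \<partial>lborel)"
      by (intro nn_integral_cong) (auto simp: \<tau>_\<sigma> split: split_indicator)
    then show ?thesis using assms by simp
  qed
  also have "\<dots> = (\<integral>\<^sup>+x. ennreal (indicator {l<..<u} (\<tau> x) * \<tau>' x * indicator {?a..?b} x) \<partial>lborel)"
    by (rule nn_integral_substitution)
      (use \<tau>_deriv \<tau>'_cont \<tau>'_pos ab in \<open>auto intro: continuous_on_subset less_imp_le simp: set_borel_measurable_def\<close>)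
  also have "\<dots> = (\<integral>\<^sup>+r. ennreal (\<tau>' r * indicator {l<..<u} (\<tau> r)) \<partial>lborel)"
  proof (intro nn_integral_cong)
    fix r
    have "r \<in> {?a..?b}" if "\<tau> r \<in> {l<..<u}"
      using that \<tau>_less_iff[of r ?a] \<tau>_less_iff[of ?b r] by (force simp: \<tau>_\<sigma>)
    then show "ennreal (indicator {l<..<u} (\<tau> r) * \<tau>' r * indicator {?a..?b} r) = ennreal (\<tau>' r * indicator {l<..<u} (\<tau> r))"
      by (auto split: split_indicator)
  qed
  finally show ?thesis by simp
qed

text \<open>Lebesgue measure is determined by its values on boxes, and on a box the integrand
  factorises over the coordinates. Only the factor of \<open>i\<close> calls for a
  substitution.\<close>

lemma lborel_Psi: "lborel = distr (density lborel (\<lambda>y. ennreal (\<tau>' (y \<bullet> i)))) borel Psi"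
proof (rule lborel_eqI)
  fix l u :: 'a assume lu: "\<And>b. b \<in> Basis \<Longrightarrow> l \<bullet> b \<le> u \<bullet> b"
  let ?f = "\<lambda>b r. if b = i then ennreal (\<tau>' r * indicator {l \<bullet> i<..<u \<bullet> i} (\<tau> r)) else indicator {l \<bullet> b<..<u \<bullet> b} r"
  have "emeasure (distr (density lborel (\<lambda>y. ennreal (\<tau>' (y \<bullet> i)))) borel Psi) (box l u)
     = (\<integral>\<^sup>+y. ennreal (\<tau>' (y \<bullet> i)) * indicator (box l u) (Psi y) \<partial>lborel)"
  proof -
    have "emeasure (distr (density lborel (\<lambda>y. ennreal (\<tau>' (y \<bullet> i)))) borel Psi) (box l u)
      = (\<integral>\<^sup>+x. indicator (box l u) x \<partial>distr (density lborel (\<lambda>y. ennreal (\<tau>' (y \<bullet> i)))) borel Psi)"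
      by simp
    then show ?thesis by (simp add: nn_integral_distr nn_integral_density del: nn_integral_indicator)
  qed
  also have "\<dots> = (\<integral>\<^sup>+y. (\<Prod>b\<in>Basis. ?f b (y \<bullet> b)) \<partial>lborel)"
  proof (intro nn_integral_cong)
    fix y
    have "(\<Prod>b\<in>Basis. ?f b (y \<bullet> b)) = ?f i (y \<bullet> i) * (\<Prod>b\<in>Basis - {i}. ?f b (y \<bullet> b))"
      using i by (simp add: prod.remove)
    also have "(\<Prod>b\<in>Basis - {i}. ?f b (y \<bullet> b)) = (\<Prod>b\<in>Basis - {i}. indicator {l \<bullet> b<..<u \<bullet> b} (Psi y \<bullet> b))"
      by (intro prod.cong) (auto simp: Psi_inner)
    also have "?f i (y \<bullet> i) = ennreal (\<tau>' (y \<bullet> i)) * indicator {l \<bullet> i<..<u \<bullet> i} (Psi y \<bullet> i)"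
      using \<tau>'_pos by (auto simp: Psi_inner split: split_indicator)
    also have "ennreal (\<tau>' (y \<bullet> i)) * indicator {l \<bullet> i<..<u \<bullet> i} (Psi y \<bullet> i) * (\<Prod>b\<in>Basis - {i}. indicator {l \<bullet> b<..<u \<bullet> b} (Psi y \<bullet> b))
      = ennreal (\<tau>' (y \<bullet> i)) * (\<Prod>b\<in>Basis. indicator {l \<bullet> b<..<u \<bullet> b} (Psi y \<bullet> b))"
      using i by (simp add: prod.remove[of Basis i] mult.assoc)
    also have "(\<Prod>b\<in>Basis. indicator {l \<bullet> b<..<u \<bullet> b} (Psi y \<bullet> b)) = (indicator (box l u) (Psi y) :: ennreal)"
      by (auto simp: mem_box indicator_def prod_zero_iff intro!: prod.neutral)
    finally show "ennreal (\<tau>' (y \<bullet> i)) * indicator (box l u) (Psi y) = (\<Prod>b\<in>Basis. ?f b (y \<bullet> b))" ..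
  qed
  also have "\<dots> = (\<Prod>b\<in>Basis. (\<integral>\<^sup>+r. ?f b r \<partial>lborel))"
    by (rule nn_integral_lborel_prod) auto
  also have "\<dots> = (\<Prod>b\<in>Basis. ennreal ((u - l) \<bullet> b))"
  proof (intro prod.cong refl)
    fix b :: 'a assume "b \<in> Basis"
    then show "(\<integral>\<^sup>+r. ?f b r \<partial>lborel) = ennreal ((u - l) \<bullet> b)"
      using lu[of b] by (cases "b = i") (simp_all add: nn_integral_\<tau> inner_diff_left)
  qed
  also have "\<dots> = ennreal (\<Prod>b\<in>Basis. (u - l) \<bullet> b)"
    using lu by (intro prod_ennreal) (auto simp: inner_diff_left)
  finally show "emeasure (distr (density lborel (\<lambda>y. ennreal (\<tau>' (y \<bullet> i)))) borel Psi) (box l u) = (\<Prod>b\<in>Basis. (u - l) \<bullet> b)" .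
qed simp

lemma nn_integral_Psi:
  assumes [measurable]: "f \<in> borel_measurable borel"
  shows "(\<integral>\<^sup>+x. f x \<partial>lborel) = (\<integral>\<^sup>+y. ennreal (\<tau>' (y \<bullet> i)) * f (Psi y) \<partial>lborel)"
  by (subst lborel_Psi) (simp add: nn_integral_distr nn_integral_density)

lemma nn_integral_Phi:
  assumes [measurable]: "f \<in> borel_measurable borel"
  shows "(\<integral>\<^sup>+x. f (Phi x) \<partial>lborel) = (\<integral>\<^sup>+y. ennreal (\<tau>' (y \<bullet> i)) * f y \<partial>lborel)"
  using nn_integral_Psi[of "\<lambda>x. f (Phi x)"] by (simp add: Phi_Psi)

lemma AE_Phi:
  assumes "AE y in lborel. P y" shows "AE x in lborel. P (Phi x)"
proof -
  from assms obtain N where N: "{x. \<not> P x} \<subseteq> N" "N \<in> null_sets lborel"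
    by (auto elim!: AE_E simp: null_sets_def)
  have [measurable]: "N \<in> sets borel" using N by auto
  have "(\<integral>\<^sup>+x. indicator N (Phi x) \<partial>lborel) = (\<integral>\<^sup>+y. ennreal (\<tau>' (y \<bullet> i)) * indicator N y \<partial>lborel)"
    by (rule nn_integral_Phi) simp
  also have "\<dots> = (\<integral>\<^sup>+y. 0 \<partial>(lborel::'a measure))"
    by (rule nn_integral_cong_AE) (use AE_not_in[OF N(2)] in \<open>eventually_elim, simp\<close>)
  finally have "AE x in lborel. (indicator N (Phi x) :: ennreal) = 0"
    by (subst nn_integral_0_iff_AE[symmetric]) auto
  then show ?thesis by eventually_elim (use N(1) in \<open>auto simp: indicator_def split: if_splits\<close>)
qed

lemma integral_Phi:
  fixes f :: "'a \<Rightarrow> real"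
  assumes [measurable]: "f \<in> borel_measurable borel" and f: "\<And>x. 0 \<le> f x" and int: "integrable lborel f"
  shows "integrable lborel (\<lambda>x. f (Phi x))" "(\<integral>x. f (Phi x) \<partial>lborel) = (\<integral>y. \<tau>' (y \<bullet> i) * f y \<partial>lborel)"
    "integrable lborel (\<lambda>y. \<tau>' (y \<bullet> i) * f y)"
proof -
  show *: "integrable lborel (\<lambda>y. \<tau>' (y \<bullet> i) * f y)"
  proof (rule Bochner_Integration.integrable_bound[OF integrable_mult_right[OF int, of "3 / 2"]])
    show "AE x in lborel. norm (\<tau>' (x \<bullet> i) * f x) \<le> norm (3 / 2 * f x)"
      using f \<tau>'_pos mult_right_mono[OF \<tau>'_upper f] by (intro AE_I2) (simp add: abs_mult less_imp_le)
  qed simp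
  have eq: "(\<integral>\<^sup>+x. ennreal (f (Phi x)) \<partial>lborel) = (\<integral>\<^sup>+y. ennreal (\<tau>' (y \<bullet> i) * f y) \<partial>lborel)"
    using f \<tau>'_pos by (subst nn_integral_Phi) (auto intro!: nn_integral_cong simp: ennreal_mult less_imp_le)
  have [simp]: "0 \<le> \<tau>' (y \<bullet> i) * f y" for y using f \<tau>'_pos by (simp add: less_imp_le)
  from eq have eq2: "(\<integral>\<^sup>+x. ennreal (f (Phi x)) \<partial>lborel) = ennreal (\<integral>y. \<tau>' (y \<bullet> i) * f y \<partial>lborel)"
    using * f \<tau>'_pos by (subst nn_integral_eq_integral[symmetric]) auto
  show "integrable lborel (\<lambda>x. f (Phi x))"
    using eq2 f by (intro integrableI_nonneg) auto
  show "(\<integral>x. f (Phi x) \<partial>lborel) = (\<integral>y. \<tau>' (y \<bullet> i) * f y \<partial>lborel)"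
    using eq2 f \<tau>'_pos by (intro integral_eq_nn_integral[THEN trans]) (auto intro!: integral_nonneg_AE)
qed

lemma nn_integral_pair_Psi:
  fixes f :: "'a \<times> 'a \<Rightarrow> ennreal"
  assumes [measurable]: "f \<in> borel_measurable (borel \<Otimes>\<^sub>M borel)"
  shows "(\<integral>\<^sup>+z. f z \<partial>(lborel \<Otimes>\<^sub>M lborel))
    = (\<integral>\<^sup>+z. ennreal (\<tau>' (fst z \<bullet> i) * \<tau>' (snd z \<bullet> i)) * f (Psi (fst z), Psi (snd z)) \<partial>(lborel \<Otimes>\<^sub>M lborel))"
proof -
  have "(\<integral>\<^sup>+z. f z \<partial>(lborel \<Otimes>\<^sub>M lborel)) = (\<integral>\<^sup>+x. (\<integral>\<^sup>+y. f (x, y) \<partial>lborel) \<partial>lborel)"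
    by (subst lborel.nn_integral_fst[symmetric]) auto
  also have "\<dots> = (\<integral>\<^sup>+x. (\<integral>\<^sup>+y. ennreal (\<tau>' (y \<bullet> i)) * f (x, Psi y) \<partial>lborel) \<partial>lborel)"
    by (intro nn_integral_cong nn_integral_Psi) simp
  also have "\<dots> = (\<integral>\<^sup>+x. ennreal (\<tau>' (x \<bullet> i)) * (\<integral>\<^sup>+y. ennreal (\<tau>' (y \<bullet> i)) * f (Psi x, Psi y) \<partial>lborel) \<partial>lborel)"
    by (rule nn_integral_Psi) simp
  also have "\<dots> = (\<integral>\<^sup>+x. (\<integral>\<^sup>+y. ennreal (\<tau>' (x \<bullet> i) * \<tau>' (y \<bullet> i)) * f (Psi x, Psi y) \<partial>lborel) \<partial>lborel)"
    using \<tau>'_pos by (intro nn_integral_cong) (simp add: nn_integral_cmult[symmetric] ennreal_mult less_imp_le mult.assoc)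
  also have "\<dots> = (\<integral>\<^sup>+z. ennreal (\<tau>' (fst z \<bullet> i) * \<tau>' (snd z \<bullet> i)) * f (Psi (fst z), Psi (snd z)) \<partial>(lborel \<Otimes>\<^sub>M lborel))"
    by (subst lborel.nn_integral_fst[symmetric]) auto
  finally show ?thesis .
qed

section \<open>The deformed gradient and the deformed kernel\<close>

text \<open>The chain rule for \<open>\<lambda>x. u (Phi x)\<close>: only the component along
  \<open>i\<close> is multiplied, by the derivative of \<open>\<sigma>\<close>.\<close>

definition grad_Phi :: "('a \<Rightarrow> 'a) \<Rightarrow> 'a \<Rightarrow> 'a" where
  "grad_Phi g x = g (Phi x) + ((1 / \<tau>' (\<sigma> (x \<bullet> i)) - 1) * (g (Phi x) \<bullet> i)) *\<^sub>R i"

text \<open>The same gradient as a function of \<open>y = Phi x\<close>, where the multiplier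
  becomes the explicit reciprocal of \<open>\<tau>'\<close>.\<close>

definition transported_grad :: "('a \<Rightarrow> 'a) \<Rightarrow> 'a \<Rightarrow> 'a" where
  "transported_grad g y = g y + ((1 / \<tau>' (y \<bullet> i) - 1) * (g y \<bullet> i)) *\<^sub>R i"

lemma grad_Phi_eq: "grad_Phi g x = transported_grad g (Phi x)"
  by (simp add: grad_Phi_def transported_grad_def Phi_inner)

lemma norm_transported_grad: "norm (transported_grad g y) \<le> 2 * norm (g y)"
proof -
  have "\<bar>1 / \<tau>' (y \<bullet> i) - 1\<bar> \<le> 1"
    using \<tau>'_lower[of "y \<bullet> i"] \<tau>'_upper[of "y \<bullet> i"] by (simp add: abs_le_iff divide_simps)
  moreover have "\<bar>g y \<bullet> i\<bar> \<le> norm (g y)" using i by (rule Basis_le_norm)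
  ultimately have "\<bar>1 / \<tau>' (y \<bullet> i) - 1\<bar> * \<bar>g y \<bullet> i\<bar> \<le> 1 * norm (g y)" by (intro mult_mono) auto
  then show ?thesis unfolding transported_grad_def
    using norm_triangle_ineq[of "g y" "((1 / \<tau>' (y \<bullet> i) - 1) * (g y \<bullet> i)) *\<^sub>R i"] i by (simp add: abs_mult)
qed

lemma norm_Psi_diff:
  "(norm (Psi x - Psi y))\<^sup>2 = (norm (x - y))\<^sup>2 + ((\<tau> (x \<bullet> i) - \<tau> (y \<bullet> i))\<^sup>2 - ((x - y) \<bullet> i)\<^sup>2)"
proof -
  define a where "a = (\<tau> (x \<bullet> i) - \<tau> (y \<bullet> i)) - (x - y) \<bullet> i"
  have "Psi x - Psi y = (x - y) + a *\<^sub>R i" by (simp add: Psi_def a_def algebra_simps inner_diff_left)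
  then have "(norm (Psi x - Psi y))\<^sup>2 = (norm (x - y))\<^sup>2 + 2 * a * ((x - y) \<bullet> i) + a\<^sup>2"
    unfolding power2_norm_eq_inner using i by (simp add: inner_add_left inner_add_right inner_commute power2_eq_square)
  also have "\<dots> = (norm (x - y))\<^sup>2 + ((a + (x - y) \<bullet> i)\<^sup>2 - ((x - y) \<bullet> i)\<^sup>2)"
    by (simp add: power2_eq_square algebra_simps)
  finally show ?thesis by (simp add: a_def)
qed

lemma norm_Psi_diff_lower: "norm (x - y) / 2 \<le> norm (Psi x - Psi y)"
proof (rule power2_le_imp_le)
  have "(\<bar>(x - y) \<bullet> i\<bar> / 2)\<^sup>2 \<le> \<bar>\<tau> (x \<bullet> i) - \<tau> (y \<bullet> i)\<bar>\<^sup>2"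
    using \<tau>_expand[of "x \<bullet> i" "y \<bullet> i"] by (intro power_mono) (auto simp: inner_diff_left)
  then have "((x - y) \<bullet> i)\<^sup>2 / 4 \<le> (\<tau> (x \<bullet> i) - \<tau> (y \<bullet> i))\<^sup>2" by (simp add: power_divide)
  moreover have "((x - y) \<bullet> i)\<^sup>2 \<le> (norm (x - y))\<^sup>2"
    using Basis_le_norm[OF i, of "x - y"] by (metis abs_ge_zero power2_abs power_mono)
  ultimately have "(norm (x - y))\<^sup>2 / 4 \<le> (norm (Psi x - Psi y))\<^sup>2" unfolding norm_Psi_diff by linarith
  then show "(norm (x - y) / 2)\<^sup>2 \<le> (norm (Psi x - Psi y))\<^sup>2" by (simp add: power_divide)
qed simp

text \<open>Changing variables in both points removes the deformation from \<open>u\<close> and puts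
  it into the kernel and two Jacobian factors.\<close>

lemma gagliardo_Phi:
  fixes u :: "'a \<Rightarrow> real"
  assumes [measurable]: "u \<in> borel_measurable borel" and p: "0 \<le> p" "0 \<le> s"
    and int: "integrable (lborel \<Otimes>\<^sub>M lborel) (gagliardo_integrand s p u)"
  defines "G \<equiv> \<lambda>z. \<tau>' (fst z \<bullet> i) * \<tau>' (snd z \<bullet> i) * (\<bar>u (fst z) - u (snd z)\<bar> powr p
      / norm (Psi (fst z) - Psi (snd z)) powr (real DIM('a) + s * p))"
  shows "integrable (lborel \<Otimes>\<^sub>M lborel) G"
    "integrable (lborel \<Otimes>\<^sub>M lborel) (gagliardo_integrand s p (\<lambda>x. u (Phi x)))"
    "integral\<^sup>L (lborel \<Otimes>\<^sub>M lborel) (gagliardo_integrand s p (\<lambda>x. u (Phi x))) = integral\<^sup>L (lborel \<Otimes>\<^sub>M lborel) G"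
proof -
  let ?\<kappa> = "real DIM('a) + s * p"
  have \<kappa>: "0 \<le> ?\<kappa>" using p by simp
  have Gm: "G \<in> borel_measurable (lborel \<Otimes>\<^sub>M lborel)"
  proof -
    have "G \<in> borel_measurable (borel \<Otimes>\<^sub>M borel)" unfolding G_def by measurable
    then show ?thesis by simp
  qed
  have G0: "0 \<le> G z" for z using \<tau>'_pos by (simp add: G_def less_imp_le)
  show Gint: "integrable (lborel \<Otimes>\<^sub>M lborel) G"
  \<comment> \<open>9/4 bounds the two Jacobian factors, and \<open>2 powr ?\<kappa>\<close> bounds
    the change of the kernel, because distances shrink at most by the factor 2.\<close>
  proof (rule Bochner_Integration.integrable_bound[OF integrable_mult_right[OF int, of "9 / 4 * 2 powr ?\<kappa>"] Gm], rule AE_I2)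
    fix z :: "'a \<times> 'a"
    obtain x y where z: "z = (x, y)" by (cases z)
    have a: "\<bar>u x - u y\<bar> powr p / norm (Psi x - Psi y) powr ?\<kappa> \<le> 2 powr ?\<kappa> * (\<bar>u x - u y\<bar> powr p / norm (x - y) powr ?\<kappa>)"
    proof (cases "x = y")
      case False
      have "(norm (x - y) / 2) powr ?\<kappa> \<le> norm (Psi x - Psi y) powr ?\<kappa>"
        using norm_Psi_diff_lower \<kappa> by (intro powr_mono2) auto
      then have "\<bar>u x - u y\<bar> powr p / norm (Psi x - Psi y) powr ?\<kappa> \<le> \<bar>u x - u y\<bar> powr p / (norm (x - y) / 2) powr ?\<kappa>"
        using False by (intro divide_left_mono mult_pos_pos) (auto simp: Phi_Psi dest: arg_cong[of _ _ Phi])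
      also have "\<dots> = 2 powr ?\<kappa> * (\<bar>u x - u y\<bar> powr p / norm (x - y) powr ?\<kappa>)" by (simp add: powr_divide)
      finally show ?thesis .
    qed simp
    have b: "\<tau>' (x \<bullet> i) * \<tau>' (y \<bullet> i) \<le> 3 / 2 * (3 / 2)"
      using \<tau>'_upper \<tau>'_pos by (intro mult_mono) (auto simp: less_imp_le)
    have "G z \<le> 3 / 2 * (3 / 2) * (2 powr ?\<kappa> * (\<bar>u x - u y\<bar> powr p / norm (x - y) powr ?\<kappa>))"
      unfolding G_def z fst_conv snd_conv by (rule mult_mono[OF b a]) auto
    then show "norm (G z) \<le> norm (9 / 4 * 2 powr ?\<kappa> * gagliardo_integrand s p u z)"
      using G0[of z] by (simp add: z gagliardo_integrand_def mult.assoc)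
  qed
  have vm: "gagliardo_integrand s p (\<lambda>x. u (Phi x)) \<in> borel_measurable (lborel \<Otimes>\<^sub>M lborel)"
    by (rule gagliardo_measurable) simp
  have v0: "0 \<le> gagliardo_integrand s p (\<lambda>x. u (Phi x)) z" for z by (simp add: gagliardo_integrand_def split_beta')
  have vm': "(\<lambda>z. ennreal (gagliardo_integrand s p (\<lambda>x. u (Phi x)) z)) \<in> borel_measurable (borel \<Otimes>\<^sub>M borel)"
    using vm by simp
  have "(\<integral>\<^sup>+z. ennreal (gagliardo_integrand s p (\<lambda>x. u (Phi x)) z) \<partial>(lborel \<Otimes>\<^sub>M lborel)) = (\<integral>\<^sup>+z. ennreal (G z) \<partial>(lborel \<Otimes>\<^sub>M lborel))"
    using \<tau>'_pos by (subst nn_integral_pair_Psi[OF vm'], intro nn_integral_cong)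
      (simp add: G_def gagliardo_integrand_def Phi_Psi ennreal_mult'[symmetric] less_imp_le)
  also have "\<dots> = ennreal (integral\<^sup>L (lborel \<Otimes>\<^sub>M lborel) G)" using Gint G0 by (intro nn_integral_eq_integral) auto
  finally have eq: "(\<integral>\<^sup>+z. ennreal (gagliardo_integrand s p (\<lambda>x. u (Phi x)) z) \<partial>(lborel \<Otimes>\<^sub>M lborel)) = ennreal (integral\<^sup>L (lborel \<Otimes>\<^sub>M lborel) G)" .
  then show "integrable (lborel \<Otimes>\<^sub>M lborel) (gagliardo_integrand s p (\<lambda>x. u (Phi x)))"
    using vm v0 by (intro integrableI_nonneg) auto
  show "integral\<^sup>L (lborel \<Otimes>\<^sub>M lborel) (gagliardo_integrand s p (\<lambda>x. u (Phi x))) = integral\<^sup>L (lborel \<Otimes>\<^sub>M lborel) G"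
    using eq vm v0 G0 by (subst integral_eq_nn_integral) (auto intro!: integral_nonneg_AE)
qed

text \<open>Coordinate lines go to coordinate lines, so the gradient of the composition is found
  line by line, without approximating \<open>u\<close> by smooth functions.\<close>

lemma W_space_Phi:
  fixes u :: "'a \<Rightarrow> real"
  assumes u: "u \<in> W_space s p" and p: "1 < p" "p < real DIM('a)" "0 \<le> s"
    and g: "weak_gradient u g" "integrable lborel (\<lambda>x. norm (g x) powr p)"
  shows "(\<lambda>x. u (Phi x)) \<in> W_space s p" "weak_gradient (\<lambda>x. u (Phi x)) (grad_Phi g)"
    "integrable lborel (\<lambda>x. norm (grad_Phi g x) powr p)"
    "(\<integral>x. norm (grad_Phi g x) powr p \<partial>lborel) = (\<integral>y. \<tau>' (y \<bullet> i) * norm (transported_grad g y) powr p \<partial>lborel)"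
    "integrable lborel (\<lambda>y. \<tau>' (y \<bullet> i) * norm (transported_grad g y) powr p)"
proof -
  let ?q = "crit_exp TYPE('a) p"
  note q = crit_exp_facts[where 'a='a, OF p(1,2)]
  have [measurable]: "u \<in> borel_measurable borel" "g \<in> borel_measurable borel"
    using g by (auto simp: weak_gradient_def loc_integrable_def)
  have [measurable]: "transported_grad g \<in> borel_measurable borel" "grad_Phi g \<in> borel_measurable borel"
    unfolding transported_grad_def[abs_def] grad_Phi_def[abs_def] by measurable
  have uq: "integrable lborel (\<lambda>x. \<bar>u x\<bar> powr ?q)" and ug: "integrable (lborel \<Otimes>\<^sub>M lborel) (gagliardo_integrand s p u)"
    using u by (auto simp: W_space_def in_Lp_def)
  have vq: "integrable lborel (\<lambda>x. \<bar>u (Phi x)\<bar> powr ?q)"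
    by (rule integral_Phi(1)[where f = "\<lambda>x. \<bar>u x\<bar> powr ?q"]) (use uq in auto)
  have tg: "integrable lborel (\<lambda>y. norm (transported_grad g y) powr p)"
  proof (rule Bochner_Integration.integrable_bound[OF integrable_mult_right[OF g(2), of "2 powr p"]])
    show "AE x in lborel. norm (norm (transported_grad g x) powr p) \<le> norm (2 powr p * norm (g x) powr p)"
    proof (rule AE_I2)
      fix x
      have "norm (transported_grad g x) powr p \<le> (2 * norm (g x)) powr p"
        using p norm_transported_grad by (intro powr_mono2) auto
      then show "norm (norm (transported_grad g x) powr p) \<le> norm (2 powr p * norm (g x) powr p)"
        by (simp add: powr_mult)
    qed
  qed simp
  note int = integral_Phi[where f = "\<lambda>y. norm (transported_grad g y) powr p", OF _ _ tg, folded grad_Phi_eq]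
  show Hint: "integrable lborel (\<lambda>x. norm (grad_Phi g x) powr p)"
    "(\<integral>x. norm (grad_Phi g x) powr p \<partial>lborel) = (\<integral>y. \<tau>' (y \<bullet> i) * norm (transported_grad g y) powr p \<partial>lborel)"
    "integrable lborel (\<lambda>y. \<tau>' (y \<bullet> i) * norm (transported_grad g y) powr p)"
    using int by auto
  show wg: "weak_gradient (\<lambda>x. u (Phi x)) (grad_Phi g)"
  proof (rule weak_gradientI_ac_on_line)
    show "loc_integrable (\<lambda>x. u (Phi x))"
      by (rule powr_integrable_imp_loc_integrable[where p = ?q]) (use vq q in auto)
    show "loc_integrable (grad_Phi g)"
      by (rule powr_integrable_imp_loc_integrable[where p = p]) (use Hint p in auto)
    fix j :: 'a assume j: "j \<in> Basis"
    \<comment> \<open>The line property is wanted at the image point \<open>Phi x\<close>; it holds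
      there for almost every \<open>x\<close> because \<open>Phi\<close> pulls null sets back to
      null sets.\<close>
    show "AE x in lborel. ac_on_line j (\<lambda>x. u (Phi x)) (\<lambda>x. grad_Phi g x \<bullet> j) x"
      using AE_Phi[OF weak_gradient_ac_on_line[OF g(1), of j]]
    proof eventually_elim
      case (elim x)
      show ?case
      proof (cases "j = i")
        case False
        show ?thesis
          by (rule ac_on_line_reparam[where \<Phi> = Phi and x = x, OF elim, where \<tau> = "\<lambda>r. r" and \<tau>' = "\<lambda>_. 1"])
            (use False i j in \<open>auto simp: Phi_def grad_Phi_def inner_add_left inner_Basis algebra_simps\<close>)
      next
        case True
        show ?thesis unfolding True
        proof (rule ac_on_line_reparam[where \<Phi> = Phi and x = x, OF elim[unfolded True], where \<tau> = "\<lambda>r. \<sigma> (x \<bullet> i + r) - \<sigma> (x \<bullet> i)"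
              and \<tau>' = "\<lambda>r. 1 / \<tau>' (\<sigma> (x \<bullet> i + r))"])
          fix r
          show "Phi (x + r *\<^sub>R i) = Phi x + (\<sigma> (x \<bullet> i + r) - \<sigma> (x \<bullet> i)) *\<^sub>R i"
            using i by (simp add: Phi_def inner_add_left algebra_simps)
          have "((\<lambda>r. \<sigma> (x \<bullet> i + r)) has_real_derivative 1 / \<tau>' (\<sigma> (x \<bullet> i + r)) * 1) (at r)"
            by (rule DERIV_chain2[OF \<sigma>_deriv]) (auto intro!: derivative_eq_intros)
          then show "((\<lambda>r. \<sigma> (x \<bullet> i + r) - \<sigma> (x \<bullet> i)) has_real_derivative 1 / \<tau>' (\<sigma> (x \<bullet> i + r))) (at r)"
            by (auto intro!: derivative_eq_intros)
          show "grad_Phi g (x + r *\<^sub>R i) \<bullet> i = g (Phi (x + r *\<^sub>R i)) \<bullet> i * (1 / \<tau>' (\<sigma> (x \<bullet> i + r)))"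
            using i by (simp add: grad_Phi_def inner_add_left algebra_simps)
          show "0 < 1 / \<tau>' (\<sigma> (x \<bullet> i + r))" using \<tau>'_pos by simp
        next
          show "continuous_on UNIV (\<lambda>r. 1 / \<tau>' (\<sigma> (x \<bullet> i + r)))"
            using \<tau>'_pos by (intro continuous_intros continuous_on_compose2[OF \<tau>'_cont] continuous_on_compose2[OF \<sigma>_continuous])
              (auto simp: less_imp_neq[symmetric] neq_iff)
        qed simp
      qed
    qed
  qed
  show "(\<lambda>x. u (Phi x)) \<in> W_space s p"
    unfolding W_space_def in_Lp_def using vq wg Hint(1) gagliardo_Phi(2)[OF _ _ p(3) ug] p
    by (auto intro!: gagliardo_measurable)
qed

end

section \<open>Second-order bounds\<close>

text \<open>The range keeps \<open>1 + x\<close> away from 0 and covers both applications below. Its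
  lower end is (1/2)^2 - 1, the value for a squared factor of 1/2.\<close>

lemma powr_second_order:
  fixes a :: real
  obtains C where "0 \<le> C" "\<And>x. - (3 / 4) \<le> x \<Longrightarrow> x \<le> 4 \<Longrightarrow> \<bar>(1 + x) powr a - 1 - a * x\<bar> \<le> C * x\<^sup>2"
proof -
  define M where "M = (1 / 4) powr (a - 2) + 5 powr (a - 2)"
  define C where "C = \<bar>a * (a - 1)\<bar> * M"
  have C: "0 \<le> C" by (simp add: C_def M_def)
  have M: "y powr (a - 2) \<le> M" if "1 / 4 \<le> y" "y \<le> 5" for y :: real
  proof (cases "0 \<le> a - 2")
    case True
    then have "y powr (a - 2) \<le> 5 powr (a - 2)" using that by (intro powr_mono2) auto
    then show ?thesis by (simp add: M_def add_increasing)
  next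
    case False
    then have "y powr (a - 2) \<le> (1 / 4) powr (a - 2)" using that by (intro powr_mono2') auto
    then show ?thesis by (simp add: M_def add_increasing2)
  qed
  have "\<bar>(1 + x) powr a - 1 - a * x\<bar> \<le> C * x\<^sup>2" if x: "- (3 / 4) \<le> x" "x \<le> 4" for x
  proof (cases "x = 0")
    case False
    define diff where "diff m t = (if m = 0 then (1 + t) powr a else if m = 1 then a * (1 + t) powr (a - 1)
      else a * (a - 1) * (1 + t) powr (a - 2))" for m :: nat and t :: real
    have "\<exists>t. (if x < 0 then x < t \<and> t < 0 else 0 < t \<and> t < x) \<and>
       (1 + x) powr a = (\<Sum>m<2. (diff m 0 / fact m) * (x - 0) ^ m) + (diff 2 t / fact 2) * (x - 0) ^ 2"
    proof (rule Taylor[where a = "- (3 / 4)" and b = 4])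
      show "\<forall>m t. m < 2 \<and> - (3 / 4) \<le> t \<and> t \<le> 4 \<longrightarrow> DERIV (diff m) t :> diff (Suc m) t"
      proof (intro allI impI)
        fix m :: nat and t :: real assume *: "m < 2 \<and> - (3 / 4) \<le> t \<and> t \<le> 4"
        then have "m = 0 \<or> m = 1" by auto
        then show "DERIV (diff m) t :> diff (Suc m) t"
        proof
          assume "m = 0"
          have "((\<lambda>t. (1 + t) powr a) has_real_derivative a * (1 + t) powr (a - 1)) (at t)"
            using * by (auto intro!: derivative_eq_intros)
          with \<open>m = 0\<close> show ?thesis by (simp add: diff_def[abs_def])
        next
          assume "m = 1"
          have "((\<lambda>t. a * (1 + t) powr (a - 1)) has_real_derivative a * ((a - 1) * (1 + t) powr (a - 2))) (at t)"
            using * by (auto intro!: derivative_eq_intros)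
          with \<open>m = 1\<close> show ?thesis by (simp add: diff_def[abs_def] mult.assoc)
        qed
      qed
    qed (use x False in \<open>auto simp: diff_def\<close>)
    then obtain t where t0: "if x < 0 then x < t \<and> t < 0 else 0 < t \<and> t < x"
      and eq: "(1 + x) powr a = (\<Sum>m<2. (diff m 0 / fact m) * (x - 0) ^ m) + (diff 2 t / fact 2) * (x - 0) ^ 2"
      by blast
    have t: "min x 0 \<le> t" "t \<le> max x 0" using t0 by (auto split: if_splits)
    from eq have eq2: "(1 + x) powr a - 1 - a * x = a * (a - 1) * (1 + t) powr (a - 2) / 2 * x\<^sup>2"
      by (simp add: numeral_2_eq_2 diff_def)
    have "\<bar>(1 + x) powr a - 1 - a * x\<bar> = \<bar>a * (a - 1)\<bar> * (1 + t) powr (a - 2) / 2 * x\<^sup>2"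
      unfolding eq2 by (simp add: abs_mult)
    also have "\<dots> \<le> C * x\<^sup>2"
    proof (rule mult_right_mono)
      have "\<bar>a * (a - 1)\<bar> * (1 + t) powr (a - 2) \<le> C"
        unfolding C_def using t x by (intro mult_left_mono M) auto
      with C show "\<bar>a * (a - 1)\<bar> * (1 + t) powr (a - 2) / 2 \<le> C" by linarith
    qed simp
    finally show ?thesis .
  qed simp
  with C show ?thesis using that by blast
qed

text \<open>\<open>1 - s\<close> is the Jacobian, \<open>1 / (1 - s)\<close> the stretching along
  \<open>i\<close>, and \<open>\<theta>\<close> the share of that direction in the squared gradient.
  Both \<open>s\<close> and \<open>\<theta>\<close> vary from point to point, so the constant must
  be uniform in them.\<close>

lemma gradient_factor_bound:
  fixes p :: real
  assumes p: "0 < p"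
  obtains C where "0 \<le> C" "\<And>s \<theta>. \<bar>s\<bar> \<le> 1 / 2 \<Longrightarrow> 0 \<le> \<theta> \<Longrightarrow> \<theta> \<le> 1 \<Longrightarrow>
    (1 - s) * (1 + \<theta> * ((1 / (1 - s))\<^sup>2 - 1)) powr (p / 2) \<le> 1 + s * (p * \<theta> - 1) + C * s\<^sup>2"
proof -
  obtain C0 where C0: "0 \<le> C0" "\<And>x. - (3 / 4) \<le> x \<Longrightarrow> x \<le> 4 \<Longrightarrow> \<bar>(1 + x) powr (p / 2) - 1 - p / 2 * x\<bar> \<le> C0 * x\<^sup>2"
    using powr_second_order[of "p / 2"] by blast
  \<comment> \<open>With \<open>z\<close> the change of the squared stretching, 8 bounds (z - 2 s) /
    s^2 and 36 comes from |z| \<le> 6 |s|. The factor 3 / 2 in the final constant bounds the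
    Jacobian.\<close>
  define D where "D = p / 2 * 8 + C0 * 36"
  have D: "0 \<le> D" using C0 p by (simp add: D_def)
  have "(1 - s) * (1 + \<theta> * ((1 / (1 - s))\<^sup>2 - 1)) powr (p / 2) \<le> 1 + s * (p * \<theta> - 1) + (3 / 2 * D) * s\<^sup>2"
    if s: "\<bar>s\<bar> \<le> 1 / 2" and \<theta>: "0 \<le> \<theta>" "\<theta> \<le> 1" for s \<theta>
  proof -
    define z where "z = (1 / (1 - s))\<^sup>2 - 1"
    have s1: "1 / 2 \<le> 1 - s" "1 - s \<le> 3 / 2" using s by auto
    then have "1 / (3 / 2) \<le> 1 / (1 - s)" "1 / (1 - s) \<le> 1 / (1 / 2)" by (intro divide_left_mono; simp)+
    then have w: "2 / 3 \<le> 1 / (1 - s)" "1 / (1 - s) \<le> 2" by simp_all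
    have "(2 / 3)\<^sup>2 \<le> (1 / (1 - s))\<^sup>2" "(1 / (1 - s))\<^sup>2 \<le> 2\<^sup>2" using w s1 by (intro power_mono; simp)+
    then have z: "- (3 / 4) \<le> z" "z \<le> 3" by (auto simp: z_def power2_eq_square)
    have zs: "z - 2 * s = s\<^sup>2 * ((3 - 2 * s) * (1 / (1 - s))\<^sup>2)"
      using s1 by (simp add: z_def power2_eq_square divide_simps) (simp add: algebra_simps)
    have "(3 - 2 * s) * (1 / (1 - s))\<^sup>2 = 2 * (1 / (1 - s)) + (1 / (1 - s))\<^sup>2"
      using s1 by (simp add: power2_eq_square divide_simps)
    then have "(3 - 2 * s) * (1 / (1 - s))\<^sup>2 \<le> 8"
      using w \<open>(1 / (1 - s))\<^sup>2 \<le> 2\<^sup>2\<close> by auto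
    moreover have "0 \<le> (3 - 2 * s) * (1 / (1 - s))\<^sup>2" using s1 by (intro mult_nonneg_nonneg) auto
    ultimately
    have e: "0 \<le> z - 2 * s" "z - 2 * s \<le> 8 * s\<^sup>2"
      unfolding zs using mult_left_mono[of "(3 - 2 * s) * (1 / (1 - s))\<^sup>2" 8 "s\<^sup>2"] by (auto simp: mult.commute)
    have "s\<^sup>2 \<le> \<bar>s\<bar> * (1 / 2)" using s mult_left_mono[of "\<bar>s\<bar>" "1 / 2" "\<bar>s\<bar>"] by (simp add: power2_eq_square)
    then have "\<bar>z\<bar> \<le> 6 * \<bar>s\<bar>" using e by auto
    then have "\<bar>z\<bar>\<^sup>2 \<le> (6 * \<bar>s\<bar>)\<^sup>2" by (intro power_mono) auto
    then have z2: "z\<^sup>2 \<le> 36 * s\<^sup>2" by (simp add: power_mult_distrib)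
    have x: "- (3 / 4) \<le> \<theta> * z" "\<theta> * z \<le> 4"
    proof -
      have "\<theta> * (- (3 / 4)) \<le> \<theta> * z" "\<theta> * z \<le> \<theta> * 3" using z \<theta> by (intro mult_left_mono; simp)+
      then show "- (3 / 4) \<le> \<theta> * z" "\<theta> * z \<le> 4" using \<theta> by auto
    qed
    have "(\<theta> * z)\<^sup>2 \<le> 1 * z\<^sup>2" using \<theta> unfolding power_mult_distrib by (intro mult_right_mono) (auto simp: power_le_one)
    with z2 have x2: "(\<theta> * z)\<^sup>2 \<le> 36 * s\<^sup>2" by simp
    have "\<theta> * (z - 2 * s) \<le> 1 * (8 * s\<^sup>2)" using e \<theta> by (intro mult_mono) auto
    then have x1: "\<theta> * z \<le> 2 * \<theta> * s + 8 * s\<^sup>2" by (simp add: algebra_simps)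
    have "(1 + \<theta> * z) powr (p / 2) \<le> 1 + p / 2 * (\<theta> * z) + C0 * (\<theta> * z)\<^sup>2" using C0(2)[OF x] by linarith
    also have "\<dots> \<le> 1 + p / 2 * (2 * \<theta> * s + 8 * s\<^sup>2) + C0 * (36 * s\<^sup>2)"
      using x1 x2 C0 p by (intro add_mono mult_left_mono) auto
    also have "\<dots> = 1 + p * \<theta> * s + D * s\<^sup>2" by (simp add: D_def algebra_simps)
    finally have "(1 - s) * (1 + \<theta> * z) powr (p / 2) \<le> (1 - s) * (1 + p * \<theta> * s + D * s\<^sup>2)"
      using s1 by (intro mult_left_mono) auto
    also have "\<dots> = 1 + s * (p * \<theta> - 1) - p * \<theta> * s\<^sup>2 + (1 - s) * (D * s\<^sup>2)" by (simp add: algebra_simps power2_eq_square)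
    also have "\<dots> \<le> 1 + s * (p * \<theta> - 1) - 0 + 3 / 2 * (D * s\<^sup>2)"
    proof -
      have "0 \<le> p * \<theta> * s\<^sup>2" using p \<theta> by simp
      moreover have "(1 - s) * (D * s\<^sup>2) \<le> 3 / 2 * (D * s\<^sup>2)" using s1 D by (intro mult_right_mono) auto
      ultimately show ?thesis by linarith
    qed
    finally show ?thesis by (simp add: z_def)
  qed
  then show ?thesis using that[of "3 / 2 * D"] D by simp
qed

text \<open>\<open>1 - t * a\<close> and \<open>1 - t * b\<close> are the Jacobian factors at two
  points, \<open>1 - t * r\<close> is the difference quotient of \<open>\<tau>\<close> between them,
  and \<open>\<theta>\<close> is the share of direction \<open>i\<close> in the squared distance.
  The exponent is halved because it acts on a squared distance.\<close>

lemma kernel_factor_bound: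
  fixes \<kappa> :: real
  assumes \<kappa>: "0 < \<kappa>"
  obtains C where "0 \<le> C" "\<And>t r \<theta> a b. 0 \<le> t \<Longrightarrow> t \<le> 1 / 2 \<Longrightarrow> \<bar>r\<bar> \<le> 1 \<Longrightarrow> 0 \<le> \<theta> \<Longrightarrow> \<theta> \<le> 1 \<Longrightarrow> \<bar>a\<bar> \<le> 1 \<Longrightarrow> \<bar>b\<bar> \<le> 1 \<Longrightarrow>
    (1 - t * a) * (1 - t * b) * (1 + \<theta> * ((1 - t * r)\<^sup>2 - 1)) powr (- \<kappa> / 2) \<le> 1 + t * (\<kappa> * (\<theta> * r) - a - b) + C * t\<^sup>2"
proof -
  obtain C0 where C0: "0 \<le> C0" "\<And>x. - (3 / 4) \<le> x \<Longrightarrow> x \<le> 4 \<Longrightarrow> \<bar>(1 + x) powr (- \<kappa> / 2) - 1 - (- \<kappa> / 2) * x\<bar> \<le> C0 * x\<^sup>2"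
    using powr_second_order[of "- \<kappa> / 2"] by blast
  define D where "D = C0 * 9"
  have D: "0 \<le> D" using C0 by (simp add: D_def)
  \<comment> \<open>Origin of the constant: 1 from the product of the two first-order Jacobian
    terms, 3 \<kappa> from the change of the Jacobians times the first-order kernel term, and 9/4
    from the bound of both Jacobians times the kernel remainder.\<close>
  have "(1 - t * a) * (1 - t * b) * (1 + \<theta> * ((1 - t * r)\<^sup>2 - 1)) powr (- \<kappa> / 2)
      \<le> 1 + t * (\<kappa> * (\<theta> * r) - a - b) + (1 + 3 * \<kappa> + 9 / 4 * D) * t\<^sup>2"
    if t: "0 \<le> t" "t \<le> 1 / 2" and r: "\<bar>r\<bar> \<le> 1" and \<theta>: "0 \<le> \<theta>" "\<theta> \<le> 1" and ab: "\<bar>a\<bar> \<le> 1" "\<bar>b\<bar> \<le> 1" for t r \<theta> a b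
  proof -
    have t_le: "\<bar>t * c\<bar> \<le> t" if "\<bar>c\<bar> \<le> 1" for c
      using that t mult_left_mono[of "\<bar>c\<bar>" 1 t] by (simp add: abs_mult)
    define z where "z = (1 - t * r)\<^sup>2 - 1"
    have tr: "\<bar>t * r\<bar> \<le> t" by (rule t_le[OF r])
    have "(1 / 2)\<^sup>2 \<le> (1 - t * r)\<^sup>2" "(1 - t * r)\<^sup>2 \<le> (3 / 2)\<^sup>2" using tr t by (intro power_mono; linarith)+
    then have z: "- (3 / 4) \<le> z" "z \<le> 4" by (auto simp: z_def power2_eq_square)
    have zeq: "z = - 2 * (t * r) + (t * r)\<^sup>2" by (simp add: z_def power2_eq_square algebra_simps)
    have "\<bar>t * r\<bar>\<^sup>2 \<le> t * 1" unfolding power2_eq_square using tr t by (intro mult_mono) auto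
    then have "(t * r)\<^sup>2 \<le> t" by simp
    then have "\<bar>z\<bar> \<le> 3 * t" unfolding zeq using tr zero_le_power2[of "t * r"] by linarith
    then have "\<bar>z\<bar>\<^sup>2 \<le> (3 * t)\<^sup>2" by (intro power_mono) auto
    then have z2: "z\<^sup>2 \<le> 9 * t\<^sup>2" by (simp add: power_mult_distrib)
    have x: "- (3 / 4) \<le> \<theta> * z" "\<theta> * z \<le> 4"
    proof -
      have "\<theta> * (- (3 / 4)) \<le> \<theta> * z" "\<theta> * z \<le> \<theta> * 4" using z \<theta> by (intro mult_left_mono; simp)+
      then show "- (3 / 4) \<le> \<theta> * z" "\<theta> * z \<le> 4" using \<theta> by auto
    qed
    have "(\<theta> * z)\<^sup>2 \<le> 1 * z\<^sup>2" using \<theta> unfolding power_mult_distrib by (intro mult_right_mono) (auto simp: power_le_one)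
    with z2 have x2: "(\<theta> * z)\<^sup>2 \<le> 9 * t\<^sup>2" by simp
    have "(1 + \<theta> * z) powr (- \<kappa> / 2) \<le> 1 + (- \<kappa> / 2) * (\<theta> * z) + C0 * (\<theta> * z)\<^sup>2" using C0(2)[OF x] by linarith
    also have "(- \<kappa> / 2) * (\<theta> * z) = \<kappa> * (\<theta> * (t * r)) - \<kappa> / 2 * (\<theta> * (t * r)\<^sup>2)" unfolding zeq by (simp add: algebra_simps)
    \<comment> \<open>The quadratic part of \<open>z\<close> enters with a negative sign and is
      dropped from the upper bound.\<close>
    also have "1 + (\<kappa> * (\<theta> * (t * r)) - \<kappa> / 2 * (\<theta> * (t * r)\<^sup>2)) + C0 * (\<theta> * z)\<^sup>2 \<le> 1 + (\<kappa> * (\<theta> * (t * r)) - 0) + C0 * (9 * t\<^sup>2)"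
      using x2 C0 \<kappa> \<theta> t by (intro add_mono diff_mono mult_left_mono) auto
    finally have f: "(1 + \<theta> * z) powr (- \<kappa> / 2) \<le> 1 + \<kappa> * (\<theta> * (t * r)) + D * t\<^sup>2" by (simp add: D_def)
    define P where "P = (1 - t * a) * (1 - t * b)"
    note ta = t_le[OF ab(1)] and tb = t_le[OF ab(2)]
    have P0: "0 \<le> P" unfolding P_def using ta tb t by (intro mult_nonneg_nonneg) linarith+
    have P1: "P \<le> 3 / 2 * (3 / 2)" unfolding P_def using ta tb t by (intro mult_mono) linarith+
    have Peq: "P = 1 - t * a - t * b + (t * a) * (t * b)" by (simp add: P_def algebra_simps)
    have tab: "\<bar>(t * a) * (t * b)\<bar> \<le> t * t" unfolding abs_mult[of "t * a"] using ta tb t by (intro mult_mono) auto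
    have tt: "t * t \<le> t * 1" using t by (intro mult_left_mono) auto
    have Pm1: "\<bar>P - 1\<bar> \<le> 3 * t" unfolding Peq using ta tb tab tt by linarith
    have th: "\<bar>\<theta> * (t * r)\<bar> \<le> 1 * t" unfolding abs_mult[of \<theta>] using \<theta> tr by (intro mult_mono) auto
    have k: "\<bar>(P - 1) * (\<kappa> * (\<theta> * (t * r)))\<bar> \<le> 3 * t * (\<kappa> * t)"
      unfolding abs_mult[of "P - 1"] abs_mult[of \<kappa>] using \<kappa> th Pm1 t by (intro mult_mono mult_left_mono) auto
    have "P * (1 + \<theta> * z) powr (- \<kappa> / 2) \<le> P * (1 + \<kappa> * (\<theta> * (t * r)) + D * t\<^sup>2)" using f P0 by (rule mult_left_mono)
    also have "\<dots> = P + \<kappa> * (\<theta> * (t * r)) + (P - 1) * (\<kappa> * (\<theta> * (t * r))) + P * (D * t\<^sup>2)" by (simp add: algebra_simps)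
    also have "\<dots> \<le> (1 - t * a - t * b + t * t) + \<kappa> * (\<theta> * (t * r)) + 3 * t * (\<kappa> * t) + 9 / 4 * (D * t\<^sup>2)"
    proof (intro add_mono)
      show "P \<le> 1 - t * a - t * b + t * t" unfolding Peq using tab by linarith
      show "(P - 1) * (\<kappa> * (\<theta> * (t * r))) \<le> 3 * t * (\<kappa> * t)" using k by linarith
      show "P * (D * t\<^sup>2) \<le> 9 / 4 * (D * t\<^sup>2)" using P1 D by (intro mult_right_mono) auto
    qed auto
    also have "\<dots> = 1 + t * (\<kappa> * (\<theta> * r) - a - b) + (1 + 3 * \<kappa> + 9 / 4 * D) * t\<^sup>2" by (simp add: algebra_simps power2_eq_square)
    finally show ?thesis unfolding P_def z_def by simp
  qed
  then show ?thesis using that[of "1 + 3 * \<kappa> + 9 / 4 * D"] D \<kappa> by simp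
qed

section \<open>Increments of the critical power\<close>

text \<open>By homogeneity this is 1 - y^(q-1) \<le> max 1 (q-1) times 1 - y, for y = b / a. When q
  \<le> 2 it holds because y \<le> y^(q-1); for larger \<open>q\<close> it is the mean value
  theorem.\<close>

lemma powr_diff_le:
  fixes a b :: real
  assumes q: "1 < q" and ab: "0 \<le> b" "b \<le> a"
  shows "a powr (q - 1) - b powr (q - 1) \<le> max 1 (q - 1) * (a powr (q - 2) * (a - b))"
proof (cases "b = 0")
  case True
  show ?thesis
  proof (cases "a = 0")
    case False
    then have "a powr (q - 1) = a powr (q - 2) * a" using ab by (simp add: powr_diff power2_eq_square)
    moreover have "1 * (a powr (q - 2) * a) \<le> max 1 (q - 1) * (a powr (q - 2) * a)" using ab by (intro mult_right_mono) auto
    ultimately show ?thesis using True by simp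
  qed (use True in simp)
next
  case False
  then have pos: "0 < b" "0 < a" using ab by auto
  define y where "y = b / a"
  have y: "0 < y" "y \<le> 1" using pos ab by (auto simp: y_def)
  have "1 - y powr (q - 1) \<le> max 1 (q - 1) * (1 - y)"
  proof (cases "q - 1 \<le> 1")
    case True
    then have "y powr 1 \<le> y powr (q - 1)" using y by (intro powr_mono') auto
    with y True show ?thesis by simp
  next
    case False
    obtain z where z: "1 powr (q - 1) - y powr (q - 1) = (q - 1) * z powr (q - 2) * (1 - y)" "0 < z" "z \<le> 1"
    proof (cases "y = 1")
      case True then show ?thesis using that[of 1] by simp
    next
      case False
      then have "y < 1" using y by simp
      have d: "((\<lambda>x. x powr (q - 1)) has_real_derivative (q - 1) * x powr (q - 2)) (at x)" if "y \<le> x" for x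
        using that y by (auto intro!: derivative_eq_intros)
      from MVT2[OF \<open>y < 1\<close>, of "\<lambda>x. x powr (q - 1)" "\<lambda>x. (q - 1) * x powr (q - 2)"] d
      obtain z where "y < z" "z < 1" "1 powr (q - 1) - y powr (q - 1) = (1 - y) * ((q - 1) * z powr (q - 2))" by auto
      then show ?thesis using that[of z] y by (simp add: mult.commute)
    qed
    have "z powr (q - 2) \<le> 1" using z False by (intro powr_le1) auto
    then have "(q - 1) * z powr (q - 2) * (1 - y) \<le> (q - 1) * 1 * (1 - y)" using y q by (intro mult_right_mono mult_left_mono) auto
    with z False show ?thesis by simp
  qed
  then have "a powr (q - 1) * (1 - y powr (q - 1)) \<le> a powr (q - 1) * (max 1 (q - 1) * (1 - y))" by (intro mult_left_mono) auto
  also have "a powr (q - 1) * (1 - y powr (q - 1)) = a powr (q - 1) - b powr (q - 1)"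
    using pos by (simp add: y_def powr_divide algebra_simps)
  also have "a powr (q - 1) * (max 1 (q - 1) * (1 - y)) = max 1 (q - 1) * (a powr (q - 2) * (a * (1 - y)))"
    using pos by (simp add: powr_diff power2_eq_square)
  also have "a * (1 - y) = a - b" using pos by (simp add: y_def algebra_simps)
  finally show ?thesis .
qed

text \<open>For equal signs \<open>powr_diff_le\<close> applies, and 2 - m powers of the increment
  are traded for powers of the larger value. For opposite signs |a - b| = |a| + |b|, so each term
  can be bounded separately.\<close>

lemma signed_powr_diff_bound:
  fixes a b :: real
  assumes q: "1 < q" and m: "1 \<le> m" "m \<le> 2" "m \<le> q"
  shows "\<bar>\<bar>a\<bar> powr (q - 2) * a - \<bar>b\<bar> powr (q - 2) * b\<bar> * \<bar>a - b\<bar>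
    \<le> 2 * max 1 (q - 1) * ((\<bar>a\<bar> + \<bar>b\<bar>) powr (q - m) * \<bar>a - b\<bar> powr m)"
proof -
  define C where "C = max 1 (q - 1)"
  have C: "1 \<le> C" by (simp add: C_def)
  have sgn: "\<bar>x\<bar> powr (q - 2) * x = sgn x * \<bar>x\<bar> powr (q - 1)" for x :: real
    by (cases "x = 0") (auto simp: powr_diff power2_eq_square sgn_if)
  have same: "\<bar>x powr (q - 1) - y powr (q - 1)\<bar> * \<bar>x - y\<bar> \<le> 2 * C * ((x + y) powr (q - m) * \<bar>x - y\<bar> powr m)"
    if xy: "0 \<le> y" "y \<le> x" for x y
  proof (cases "x = y")
    case False
    then have pos: "0 < x - y" "0 < x" using xy by auto
    have "y powr (q - 1) \<le> x powr (q - 1)" using xy q by (intro powr_mono2) auto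
    then have "\<bar>x powr (q - 1) - y powr (q - 1)\<bar> * \<bar>x - y\<bar> \<le> C * (x powr (q - 2) * (x - y)) * (x - y)"
      using powr_diff_le[OF q xy] pos by (simp add: C_def mult_right_mono)
    also have "\<dots> = C * (x powr (q - 2) * ((x - y) powr (2 - m) * (x - y) powr m))"
      using pos by (simp add: powr_add[symmetric] power2_eq_square)
    also have "\<dots> \<le> C * (x powr (q - 2) * (x powr (2 - m) * (x - y) powr m))"
      using pos xy m C by (intro mult_left_mono mult_right_mono powr_mono2) auto
    also have "\<dots> = C * (x powr (q - m) * (x - y) powr m)" by (simp add: mult.assoc[symmetric] powr_add[symmetric])
    also have "\<dots> \<le> 2 * C * ((x + y) powr (q - m) * (x - y) powr m)"
      using pos xy m C by (intro mult_mono mult_right_mono powr_mono2) auto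
    finally show ?thesis using pos by simp
  qed simp
  have opp: "(x powr (q - 1) + y powr (q - 1)) * (x + y) \<le> 2 * C * ((x + y) powr (q - m) * (x + y) powr m)"
    if xy: "0 \<le> y" "0 \<le> x" for x y
  proof -
    have "x powr (q - 1) \<le> (x + y) powr (q - 1)" "y powr (q - 1) \<le> (x + y) powr (q - 1)" using xy q by (intro powr_mono2; simp)+
    then have "(x powr (q - 1) + y powr (q - 1)) * (x + y) \<le> (2 * (x + y) powr (q - 1)) * (x + y)"
      using xy by (intro mult_right_mono) auto
    also have "\<dots> = 2 * 1 * (x + y) powr q" using xy by (cases "x + y = 0") (auto simp: powr_diff)
    also have "\<dots> \<le> 2 * C * (x + y) powr q" using C by (intro mult_right_mono) auto
    also have "(x + y) powr q = (x + y) powr (q - m) * (x + y) powr m" by (simp add: powr_add[symmetric])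
    finally show ?thesis by simp
  qed
  consider "0 \<le> a" "0 \<le> b" | "a \<le> 0" "b \<le> 0" | "0 < a" "b < 0" | "a < 0" "0 < b" by linarith
  then show ?thesis
  proof cases
    case 1
    then have e: "\<bar>x\<bar> powr (q - 2) * x = x powr (q - 1)" if "x = a \<or> x = b" for x
      using that by (cases "x = 0") (auto simp: sgn)
    have e1: "\<bar>a\<bar> powr (q - 2) * a = a powr (q - 1)" "\<bar>b\<bar> powr (q - 2) * b = b powr (q - 1)" by (auto intro: e)
    show ?thesis unfolding e1 using same[of b a] same[of a b] 1
      by (cases "b \<le> a") (auto simp: C_def abs_minus_commute add.commute)
  next
    case 2
    then have e: "\<bar>x\<bar> powr (q - 2) * x = - ((- x) powr (q - 1))" if "x = a \<or> x = b" for x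
      using that by (cases "x = 0") (auto simp: sgn sgn_if)
    have e1: "\<bar>a\<bar> powr (q - 2) * a = - ((- a) powr (q - 1))" "\<bar>b\<bar> powr (q - 2) * b = - ((- b) powr (q - 1))" by (auto intro: e)
    have e2: "- ((- a) powr (q - 1)) - - ((- b) powr (q - 1)) = (- b) powr (q - 1) - (- a) powr (q - 1)" by simp
    show ?thesis unfolding e1 e2 using same[of "- b" "- a"] same[of "- a" "- b"] 2
      by (cases "b \<le> a") (auto simp: C_def abs_minus_commute add.commute)
  next
    case 3
    have e: "\<bar>a\<bar> powr (q - 2) * a = a powr (q - 1)" "\<bar>b\<bar> powr (q - 2) * b = - ((- b) powr (q - 1))"
      unfolding sgn using 3 by simp_all
    have "\<bar>a powr (q - 1) - - ((- b) powr (q - 1))\<bar> = a powr (q - 1) + (- b) powr (q - 1)" by simp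
    with 3 show ?thesis unfolding e using opp[of "- b" a] by (simp add: C_def)
  next
    case 4
    have e: "\<bar>a\<bar> powr (q - 2) * a = - ((- a) powr (q - 1))" "\<bar>b\<bar> powr (q - 2) * b = b powr (q - 1)"
      unfolding sgn using 4 by simp_all
    have "\<bar>- ((- a) powr (q - 1)) - b powr (q - 1)\<bar> = b powr (q - 1) + (- a) powr (q - 1)"
      using powr_ge_zero[of "- a" "q - 1"] powr_ge_zero[of b "q - 1"] by linarith
    with 4 show ?thesis unfolding e using opp[of "- a" b] by (simp add: C_def)
  qed
qed

text \<open>Convexity at \<open>b\<close> has the right direction; moving the nonlinearity to \<open>a\<close> costs a remainder of order
  \<open>m > 1\<close> in the increment. An exponent below \<open>2\<close> is needed when \<open>p \<le> 2\<close>, since the increment is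
  controlled in \<open>L\<^sup>p\<close> and \<open>m < p\<close>.\<close>

lemma signed_powr_increment_lower:
  fixes a b :: real
  assumes q: "1 < q" and m: "1 \<le> m" "m \<le> 2" "m \<le> q"
  shows "(\<bar>b\<bar> powr q - \<bar>a\<bar> powr q) / q - 2 * max 1 (q - 1) * ((\<bar>a\<bar> + \<bar>b\<bar>) powr (q - m) * \<bar>b - a\<bar> powr m)
    \<le> \<bar>a\<bar> powr (q - 2) * a * (b - a)"
proof -
  have self: "\<bar>b\<bar> powr (q - 2) * (b * b) = \<bar>b\<bar> powr q"
    by (cases "b = 0") (auto simp: powr_diff power2_eq_square abs_mult_self_eq)
  have "\<bar>b\<bar> powr (q - 2) * (b * a) \<le> (1 - 1 / q) * \<bar>b\<bar> powr q + \<bar>a\<bar> powr q / q"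
    using Young_inner(1)[OF q, of b a] by simp
  then have 1: "(\<bar>b\<bar> powr q - \<bar>a\<bar> powr q) / q \<le> \<bar>b\<bar> powr (q - 2) * b * (b - a)"
    using self by (simp add: algebra_simps diff_divide_distrib)
  have "(\<bar>b\<bar> powr (q - 2) * b - \<bar>a\<bar> powr (q - 2) * a) * (b - a)
    \<le> \<bar>\<bar>b\<bar> powr (q - 2) * b - \<bar>a\<bar> powr (q - 2) * a\<bar> * \<bar>b - a\<bar>" by (metis abs_ge_self abs_mult)
  also note signed_powr_diff_bound[OF q m, of b a]
  finally show ?thesis using 1 by (simp add: algebra_simps add.commute)
qed

section \<open>The Pohozaev inequality\<close>

lemma powr_norm_self:
  fixes x :: "'b::real_inner"
  shows "norm x powr (p - 2) * (x \<bullet> x) = norm x powr p"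
proof (cases "x = 0")
  case False
  then have "x \<bullet> x = norm x powr 2" by (simp add: power2_norm_eq_inner)
  then show ?thesis by (simp only: powr_add[symmetric]) simp
qed simp

lemma inner_Basis_square_le: "i \<in> Basis \<Longrightarrow> (x \<bullet> i)\<^sup>2 \<le> (norm x)\<^sup>2"
  using Basis_le_norm[of i x] by (metis abs_ge_zero power2_abs power_mono)

lemma powr_norm_coord_le:
  fixes x :: "'a::euclidean_space"
  assumes "i \<in> Basis"
  shows "norm x powr (p - 2) * (x \<bullet> i)\<^sup>2 \<le> norm x powr p"
proof -
  have "norm x powr (p - 2) * (x \<bullet> i)\<^sup>2 \<le> norm x powr (p - 2) * (x \<bullet> x)"
    using inner_Basis_square_le[OF assms, of x] by (intro mult_left_mono) (auto simp: power2_norm_eq_inner)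
  then show ?thesis by (simp add: powr_norm_self)
qed

lemma inner_ratio_le_1:
  fixes d :: "'a::euclidean_space"
  assumes "i \<in> Basis" "\<bar>b\<bar> \<le> \<bar>d \<bullet> i\<bar>"
  shows "\<bar>(d \<bullet> i) * b / (norm d)\<^sup>2\<bar> \<le> 1"
proof -
  have "\<bar>d \<bullet> i\<bar> \<le> norm d" using assms(1) by (rule Basis_le_norm)
  then have "\<bar>(d \<bullet> i) * b\<bar> \<le> norm d * norm d"
    unfolding abs_mult using assms(2) by (intro mult_mono) auto
  then show ?thesis by (simp add: abs_divide divide_le_eq power2_eq_square)
qed

lemma powr_abs_self: "\<bar>x\<bar> powr (p - 2) * x * x = \<bar>x\<bar> powr p" for x :: real
  using powr_norm_self[of x p] by (simp add: mult.assoc)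

section \<open>First-order expansions under the deformation\<close>

context coord_change
begin

text \<open>The squared norm changes by the factor treated in \<open>gradient_factor_bound\<close>,
  with s = t c at the coordinate of \<open>y\<close> and \<theta> the normalised squared component
  of \<open>g y\<close>. Multiplying out by the norm keeps the first-order term as an integrable
  density.\<close>

lemma transported_grad_powr_bound:
  fixes g :: "'a \<Rightarrow> 'a"
  assumes p: "1 < p" and t: "0 \<le> t" "t \<le> 1 / 2" and c: "\<And>r. \<tau>' r = 1 - t * c r" "\<And>r. \<bar>c r\<bar> \<le> 1"
    and C: "0 \<le> C" "\<And>s \<theta>. \<bar>s\<bar> \<le> 1 / 2 \<Longrightarrow> 0 \<le> \<theta> \<Longrightarrow> \<theta> \<le> 1 \<Longrightarrow>
      (1 - s) * (1 + \<theta> * ((1 / (1 - s))\<^sup>2 - 1)) powr (p / 2) \<le> 1 + s * (p * \<theta> - 1) + C * s\<^sup>2"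
  shows "\<tau>' (y \<bullet> i) * norm (transported_grad g y) powr p \<le> norm (g y) powr p
     + t * (c (y \<bullet> i) * (p * (norm (g y) powr (p - 2) * (g y \<bullet> i)\<^sup>2) - norm (g y) powr p)) + t\<^sup>2 * (C * norm (g y) powr p)"
proof (cases "g y = 0")
  case False
  define n where "n = norm (g y)"
  have n: "0 < n" using False by (simp add: n_def)
  define s where "s = t * c (y \<bullet> i)"
  have st: "\<bar>s\<bar> \<le> t" unfolding s_def using t c(2)[of "y \<bullet> i"] mult_left_mono[of "\<bar>c (y \<bullet> i)\<bar>" 1 t] by (simp add: abs_mult)
  have \<tau>': "\<tau>' (y \<bullet> i) = 1 - s" by (simp add: c s_def)
  define \<theta> where "\<theta> = (g y \<bullet> i)\<^sup>2 / n\<^sup>2"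
  have gi: "(g y \<bullet> i)\<^sup>2 = \<theta> * n\<^sup>2" using n by (simp add: \<theta>_def)
  have "(g y \<bullet> i)\<^sup>2 \<le> n\<^sup>2" unfolding n_def by (rule inner_Basis_square_le[OF i])
  then have \<theta>: "0 \<le> \<theta>" "\<theta> \<le> 1" using n by (auto simp: \<theta>_def)
  define z where "z = 1 + \<theta> * ((1 / (1 - s))\<^sup>2 - 1)"
  have "(norm (transported_grad g y))\<^sup>2 = n\<^sup>2 * z"
  proof -
    define a where "a = 1 / (1 - s) - 1"
    have "(norm (transported_grad g y))\<^sup>2 = n\<^sup>2 + 2 * a * (g y \<bullet> i)\<^sup>2 + a\<^sup>2 * (g y \<bullet> i)\<^sup>2"
      unfolding power2_norm_eq_inner transported_grad_def \<tau>' n_def a_def[symmetric] using i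
      by (simp add: inner_add_left inner_add_right inner_commute power2_eq_square algebra_simps)
    also have "\<dots> = n\<^sup>2 * (1 + \<theta> * ((a + 1)\<^sup>2 - 1))" unfolding gi by (simp add: power2_eq_square algebra_simps)
    finally show ?thesis by (simp add: z_def a_def)
  qed
  then have sq: "norm (transported_grad g y) = n * sqrt z"
    using n by (metis norm_ge_zero real_sqrt_abs2 real_sqrt_mult real_sqrt_unique abs_of_pos power2_eq_square)
  have z0: "0 \<le> z"
  proof -
    have "0 \<le> n\<^sup>2 * z" using \<open>(norm (transported_grad g y))\<^sup>2 = n\<^sup>2 * z\<close> by (metis zero_le_power2)
    then show ?thesis using n by (simp add: zero_le_mult_iff)
  qed
  have "norm (transported_grad g y) powr p = n powr p * z powr (p / 2)"
    unfolding sq using n z0 by (simp add: powr_mult powr_half_sqrt[symmetric] powr_powr)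
  then have "\<tau>' (y \<bullet> i) * norm (transported_grad g y) powr p = n powr p * ((1 - s) * z powr (p / 2))" by (simp add: \<tau>')
  also have "\<dots> \<le> n powr p * (1 + s * (p * \<theta> - 1) + C * s\<^sup>2)"
    unfolding z_def using st t \<theta> by (intro mult_left_mono C) auto
  also have "\<dots> \<le> n powr p * (1 + s * (p * \<theta> - 1) + C * t\<^sup>2)"
  proof -
    have "\<bar>s\<bar>\<^sup>2 \<le> t\<^sup>2" using st by (intro power_mono) auto
    then have "C * s\<^sup>2 \<le> C * t\<^sup>2" using C(1) by (intro mult_left_mono) auto
    then show ?thesis by (intro mult_left_mono) auto
  qed
  also have "\<dots> = n powr p + t * (c (y \<bullet> i) * (p * (n powr p * \<theta>) - n powr p)) + t\<^sup>2 * (C * n powr p)"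
    by (simp add: s_def algebra_simps)
  also have "n powr p * \<theta> = n powr (p - 2) * (g y \<bullet> i)\<^sup>2"
    unfolding gi using n by (simp add: powr_diff)
  finally show ?thesis by (simp add: n_def)
qed (simp add: transported_grad_def)

text \<open>\<open>k\<close> stands for the power of |u x - u y|. It vanishes on the diagonal, where
  the quotients have the default value 0 as well.\<close>

lemma kernel_Psi_bound:
  fixes x y :: 'a
  assumes \<kappa>: "0 < \<kappa>" and t: "0 \<le> t" "t \<le> 1 / 2" and c: "\<And>r. \<tau>' r = 1 - t * c r" "\<And>r. \<bar>c r\<bar> \<le> 1"
    and w: "\<And>r. \<tau> r = r - t * w r" "\<And>a b. \<bar>w a - w b\<bar> \<le> \<bar>a - b\<bar>"
    and C: "0 \<le> C" "\<And>t r \<theta> a b. 0 \<le> t \<Longrightarrow> t \<le> 1 / 2 \<Longrightarrow> \<bar>r\<bar> \<le> 1 \<Longrightarrow> 0 \<le> \<theta> \<Longrightarrow> \<theta> \<le> 1 \<Longrightarrow> \<bar>a\<bar> \<le> 1 \<Longrightarrow> \<bar>b\<bar> \<le> 1 \<Longrightarrow>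
    (1 - t * a) * (1 - t * b) * (1 + \<theta> * ((1 - t * r)\<^sup>2 - 1)) powr (- \<kappa> / 2) \<le> 1 + t * (\<kappa> * (\<theta> * r) - a - b) + C * t\<^sup>2"
    and k: "0 \<le> k" "x = y \<Longrightarrow> k = 0"
  shows "\<tau>' (x \<bullet> i) * \<tau>' (y \<bullet> i) * (k / norm (Psi x - Psi y) powr \<kappa>) \<le> k / norm (x - y) powr \<kappa>
    + t * (k / norm (x - y) powr \<kappa> * (\<kappa> * (((x - y) \<bullet> i) * (w (x \<bullet> i) - w (y \<bullet> i)) / (norm (x - y))\<^sup>2) - c (x \<bullet> i) - c (y \<bullet> i)))
    + t\<^sup>2 * (C * (k / norm (x - y) powr \<kappa>))"
proof (cases "x = y")
  case False
  define n where "n = norm (x - y)"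
  have n: "0 < n" using False by (simp add: n_def)
  define d where "d = (x - y) \<bullet> i"
  define om where "om = w (x \<bullet> i) - w (y \<bullet> i)"
  have om: "\<bar>om\<bar> \<le> \<bar>d\<bar>" using w(2)[of "x \<bullet> i" "y \<bullet> i"] by (simp add: om_def d_def inner_diff_left)
  \<comment> \<open>If \<open>d\<close> is 0 then so is \<open>om\<close>, so the default value of
    the quotient still gives \<open>om = r * d\<close>.\<close>
  define r where "r = om / d"
  have r: "\<bar>r\<bar> \<le> 1" using om by (simp add: r_def divide_simps)
  have omr: "om = r * d" using om by (auto simp: r_def)
  define \<theta> where "\<theta> = d\<^sup>2 / n\<^sup>2"
  have dn: "d\<^sup>2 = \<theta> * n\<^sup>2" using n by (simp add: \<theta>_def)
  have "d\<^sup>2 \<le> n\<^sup>2" unfolding n_def d_def by (rule inner_Basis_square_le[OF i])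
  then have \<theta>: "0 \<le> \<theta>" "\<theta> \<le> 1" using n by (auto simp: \<theta>_def)
  define z where "z = 1 + \<theta> * ((1 - t * r)\<^sup>2 - 1)"
  have sqn: "(norm (Psi x - Psi y))\<^sup>2 = n\<^sup>2 * z"
  proof -
    have "\<tau> (x \<bullet> i) - \<tau> (y \<bullet> i) = d - t * om" by (simp add: w d_def om_def inner_diff_left algebra_simps)
    also have "\<dots> = d * (1 - t * r)" by (simp add: omr algebra_simps)
    finally have "(\<tau> (x \<bullet> i) - \<tau> (y \<bullet> i))\<^sup>2 = \<theta> * n\<^sup>2 * (1 - t * r)\<^sup>2" by (simp add: power_mult_distrib dn)
    then show ?thesis unfolding norm_Psi_diff d_def[symmetric] n_def[symmetric] dn by (simp add: z_def algebra_simps)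
  qed
  have Pn: "0 < norm (Psi x - Psi y)" using norm_Psi_diff_lower[of x y] n unfolding n_def by linarith
  have z0: "0 < z"
  proof -
    have "0 < n\<^sup>2 * z" unfolding sqn[symmetric] using Pn by simp
    then show ?thesis using n by (simp add: zero_less_mult_iff)
  qed
  have "norm (Psi x - Psi y) powr \<kappa> = ((norm (Psi x - Psi y))\<^sup>2) powr (\<kappa> / 2)"
    using Pn by (simp add: powr_realpow[symmetric] powr_powr del: powr_numeral) 
  also have "\<dots> = (n\<^sup>2) powr (\<kappa> / 2) * z powr (\<kappa> / 2)" unfolding sqn using z0 by (simp add: powr_mult)
  also have "(n\<^sup>2) powr (\<kappa> / 2) = n powr \<kappa>" using n by (simp add: powr_realpow[symmetric] powr_powr del: powr_numeral)
  finally have Pk: "norm (Psi x - Psi y) powr \<kappa> = n powr \<kappa> * z powr (\<kappa> / 2)" .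
  define K where "K = k / n powr \<kappa>"
  have K: "0 \<le> K" using k by (simp add: K_def)
  have "\<tau>' (x \<bullet> i) * \<tau>' (y \<bullet> i) * (k / norm (Psi x - Psi y) powr \<kappa>)
     = K * ((1 - t * c (x \<bullet> i)) * (1 - t * c (y \<bullet> i)) * z powr (- \<kappa> / 2))"
  proof -
    have "z powr (- \<kappa> / 2) = 1 / z powr (\<kappa> / 2)" using powr_minus_divide[of z "\<kappa> / 2"] by simp
    then show ?thesis by (simp add: Pk c(1) K_def)
  qed
  also have "\<dots> \<le> K * (1 + t * (\<kappa> * (\<theta> * r) - c (x \<bullet> i) - c (y \<bullet> i)) + C * t\<^sup>2)"
    unfolding z_def using K t r \<theta> c by (intro mult_left_mono C(2)) auto
  also have "\<dots> = K + t * (K * (\<kappa> * (\<theta> * r) - c (x \<bullet> i) - c (y \<bullet> i))) + t\<^sup>2 * (C * K)" by (simp add: algebra_simps)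
  also have "\<theta> * r = d * om / n\<^sup>2" using omr by (simp add: \<theta>_def power2_eq_square)
  finally show ?thesis unfolding K_def n_def d_def om_def .
qed (use k in simp)

lemma AE_shift: "AE x in lborel. P x \<Longrightarrow> AE x in lborel. P (x + (\<sigma> (x \<bullet> i) - x \<bullet> i) *\<^sub>R i)"
  using AE_Phi[of P] by (simp add: Phi_def)

text \<open>Here the boundedness of the field pays off: every point moves by at most t W, so the
  difference quotient is bounded in L^p uniformly in \<open>t\<close>.\<close>

lemma Phi_increment_bound:
  fixes u :: "'a \<Rightarrow> real"
  assumes g: "weak_gradient u g" "integrable lborel (\<lambda>x. norm (g x) powr p)" and p: "1 < p"
    and t: "0 < t" and w: "\<And>r. \<tau> r = r - t * w r" "\<And>r. \<bar>w r\<bar> \<le> W" "0 < W"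
  shows "integrable lborel (\<lambda>x. (\<bar>u (Phi x) - u x\<bar> / t) powr p)"
    "(\<integral>x. (\<bar>u (Phi x) - u x\<bar> / t) powr p \<partial>lborel) \<le> (2 * W) powr p * (\<integral>x. norm (g x) powr p \<partial>lborel)"
proof -
  have [measurable]: "u \<in> borel_measurable borel" "g \<in> borel_measurable borel"
    using g by (auto simp: weak_gradient_def loc_integrable_def)
  define a0 where "a0 = (\<integral>x. norm (g x) powr p \<partial>lborel)"
  have a0: "0 \<le> a0" unfolding a0_def by (intro integral_nonneg_AE) auto
  have nna: "(\<integral>\<^sup>+x. ennreal (norm (g x) powr p) \<partial>lborel) = ennreal a0"
    unfolding a0_def using g by (intro nn_integral_eq_integral) auto
  have "\<bar>\<sigma> (x \<bullet> i) - x \<bullet> i\<bar> \<le> t * W" for x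
  proof -
    \<comment> \<open>The displacement under \<open>\<sigma>\<close> is the field evaluated at the
      preimage, so the bound \<open>W\<close> applies although \<open>\<sigma>\<close> is not
      explicit.\<close>
    have "\<sigma> (x \<bullet> i) - x \<bullet> i = t * w (\<sigma> (x \<bullet> i))" using \<tau>_\<sigma>[of "x \<bullet> i"] w(1)[of "\<sigma> (x \<bullet> i)"] by simp
    then show ?thesis using w(2)[of "\<sigma> (x \<bullet> i)"] t by (simp add: abs_mult)
  qed
  from variable_shift_estimate[OF g(1) p i _ this AE_shift] t w
  have "(\<integral>\<^sup>+x. ennreal (\<bar>u (Phi x) - u x\<bar> powr p) \<partial>lborel) \<le> ennreal ((2 * (t * W)) powr p) * ennreal a0"
    unfolding Phi_def nna by simp
  then have "ennreal ((1 / t) powr p) * (\<integral>\<^sup>+x. ennreal (\<bar>u (Phi x) - u x\<bar> powr p) \<partial>lborel)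
      \<le> ennreal ((1 / t) powr p) * (ennreal ((2 * (t * W)) powr p) * ennreal a0)" by (intro mult_left_mono) auto
  also have "\<dots> = ennreal ((2 * W) powr p * a0)"
    using t a0 w by (simp add: ennreal_mult'[symmetric] powr_mult powr_divide mult.assoc)
  also have "ennreal ((1 / t) powr p) * (\<integral>\<^sup>+x. ennreal (\<bar>u (Phi x) - u x\<bar> powr p) \<partial>lborel)
      = (\<integral>\<^sup>+x. ennreal ((\<bar>u (Phi x) - u x\<bar> / t) powr p) \<partial>lborel)"
    by (subst nn_integral_cmult[symmetric]) (use t in \<open>auto intro!: nn_integral_cong simp: ennreal_mult[symmetric] powr_divide\<close>)
  finally have le: "(\<integral>\<^sup>+x. ennreal ((\<bar>u (Phi x) - u x\<bar> / t) powr p) \<partial>lborel) \<le> ennreal ((2 * W) powr p * a0)" .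
  show int: "integrable lborel (\<lambda>x. (\<bar>u (Phi x) - u x\<bar> / t) powr p)"
    by (rule integrableI_nonneg) (auto intro: le_less_trans[OF le])
  show "(\<integral>x. (\<bar>u (Phi x) - u x\<bar> / t) powr p \<partial>lborel) \<le> (2 * W) powr p * (\<integral>x. norm (g x) powr p \<partial>lborel)"
    using le a0 int unfolding a0_def[symmetric]
    by (subst (asm) nn_integral_eq_integral) auto
qed

text \<open>Young with the conjugate exponents p / (p - m) and p / m: the difference quotient is
  raised to the power \<open>p\<close>, where it is controlled, and the size of \<open>u\<close> to
  the power \<open>r\<close>, whose formula is dictated by this choice. The factor t^m is what the
  difference quotient leaves over.\<close>

lemma remainder_bound:
  fixes u :: "'a \<Rightarrow> real"
  assumes g: "weak_gradient u g" "integrable lborel (\<lambda>x. norm (g x) powr p)" and p: "1 < p"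
    and t: "0 < t" and w: "\<And>r. \<tau> r = r - t * w r" "\<And>r. \<bar>w r\<bar> \<le> W" "0 < W"
    and m: "0 < m" "m < p" "m < q" and r: "r = (q - m) * p / (p - m)" "integrable lborel (\<lambda>x. \<bar>u x\<bar> powr r)"
  shows "integrable lborel (\<lambda>x. (\<bar>u x\<bar> + \<bar>u (Phi x)\<bar>) powr (q - m) * \<bar>u (Phi x) - u x\<bar> powr m)"
    "(\<integral>x. (\<bar>u x\<bar> + \<bar>u (Phi x)\<bar>) powr (q - m) * \<bar>u (Phi x) - u x\<bar> powr m \<partial>lborel)
     \<le> t powr m * (2 powr r * (5 / 2) * (\<integral>x. \<bar>u x\<bar> powr r \<partial>lborel) + (2 * W) powr p * (\<integral>x. norm (g x) powr p \<partial>lborel))"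
proof -
  have [measurable]: "u \<in> borel_measurable borel"
    using g by (auto simp: weak_gradient_def loc_integrable_def)
  have r0: "0 < r" using m r by (simp add: r(1))
  define R where "R = (\<integral>x. \<bar>u x\<bar> powr r \<partial>lborel)"
  note v = integral_Phi[where f = "\<lambda>x. \<bar>u x\<bar> powr r", OF _ _ r(2)]
  have vr: "integrable lborel (\<lambda>x. \<bar>u (Phi x)\<bar> powr r)" using v by auto
  have vR: "(\<integral>x. \<bar>u (Phi x)\<bar> powr r \<partial>lborel) \<le> 3 / 2 * R"
  proof -
    have "(\<integral>x. \<bar>u (Phi x)\<bar> powr r \<partial>lborel) = (\<integral>y. \<tau>' (y \<bullet> i) * \<bar>u y\<bar> powr r \<partial>lborel)" using v by auto
    also have "\<dots> \<le> (\<integral>y. 3 / 2 * \<bar>u y\<bar> powr r \<partial>lborel)"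
      using v r(2) \<tau>'_upper by (intro integral_mono mult_right_mono) auto
    finally show ?thesis by (simp add: R_def)
  qed
  note B = Phi_increment_bound[OF g p t w]
  \<comment> \<open>\<open>2 powr r\<close> comes from bounding a sum by twice the maximum. After
    integration the deformed function costs at most 3 / 2 by the Jacobian, so the sum 1 + 3/2 gives
    the 5 / 2 of the statement.\<close>
  define bnd where "bnd x = t powr m * (2 powr r * (\<bar>u x\<bar> powr r + \<bar>u (Phi x)\<bar> powr r) + (\<bar>u (Phi x) - u x\<bar> / t) powr p)" for x
  have bi: "integrable lborel bnd" unfolding bnd_def using r(2) vr B by auto
  have pt: "(\<bar>u x\<bar> + \<bar>u (Phi x)\<bar>) powr (q - m) * \<bar>u (Phi x) - u x\<bar> powr m \<le> bnd x" for x
  proof -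
    define A where "A = \<bar>u x\<bar> + \<bar>u (Phi x)\<bar>"
    define D where "D = \<bar>u (Phi x) - u x\<bar> / t"
    have A: "0 \<le> A" and D: "0 \<le> D" using t by (auto simp: A_def D_def)
    define P where "P = p / (p - m)"
    define Q where "Q = p / m"
    have PQ: "1 < P" "1 < Q" "1 / P + 1 / Q = 1" using m p by (auto simp: P_def Q_def field_simps)
    have "A powr (q - m) * D powr m \<le> (A powr (q - m)) powr P / P + (D powr m) powr Q / Q"
      using PQ by (intro Youngs_inequality) auto
    also have "(A powr (q - m)) powr P = A powr r" using A by (simp add: powr_powr P_def r(1))
    also have "(D powr m) powr Q = D powr p" using D m by (simp add: powr_powr Q_def)
    also have "A powr r / P + D powr p / Q \<le> A powr r + D powr p"
      using PQ by (intro add_mono) (auto simp: divide_le_eq mult_le_cancel_left1)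
    also have "A powr r \<le> 2 powr r * (\<bar>u x\<bar> powr r + \<bar>u (Phi x)\<bar> powr r)"
    proof -
      define M where "M = max \<bar>u x\<bar> \<bar>u (Phi x)\<bar>"
      have "A powr r \<le> (2 * M) powr r" using r0 by (intro powr_mono2) (auto simp: A_def M_def)
      also have "\<dots> = 2 powr r * M powr r" by (rule powr_mult)
      also have "M powr r \<le> \<bar>u x\<bar> powr r + \<bar>u (Phi x)\<bar> powr r" by (auto simp: M_def max_def)
      finally show ?thesis by simp
    qed
    finally have "t powr m * (A powr (q - m) * D powr m) \<le> bnd x"
      unfolding bnd_def D_def[symmetric] by (intro mult_left_mono) auto
    also have "t powr m * (A powr (q - m) * D powr m) = A powr (q - m) * \<bar>u (Phi x) - u x\<bar> powr m"
      unfolding D_def using t by (simp add: powr_divide)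
    finally show ?thesis by (simp add: A_def)
  qed
  show int: "integrable lborel (\<lambda>x. (\<bar>u x\<bar> + \<bar>u (Phi x)\<bar>) powr (q - m) * \<bar>u (Phi x) - u x\<bar> powr m)"
    by (rule Bochner_Integration.integrable_bound[OF bi]) (use pt in \<open>auto intro: order.trans[OF _ abs_ge_self]\<close>)
  have "(\<integral>x. (\<bar>u x\<bar> + \<bar>u (Phi x)\<bar>) powr (q - m) * \<bar>u (Phi x) - u x\<bar> powr m \<partial>lborel) \<le> integral\<^sup>L lborel bnd"
    by (rule integral_mono[OF int bi pt])
  also have "\<dots> = t powr m * (2 powr r * (R + (\<integral>x. \<bar>u (Phi x)\<bar> powr r \<partial>lborel)) + (\<integral>x. (\<bar>u (Phi x) - u x\<bar> / t) powr p \<partial>lborel))"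
    unfolding bnd_def R_def using r(2) vr B(1) by simp
  also have "\<dots> \<le> t powr m * (2 powr r * (R + 3 / 2 * R) + (2 * W) powr p * (\<integral>x. norm (g x) powr p \<partial>lborel))"
    using vR B(2) by (intro mult_left_mono add_mono) auto
  finally show "(\<integral>x. (\<bar>u x\<bar> + \<bar>u (Phi x)\<bar>) powr (q - m) * \<bar>u (Phi x) - u x\<bar> powr m \<partial>lborel)
     \<le> t powr m * (2 powr r * (5 / 2) * (\<integral>x. \<bar>u x\<bar> powr r \<partial>lborel) + (2 * W) powr p * (\<integral>x. norm (g x) powr p \<partial>lborel))"
    by (simp add: R_def mult.assoc)
qed

end

section \<open>The weak formulation compared with energies\<close>

text \<open>\<open>n\<close> is the denominator of the kernel. It may be 0, on the diagonal; all
  quotients are then 0.\<close>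

lemma Young_pair:
  fixes U V n p :: real
  assumes p: "1 < p" and n: "0 \<le> n"
  shows "\<bar>U\<bar> powr (p - 2) * U * V / n \<le> (1 - 1 / p) * (\<bar>U\<bar> powr p / n) + (\<bar>V\<bar> powr p / n) / p"
    "\<bar>\<bar>U\<bar> powr (p - 2) * U * V / n\<bar> \<le> \<bar>U\<bar> powr p / n + \<bar>V\<bar> powr p / n"
proof -
  have "\<bar>U\<bar> powr (p - 2) * U * V \<le> (1 - 1 / p) * \<bar>U\<bar> powr p + \<bar>V\<bar> powr p / p"
    using Young_inner(1)[OF p, of U V] by (simp add: mult.assoc)
  then have "\<bar>U\<bar> powr (p - 2) * U * V / n \<le> ((1 - 1 / p) * \<bar>U\<bar> powr p + \<bar>V\<bar> powr p / p) / n"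
    using n by (intro divide_right_mono)
  then show "\<bar>U\<bar> powr (p - 2) * U * V / n \<le> (1 - 1 / p) * (\<bar>U\<bar> powr p / n) + (\<bar>V\<bar> powr p / n) / p"
    by (simp add: add_divide_distrib mult.commute)
  have "\<bar>\<bar>U\<bar> powr (p - 2) * U * V\<bar> \<le> \<bar>U\<bar> powr p + \<bar>V\<bar> powr p"
    using Young_inner(2)[OF p, of U V] by (simp add: mult.assoc)
  then have "\<bar>\<bar>U\<bar> powr (p - 2) * U * V\<bar> / n \<le> (\<bar>U\<bar> powr p + \<bar>V\<bar> powr p) / n"
    using n by (intro divide_right_mono)
  then show "\<bar>\<bar>U\<bar> powr (p - 2) * U * V / n\<bar> \<le> \<bar>U\<bar> powr p / n + \<bar>V\<bar> powr p / n"
    using n by (simp add: abs_divide add_divide_distrib)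
qed

lemma gagliardo_form_bound:
  fixes u v :: "'a::euclidean_space \<Rightarrow> real"
  assumes [measurable]: "u \<in> borel_measurable borel" "v \<in> borel_measurable borel" and p: "1 < p"
    and int: "integrable (lborel \<Otimes>\<^sub>M lborel) (gagliardo_integrand s p u)" "integrable (lborel \<Otimes>\<^sub>M lborel) (gagliardo_integrand s p v)"
  shows "(\<integral>z. (case z of (x,y) \<Rightarrow>
              \<bar>u x - u y\<bar> powr (p - 2) * (u x - u y) * (v x - v y)
                / norm (x - y) powr (real DIM('a) + s * p)) \<partial>(lborel \<Otimes>\<^sub>M lborel))
    \<le> (1 - 1 / p) * integral\<^sup>L (lborel \<Otimes>\<^sub>M lborel) (gagliardo_integrand s p u)
      + integral\<^sup>L (lborel \<Otimes>\<^sub>M lborel) (gagliardo_integrand s p v) / p"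
proof -
  let ?f = "\<lambda>z::'a \<times> 'a. case z of (x,y) \<Rightarrow> \<bar>u x - u y\<bar> powr (p - 2) * (u x - u y) * (v x - v y)
                / norm (x - y) powr (real DIM('a) + s * p)"
  let ?K = "gagliardo_integrand s p"
  have m: "?f \<in> borel_measurable (lborel \<Otimes>\<^sub>M lborel)"
  proof -
    have "?f \<in> borel_measurable (borel \<Otimes>\<^sub>M borel)" by measurable
    then show ?thesis by simp
  qed
  have "integrable (lborel \<Otimes>\<^sub>M lborel) ?f"
  proof (rule Bochner_Integration.integrable_bound[OF Bochner_Integration.integrable_add[OF int] m], rule AE_I2)
    fix z :: "'a \<times> 'a"
    show "norm (?f z) \<le> norm (?K u z + ?K v z)"
      using Young_pair(2)[OF p, of "norm (fst z - snd z) powr (real DIM('a) + s * p)" "u (fst z) - u (snd z)" "v (fst z) - v (snd z)"]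
      by (simp add: gagliardo_integrand_def split_beta')
  qed
  then have "integral\<^sup>L (lborel \<Otimes>\<^sub>M lborel) ?f \<le> (\<integral>z. (1 - 1 / p) * ?K u z + ?K v z / p \<partial>(lborel \<Otimes>\<^sub>M lborel))"
  proof (rule integral_mono)
    fix z :: "'a \<times> 'a"
    show "?f z \<le> (1 - 1 / p) * ?K u z + ?K v z / p"
      using Young_pair(1)[OF p, of "norm (fst z - snd z) powr (real DIM('a) + s * p)" "u (fst z) - u (snd z)" "v (fst z) - v (snd z)"]
      by (simp add: gagliardo_integrand_def split_beta')
  qed (use int in auto)
  also have "\<dots> = (1 - 1 / p) * integral\<^sup>L (lborel \<Otimes>\<^sub>M lborel) (?K u) + integral\<^sup>L (lborel \<Otimes>\<^sub>M lborel) (?K v) / p"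
    using int by simp
  finally show ?thesis .
qed

lemma gradient_form_bound:
  fixes g h :: "'a::euclidean_space \<Rightarrow> 'a"
  assumes [measurable]: "g \<in> borel_measurable borel" "h \<in> borel_measurable borel" and p: "1 < p"
    and int: "integrable lborel (\<lambda>x. norm (g x) powr p)" "integrable lborel (\<lambda>x. norm (h x) powr p)"
  shows "(\<integral>x. norm (g x) powr (p - 2) * (g x \<bullet> h x) \<partial>lborel)
    \<le> (1 - 1 / p) * (\<integral>x. norm (g x) powr p \<partial>lborel) + (\<integral>x. norm (h x) powr p \<partial>lborel) / p"
proof -
  have "integrable lborel (\<lambda>x. norm (g x) powr (p - 2) * (g x \<bullet> h x))"
    by (rule Bochner_Integration.integrable_bound[OF Bochner_Integration.integrable_add[OF int]])
      (use Young_inner(2)[OF p] in auto)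
  then have "(\<integral>x. norm (g x) powr (p - 2) * (g x \<bullet> h x) \<partial>lborel)
    \<le> (\<integral>x. (1 - 1 / p) * norm (g x) powr p + norm (h x) powr p / p \<partial>lborel)"
    by (rule integral_mono) (use int Young_inner(1)[OF p] in auto)
  also have "\<dots> = (1 - 1 / p) * (\<integral>x. norm (g x) powr p \<partial>lborel) + (\<integral>x. norm (h x) powr p \<partial>lborel) / p"
    using int by simp
  finally show ?thesis .
qed

text \<open>Testing with \<open>u\<close> itself; in the variation below this cancels the terms of
  order zero in \<open>t\<close>.\<close>

lemma weak_solution_energy_identity:
  fixes u :: "'a::euclidean_space \<Rightarrow> real"
  assumes sol: "weak_solution s p u" and g: "weak_gradient u g"
  shows "(\<integral>x. norm (g x) powr p \<partial>lborel) + integral\<^sup>L (lborel \<Otimes>\<^sub>M lborel) (gagliardo_integrand s p u)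
    = (\<integral>x. \<bar>u x\<bar> powr crit_exp TYPE('a) p \<partial>lborel)"
proof -
  have "u \<in> W_space s p" using sol by (simp add: weak_solution_def)
  with sol g have "(\<integral>x. norm (g x) powr (p - 2) * (g x \<bullet> g x) \<partial>lborel)
        + (\<integral>z. (case z of (x,y) \<Rightarrow>
              \<bar>u x - u y\<bar> powr (p - 2) * (u x - u y) * (u x - u y)
                / norm (x - y) powr (real DIM('a) + s * p)) \<partial>(lborel \<Otimes>\<^sub>M lborel))
        = (\<integral>x. \<bar>u x\<bar> powr (crit_exp TYPE('a) p - 2) * u x * u x \<partial>lborel)"
    unfolding weak_solution_def by blast
  then show ?thesis unfolding powr_norm_self powr_abs_self gagliardo_integrand_def .
qed

context coord_change
begin

text \<open>The equation is evaluated at the deformed function, and the energy identity supplies the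
  part with \<open>u\<close>; together they amount to testing with the increment. The orders t, t^2
  and t^m stay separate, so that the limit only has to divide by \<open>t\<close>.\<close>

lemma domain_variation:
  fixes u :: "'a \<Rightarrow> real"
  assumes sol: "weak_solution s p u" and p: "1 < p" "p < real DIM('a)" and s: "0 \<le> s"
    and g: "weak_gradient u g" "integrable lborel (\<lambda>x. norm (g x) powr p)"
    and t: "0 < t" "t \<le> 1 / 2" and c: "\<And>r. \<tau>' r = 1 - t * c r" "\<And>r. \<bar>c r\<bar> \<le> 1" "c \<in> borel_measurable borel"
    and w: "\<And>r. \<tau> r = r - t * w r" "\<And>a b. \<bar>w a - w b\<bar> \<le> \<bar>a - b\<bar>" "\<And>r. \<bar>w r\<bar> \<le> W" "0 < W" "w \<in> borel_measurable borel"
    and CA: "0 \<le> CA" "\<And>s \<theta>. \<bar>s\<bar> \<le> 1 / 2 \<Longrightarrow> 0 \<le> \<theta> \<Longrightarrow> \<theta> \<le> 1 \<Longrightarrow>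
      (1 - s) * (1 + \<theta> * ((1 / (1 - s))\<^sup>2 - 1)) powr (p / 2) \<le> 1 + s * (p * \<theta> - 1) + CA * s\<^sup>2"
    and CB: "0 \<le> CB" "\<And>t r \<theta> a b. 0 \<le> t \<Longrightarrow> t \<le> 1 / 2 \<Longrightarrow> \<bar>r\<bar> \<le> 1 \<Longrightarrow> 0 \<le> \<theta> \<Longrightarrow> \<theta> \<le> 1 \<Longrightarrow> \<bar>a\<bar> \<le> 1 \<Longrightarrow> \<bar>b\<bar> \<le> 1 \<Longrightarrow>
      (1 - t * a) * (1 - t * b) * (1 + \<theta> * ((1 - t * r)\<^sup>2 - 1)) powr (- \<kappa> / 2) \<le> 1 + t * (\<kappa> * (\<theta> * r) - a - b) + CB * t\<^sup>2"
    and \<kappa>: "\<kappa> = real DIM('a) + s * p" and q: "q = crit_exp TYPE('a) p"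
    and m: "1 < m" "m \<le> 2" "m < p" and r: "r = (q - m) * p / (p - m)"
  defines "a0 \<equiv> (\<integral>x. norm (g x) powr p \<partial>lborel)"
    and "K \<equiv> gagliardo_integrand s p u"
  shows "- (t / q) * (\<integral>x. c (x \<bullet> i) * \<bar>u x\<bar> powr q \<partial>lborel)
      - 2 * max 1 (q - 1) * (t powr m * (2 powr r * (5 / 2) * (\<integral>x. \<bar>u x\<bar> powr r \<partial>lborel) + (2 * W) powr p * a0))
    \<le> t / p * ((\<integral>x. c (x \<bullet> i) * (p * (norm (g x) powr (p - 2) * (g x \<bullet> i)\<^sup>2) - norm (g x) powr p) \<partial>lborel)
        + (\<integral>z. K z * (\<kappa> * (((fst z - snd z) \<bullet> i) * (w (fst z \<bullet> i) - w (snd z \<bullet> i)) / (norm (fst z - snd z))\<^sup>2)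
             - c (fst z \<bullet> i) - c (snd z \<bullet> i)) \<partial>(lborel \<Otimes>\<^sub>M lborel)))
      + t\<^sup>2 * ((CA * a0 + CB * integral\<^sup>L (lborel \<Otimes>\<^sub>M lborel) K) / p)"
proof -
  note qf = crit_exp_facts[where 'a='a, OF p, folded q]
  have uW: "u \<in> W_space s p" using sol by (simp add: weak_solution_def)
  then have uq: "integrable lborel (\<lambda>x. \<bar>u x\<bar> powr q)" and Kint: "integrable (lborel \<Otimes>\<^sub>M lborel) K"
    by (auto simp: W_space_def in_Lp_def q K_def)
  have [measurable]: "u \<in> borel_measurable borel" "g \<in> borel_measurable borel"
    using g by (auto simp: weak_gradient_def loc_integrable_def)
  note c(3)[measurable] w(5)[measurable]
  have Km: "K \<in> borel_measurable (borel \<Otimes>\<^sub>M borel)" using borel_measurable_integrable[OF Kint] by simp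
  note Km[measurable]
  have K0: "0 \<le> K z" for z by (simp add: K_def gagliardo_integrand_def split_beta')
  let ?v = "\<lambda>x. u (Phi x)" and ?h = "grad_Phi g"
  note V = W_space_Phi[OF uW p s g]
  have [measurable]: "?h \<in> borel_measurable borel"
    using V(2) by (auto simp: weak_gradient_def loc_integrable_def)
  let ?b0 = "integral\<^sup>L (lborel \<Otimes>\<^sub>M lborel) K"
  let ?c0 = "\<integral>x. \<bar>u x\<bar> powr q \<partial>lborel"
  define fA where "fA x = c (x \<bullet> i) * (p * (norm (g x) powr (p - 2) * (g x \<bullet> i)\<^sup>2) - norm (g x) powr p)" for x
  define fB where "fB z = K z * (\<kappa> * (((fst z - snd z) \<bullet> i) * (w (fst z \<bullet> i) - w (snd z \<bullet> i)) / (norm (fst z - snd z))\<^sup>2)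
             - c (fst z \<bullet> i) - c (snd z \<bullet> i))" for z
  define fC where "fC x = c (x \<bullet> i) * \<bar>u x\<bar> powr q" for x
  note gi = powr_norm_coord_le[OF i]
  have fAi: "integrable lborel fA"
  proof (rule Bochner_Integration.integrable_bound[OF integrable_mult_right[OF g(2), of "p + 1"]])
    show "fA \<in> borel_measurable lborel" unfolding fA_def[abs_def] by simp
    show "AE x in lborel. norm (fA x) \<le> norm ((p + 1) * norm (g x) powr p)"
    proof (rule AE_I2)
      fix x
      have "\<bar>p * (norm (g x) powr (p - 2) * (g x \<bullet> i)\<^sup>2) - norm (g x) powr p\<bar> \<le> p * norm (g x) powr p + norm (g x) powr p"
      proof -
        have "0 \<le> p * (norm (g x) powr (p - 2) * (g x \<bullet> i)\<^sup>2)" "0 \<le> norm (g x) powr p" using p by auto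
        moreover have "p * (norm (g x) powr (p - 2) * (g x \<bullet> i)\<^sup>2) \<le> p * norm (g x) powr p"
          using p by (intro mult_left_mono gi) auto
        ultimately show ?thesis by linarith
      qed
      then have "\<bar>c (x \<bullet> i)\<bar> * \<bar>p * (norm (g x) powr (p - 2) * (g x \<bullet> i)\<^sup>2) - norm (g x) powr p\<bar> \<le> 1 * (p * norm (g x) powr p + norm (g x) powr p)"
        using c(2) by (intro mult_mono) auto
      then have "norm (fA x) \<le> p * norm (g x) powr p + norm (g x) powr p"
        unfolding fA_def real_norm_def abs_mult[of "c (x \<bullet> i)"] by simp
      also have "\<dots> = norm ((p + 1) * norm (g x) powr p)" using p by (simp add: abs_mult distrib_right)
      finally show "norm (fA x) \<le> norm ((p + 1) * norm (g x) powr p)" .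
    qed
  qed
  have \<kappa>0: "0 < \<kappa>" using s p unfolding \<kappa> by (intro add_pos_nonneg) auto
  have fBi: "integrable (lborel \<Otimes>\<^sub>M lborel) fB"
  proof (rule Bochner_Integration.integrable_bound[OF integrable_mult_right[OF Kint, of "\<kappa> + 2"]])
    have "fB \<in> borel_measurable (borel \<Otimes>\<^sub>M borel)" unfolding fB_def[abs_def] by measurable
    then show "fB \<in> borel_measurable (lborel \<Otimes>\<^sub>M lborel)" by simp
    show "AE z in lborel \<Otimes>\<^sub>M lborel. norm (fB z) \<le> norm ((\<kappa> + 2) * K z)"
    proof (rule AE_I2)
      fix z :: "'a \<times> 'a"
      define d where "d = (fst z - snd z) \<bullet> i"
      define om where "om = w (fst z \<bullet> i) - w (snd z \<bullet> i)"
      have om: "\<bar>om\<bar> \<le> \<bar>d\<bar>" using w(2)[of "fst z \<bullet> i" "snd z \<bullet> i"] by (simp add: om_def d_def inner_diff_left)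
      have dq: "\<bar>d * om / (norm (fst z - snd z))\<^sup>2\<bar> \<le> 1"
        using inner_ratio_le_1[OF i om[unfolded d_def]] by (simp add: d_def)
      have "\<bar>\<kappa> * (d * om / (norm (fst z - snd z))\<^sup>2)\<bar> \<le> \<kappa> * 1"
        unfolding abs_mult[of \<kappa>] using \<kappa>0 dq by (intro mult_mono) auto
      then have "\<bar>\<kappa> * (d * om / (norm (fst z - snd z))\<^sup>2) - c (fst z \<bullet> i) - c (snd z \<bullet> i)\<bar> \<le> \<kappa> + 2"
        using c(2)[of "fst z \<bullet> i"] c(2)[of "snd z \<bullet> i"] by linarith
      then show "norm (fB z) \<le> norm ((\<kappa> + 2) * K z)"
        unfolding fB_def d_def om_def using K0[of z] \<kappa>0 mult_left_mono by (fastforce simp: abs_mult mult.commute)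
    qed
  qed
  have fCi: "integrable lborel fC"
    by (rule Bochner_Integration.integrable_bound[OF uq])
      (use c(2) in \<open>auto simp: fC_def[abs_def] abs_mult mult_left_le_one_le\<close>)
  \<comment> \<open>The pointwise bound is integrated in the preimage variable, where it is
    explicit; \<open>B\<close> below does the same for pairs of points.\<close>
  have A: "(\<integral>x. norm (?h x) powr p \<partial>lborel) \<le> a0 + t * integral\<^sup>L lborel fA + t\<^sup>2 * (CA * a0)"
  proof -
    have "(\<integral>x. norm (?h x) powr p \<partial>lborel) = (\<integral>y. \<tau>' (y \<bullet> i) * norm (transported_grad g y) powr p \<partial>lborel)" by (rule V(4))
    also have "\<dots> \<le> (\<integral>y. norm (g y) powr p + t * fA y + t\<^sup>2 * (CA * norm (g y) powr p) \<partial>lborel)"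
    proof (rule integral_mono)
      fix y
      show "\<tau>' (y \<bullet> i) * norm (transported_grad g y) powr p \<le> norm (g y) powr p + t * fA y + t\<^sup>2 * (CA * norm (g y) powr p)"
        unfolding fA_def using t by (intro transported_grad_powr_bound[OF p(1) _ t(2) c(1,2) CA]) auto
    qed (use V(5) g(2) fAi in auto)
    also have "\<dots> = a0 + t * integral\<^sup>L lborel fA + t\<^sup>2 * (CA * a0)"
      using g(2) fAi by (simp add: a0_def)
    finally show ?thesis .
  qed
  note G = gagliardo_Phi[OF \<open>u \<in> borel_measurable borel\<close> _ s Kint[unfolded K_def], folded \<kappa>]
  have B: "integral\<^sup>L (lborel \<Otimes>\<^sub>M lborel) (gagliardo_integrand s p ?v) \<le> ?b0 + t * integral\<^sup>L (lborel \<Otimes>\<^sub>M lborel) fB + t\<^sup>2 * (CB * ?b0)"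
  proof -
    have "integral\<^sup>L (lborel \<Otimes>\<^sub>M lborel) (gagliardo_integrand s p ?v)
      = (\<integral>z. \<tau>' (fst z \<bullet> i) * \<tau>' (snd z \<bullet> i) * (\<bar>u (fst z) - u (snd z)\<bar> powr p
      / norm (Psi (fst z) - Psi (snd z)) powr \<kappa>) \<partial>(lborel \<Otimes>\<^sub>M lborel))" using G(3) p by simp
    also have "\<dots> \<le> (\<integral>z. K z + t * fB z + t\<^sup>2 * (CB * K z) \<partial>(lborel \<Otimes>\<^sub>M lborel))"
    proof (rule integral_mono)
      fix z :: "'a \<times> 'a"
      show "\<tau>' (fst z \<bullet> i) * \<tau>' (snd z \<bullet> i) * (\<bar>u (fst z) - u (snd z)\<bar> powr p / norm (Psi (fst z) - Psi (snd z)) powr \<kappa>)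
        \<le> K z + t * fB z + t\<^sup>2 * (CB * K z)"
        using kernel_Psi_bound[OF \<kappa>0 _ t(2) c(1,2) w(1,2) CB, of "\<bar>u (fst z) - u (snd z)\<bar> powr p" "fst z" "snd z"] t
        by (simp add: fB_def K_def gagliardo_integrand_def split_beta' \<kappa>)
    qed (use G(1) p Kint fBi in auto)
    also have "\<dots> = ?b0 + t * integral\<^sup>L (lborel \<Otimes>\<^sub>M lborel) fB + t\<^sup>2 * (CB * ?b0)"
      using Kint fBi by simp
    finally show ?thesis .
  qed
  have mq: "1 \<le> m" "m \<le> q" "0 < m" "m < q" using m qf by auto
  \<comment> \<open>Equivalent to p \<le> q, and the reason why the solution must be more than L^q
    integrable.\<close>
  have rq: "q \<le> r"
  proof -
    have "q * (p - m) \<le> (q - m) * p" using m qf by (simp add: algebra_simps)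
    then show ?thesis using m by (simp add: r pos_le_divide_eq)
  qed
  have ur: "integrable lborel (\<lambda>x. \<bar>u x\<bar> powr r)"
    using weak_solution_higher_integrability[OF sol p] rq q by simp
  note R = remainder_bound[OF g p(1) t(1) w(1,3,4) mq(3) m(3) mq(4) r ur]
  note Q = integral_Phi[where f = "\<lambda>x. \<bar>u x\<bar> powr q", OF _ _ uq]
  have vq: "integrable lborel (\<lambda>x. \<bar>?v x\<bar> powr q)" using Q by auto
  have Qeq: "(\<integral>x. \<bar>?v x\<bar> powr q \<partial>lborel) = ?c0 - t * integral\<^sup>L lborel fC"
  proof -
    have "(\<integral>x. \<bar>?v x\<bar> powr q \<partial>lborel) = (\<integral>y. \<tau>' (y \<bullet> i) * \<bar>u y\<bar> powr q \<partial>lborel)" using Q by auto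
    also have "\<dots> = (\<integral>y. \<bar>u y\<bar> powr q - t * fC y \<partial>lborel)" by (simp add: c(1) fC_def algebra_simps)
    also have "\<dots> = ?c0 - t * integral\<^sup>L lborel fC" using uq fCi by simp
    finally show ?thesis .
  qed
  define M where "M = 2 * max 1 (q - 1)"
  define rem where "rem x = (\<bar>u x\<bar> + \<bar>?v x\<bar>) powr (q - m) * \<bar>?v x - u x\<bar> powr m" for x
  \<comment> \<open>The critical side is the only one to be bounded from below, and so the only one
    to pay the remainder \<open>rem\<close>. Its first-order part is the exact change of the L^q
    integral.\<close>
  have C: "?c0 + (- (t / q) * integral\<^sup>L lborel fC - M * integral\<^sup>L lborel rem) \<le> (\<integral>x. \<bar>u x\<bar> powr (q - 2) * u x * ?v x \<partial>lborel)"
  proof -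
    have remi: "integrable lborel rem" unfolding rem_def using R(1) .
    have fv: "integrable lborel (\<lambda>x. \<bar>u x\<bar> powr (q - 2) * u x * ?v x)"
    proof (rule Bochner_Integration.integrable_bound[OF Bochner_Integration.integrable_add[OF uq vq]])
      show "AE x in lborel. norm (\<bar>u x\<bar> powr (q - 2) * u x * ?v x) \<le> norm (\<bar>u x\<bar> powr q + \<bar>?v x\<bar> powr q)"
        using Young_inner(2)[OF qf(2), of "u _" "?v _"] by (auto simp: mult.assoc)
    qed simp
    have "?c0 + (- (t / q) * integral\<^sup>L lborel fC - M * integral\<^sup>L lborel rem)
      = (\<integral>x. \<bar>u x\<bar> powr q + ((\<bar>?v x\<bar> powr q - \<bar>u x\<bar> powr q) / q - M * rem x) \<partial>lborel)"
      using uq vq remi Qeq by (simp add: diff_divide_distrib)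
    also have "\<dots> \<le> (\<integral>x. \<bar>u x\<bar> powr (q - 2) * u x * ?v x \<partial>lborel)"
    proof (rule integral_mono)
      fix x
      show "\<bar>u x\<bar> powr q + ((\<bar>?v x\<bar> powr q - \<bar>u x\<bar> powr q) / q - M * rem x) \<le> \<bar>u x\<bar> powr (q - 2) * u x * ?v x"
        using signed_powr_increment_lower[OF qf(2) mq(1) m(2) mq(2), where a = "u x" and b = "?v x"] powr_abs_self[of "u x" q]
        unfolding M_def rem_def right_diff_distrib by linarith
    qed (use uq vq remi fv in auto)
    finally show ?thesis .
  qed
  have eq: "(\<integral>x. norm (g x) powr (p - 2) * (g x \<bullet> ?h x) \<partial>lborel)
        + (\<integral>z. (case z of (x,y) \<Rightarrow>
              \<bar>u x - u y\<bar> powr (p - 2) * (u x - u y) * (?v x - ?v y)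
                / norm (x - y) powr (real DIM('a) + s * p)) \<partial>(lborel \<Otimes>\<^sub>M lborel))
        = (\<integral>x. \<bar>u x\<bar> powr (q - 2) * u x * ?v x \<partial>lborel)"
    using sol g(1) V(1,2) unfolding weak_solution_def q by blast
  have A': "(\<integral>x. norm (g x) powr (p - 2) * (g x \<bullet> ?h x) \<partial>lborel) \<le> (1 - 1 / p) * a0 + (a0 + t * integral\<^sup>L lborel fA + t\<^sup>2 * (CA * a0)) / p"
    using gradient_form_bound[OF _ _ p(1) g(2) V(3)] divide_right_mono[OF A, of p] p by (simp add: a0_def)
  have B': "(\<integral>z. (case z of (x,y) \<Rightarrow>
              \<bar>u x - u y\<bar> powr (p - 2) * (u x - u y) * (?v x - ?v y)
                / norm (x - y) powr (real DIM('a) + s * p)) \<partial>(lborel \<Otimes>\<^sub>M lborel))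
     \<le> (1 - 1 / p) * ?b0 + (?b0 + t * integral\<^sup>L (lborel \<Otimes>\<^sub>M lborel) fB + t\<^sup>2 * (CB * ?b0)) / p"
  proof -
    have "?v \<in> borel_measurable borel" by simp
    from gagliardo_form_bound[OF \<open>u \<in> borel_measurable borel\<close> this p(1) Kint[unfolded K_def] G(2), folded K_def]
      divide_right_mono[OF B, of p] p show ?thesis by simp
  qed
  have E: "a0 + ?b0 = ?c0" using weak_solution_energy_identity[OF sol g(1)] by (simp add: a0_def K_def q)
  have "M * integral\<^sup>L lborel rem \<le> M * (t powr m * (2 powr r * (5 / 2) * (\<integral>x. \<bar>u x\<bar> powr r \<partial>lborel) + (2 * W) powr p * a0))"
    using R(2) unfolding rem_def a0_def by (intro mult_left_mono) (auto simp: M_def)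
  moreover have "(1 - 1 / p) * a0 + (a0 + t * integral\<^sup>L lborel fA + t\<^sup>2 * (CA * a0)) / p
      + ((1 - 1 / p) * ?b0 + (?b0 + t * integral\<^sup>L (lborel \<Otimes>\<^sub>M lborel) fB + t\<^sup>2 * (CB * ?b0)) / p)
      = ?c0 + (t / p * (integral\<^sup>L lborel fA + integral\<^sup>L (lborel \<Otimes>\<^sub>M lborel) fB) + t\<^sup>2 * ((CA * a0 + CB * ?b0) / p))"
    unfolding E[symmetric] using p by (simp add: field_simps)
  ultimately have "- (t / q) * integral\<^sup>L lborel fC
      - M * (t powr m * (2 powr r * (5 / 2) * (\<integral>x. \<bar>u x\<bar> powr r \<partial>lborel) + (2 * W) powr p * a0))
    \<le> t / p * (integral\<^sup>L lborel fA + integral\<^sup>L (lborel \<Otimes>\<^sub>M lborel) fB) + t\<^sup>2 * ((CA * a0 + CB * ?b0) / p)"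
    using C eq A' B' by linarith
  then show ?thesis unfolding fA_def fB_def fC_def M_def .
qed

end

section \<open>The sine field and the two limits\<close>

text \<open>The displacement is at most 1 / \<epsilon>, so the intermediate value theorem on an
  interval of that radius gives surjectivity, and \<open>inv\<close> is a right inverse. The bounds
  1 / 2 and 3 / 2 of the locale come from t \<le> 1 / 2.\<close>

lemma coord_change_sin:
  fixes i :: "'a::euclidean_space"
  assumes i: "i \<in> Basis" and \<epsilon>: "0 < \<epsilon>" and t: "0 < t" "t \<le> 1 / 2"
  defines "\<tau> \<equiv> \<lambda>r. r - t * (sin (\<epsilon> * r) / \<epsilon>)"
  shows "coord_change i \<tau> (\<lambda>r. 1 - t * cos (\<epsilon> * r)) (inv \<tau>)"
proof
  have tc: "\<bar>t * cos (\<epsilon> * r)\<bar> \<le> t" for r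
    using t abs_cos_le_one[of "\<epsilon> * r"] mult_left_mono[of "\<bar>cos (\<epsilon> * r)\<bar>" 1 t] by (simp add: abs_mult)
  show "i \<in> Basis" by fact
  show d: "(\<tau> has_real_derivative 1 - t * cos (\<epsilon> * r)) (at r)" for r
    unfolding \<tau>_def using \<epsilon> by (auto intro!: derivative_eq_intros)
  show "continuous_on UNIV (\<lambda>r. 1 - t * cos (\<epsilon> * r))" by (intro continuous_intros)
  show "1 / 2 \<le> 1 - t * cos (\<epsilon> * r)" "1 - t * cos (\<epsilon> * r) \<le> 3 / 2" for r using tc[of r] t by linarith+
  have "surj \<tau>"
    unfolding surj_def
  proof
    fix y
    have b: "\<bar>t * (sin (\<epsilon> * r) / \<epsilon>)\<bar> \<le> 1 / \<epsilon>" for r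
    proof -
      have "t * \<bar>sin (\<epsilon> * r)\<bar> \<le> 1 * 1" using t by (intro mult_mono) auto
      then show ?thesis using \<epsilon> t by (simp add: abs_mult abs_divide divide_right_mono)
    qed
    have "\<exists>x\<ge>y - 1 / \<epsilon>. x \<le> y + 1 / \<epsilon> \<and> \<tau> x = y"
    proof (rule IVT')
      show "\<tau> (y - 1 / \<epsilon>) \<le> y" "y \<le> \<tau> (y + 1 / \<epsilon>)"
        using b[of "y - 1 / \<epsilon>"] b[of "y + 1 / \<epsilon>"] unfolding \<tau>_def by linarith+
      show "y - 1 / \<epsilon> \<le> y + 1 / \<epsilon>" using \<epsilon> by simp
      show "continuous_on {y - 1 / \<epsilon>..y + 1 / \<epsilon>} \<tau>"
        using d by (auto intro!: continuous_at_imp_continuous_on DERIV_isCont)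
    qed
    then show "\<exists>x. y = \<tau> x" by auto
  qed
  then show "\<tau> (inv \<tau> r) = r" for r by (rule surj_f_inv_f)
qed

lemma sin_scaled_diff_le:
  fixes \<epsilon> :: real
  assumes \<epsilon>: "0 < \<epsilon>"
  shows "\<bar>sin (\<epsilon> * a) / \<epsilon> - sin (\<epsilon> * b) / \<epsilon>\<bar> \<le> \<bar>a - b\<bar>"
proof -
  obtain z where "sin (\<epsilon> * a) - sin (\<epsilon> * b) = cos z * (\<epsilon> * a - \<epsilon> * b)"
    using MVT_closed_segment[of sin cos "\<epsilon> * b" "\<epsilon> * a"] DERIV_sin by blast
  then have "\<bar>sin (\<epsilon> * a) - sin (\<epsilon> * b)\<bar> \<le> 1 * \<bar>\<epsilon> * a - \<epsilon> * b\<bar>"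
    unfolding abs_mult by (metis abs_cos_le_one abs_ge_zero abs_mult mult_right_mono)
  also have "\<dots> = \<epsilon> * \<bar>a - b\<bar>" using \<epsilon> by (simp add: right_diff_distrib[symmetric] abs_mult)
  finally show ?thesis using \<epsilon> by (simp add: diff_divide_distrib[symmetric] abs_divide divide_le_eq mult.commute)
qed

text \<open>After division by \<open>t\<close> the remainder is of order t^(m - 1) and vanishes. Its
  constant contains a power of 1 / \<epsilon>, so \<epsilon> stays fixed in this limit.\<close>

lemma directional_inequality:
  fixes u :: "'a::euclidean_space \<Rightarrow> real"
  assumes sol: "weak_solution s p u" and p: "1 < p" "p < real DIM('a)" and s: "0 \<le> s"
    and g: "weak_gradient u g" "integrable lborel (\<lambda>x. norm (g x) powr p)"
    and i: "i \<in> Basis" and \<epsilon>: "0 < \<epsilon>"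
  shows "- (1 / crit_exp TYPE('a) p) * (\<integral>x. cos (\<epsilon> * (x \<bullet> i)) * \<bar>u x\<bar> powr crit_exp TYPE('a) p \<partial>lborel)
    \<le> 1 / p * ((\<integral>x. cos (\<epsilon> * (x \<bullet> i)) * (p * (norm (g x) powr (p - 2) * (g x \<bullet> i)\<^sup>2) - norm (g x) powr p) \<partial>lborel)
        + (\<integral>z. gagliardo_integrand s p u z * ((real DIM('a) + s * p) *
             (((fst z - snd z) \<bullet> i) * (sin (\<epsilon> * (fst z \<bullet> i)) / \<epsilon> - sin (\<epsilon> * (snd z \<bullet> i)) / \<epsilon>) / (norm (fst z - snd z))\<^sup>2)
             - cos (\<epsilon> * (fst z \<bullet> i)) - cos (\<epsilon> * (snd z \<bullet> i))) \<partial>(lborel \<Otimes>\<^sub>M lborel)))"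
    (is "?L \<le> ?R")
proof -
  let ?q = "crit_exp TYPE('a) p" and ?\<kappa> = "real DIM('a) + s * p"
  note q = crit_exp_facts[where 'a='a, OF p]
  \<comment> \<open>Any exponent with 1 < m < p and m \<le> 2 works; this is the midpoint of 1 and
    \<open>p\<close>, capped at 2.\<close>
  define m where "m = min 2 ((1 + p) / 2)"
  have m: "1 < m" "m \<le> 2" "m < p" using p by (auto simp: m_def min_def)
  have \<kappa>: "0 < ?\<kappa>" using s p by (intro add_pos_nonneg) auto
  have p0: "0 < p" using p by simp
  obtain CA where CA: "0 \<le> CA" "\<And>s \<theta>. \<bar>s\<bar> \<le> 1 / 2 \<Longrightarrow> 0 \<le> \<theta> \<Longrightarrow> \<theta> \<le> 1 \<Longrightarrow>
      (1 - s) * (1 + \<theta> * ((1 / (1 - s))\<^sup>2 - 1)) powr (p / 2) \<le> 1 + s * (p * \<theta> - 1) + CA * s\<^sup>2"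
    using gradient_factor_bound[OF p0] by blast
  obtain CB where CB: "0 \<le> CB" "\<And>t r \<theta> a b. 0 \<le> t \<Longrightarrow> t \<le> 1 / 2 \<Longrightarrow> \<bar>r\<bar> \<le> 1 \<Longrightarrow> 0 \<le> \<theta> \<Longrightarrow> \<theta> \<le> 1 \<Longrightarrow> \<bar>a\<bar> \<le> 1 \<Longrightarrow> \<bar>b\<bar> \<le> 1 \<Longrightarrow>
      (1 - t * a) * (1 - t * b) * (1 + \<theta> * ((1 - t * r)\<^sup>2 - 1)) powr (- ?\<kappa> / 2) \<le> 1 + t * (?\<kappa> * (\<theta> * r) - a - b) + CB * t\<^sup>2"
    using kernel_factor_bound[OF \<kappa>] by blast
  let ?r = "(?q - m) * p / (p - m)"
  define a0 where "a0 = (\<integral>x. norm (g x) powr p \<partial>lborel)"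
  define D1 where "D1 = 2 * max 1 (?q - 1) * (2 powr ?r * (5 / 2) * (\<integral>x. \<bar>u x\<bar> powr ?r \<partial>lborel) + (2 * (1 / \<epsilon>)) powr p * a0)"
  define D2 where "D2 = (CA * a0 + CB * integral\<^sup>L (lborel \<Otimes>\<^sub>M lborel) (gagliardo_integrand s p u)) / p"
  note sin_diff = sin_scaled_diff_le[OF \<epsilon>]
  have ineq: "?L \<le> ?R + (t * D2 + t powr (m - 1) * D1)" if t: "0 < t" "t \<le> 1 / 2" for t
  proof -
    let ?\<tau> = "\<lambda>r. r - t * (sin (\<epsilon> * r) / \<epsilon>)"
    interpret coord_change i ?\<tau> "\<lambda>r. 1 - t * cos (\<epsilon> * r)" "inv ?\<tau>"
      by (rule coord_change_sin[OF i \<epsilon> t])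
    have "- (t / ?q) * (\<integral>x. cos (\<epsilon> * (x \<bullet> i)) * \<bar>u x\<bar> powr ?q \<partial>lborel)
      - 2 * max 1 (?q - 1) * (t powr m * (2 powr ?r * (5 / 2) * (\<integral>x. \<bar>u x\<bar> powr ?r \<partial>lborel) + (2 * (1 / \<epsilon>)) powr p * a0))
      \<le> t / p * (p * ?R) + t\<^sup>2 * D2"
    proof -
      have R: "p * ?R = (\<integral>x. cos (\<epsilon> * (x \<bullet> i)) * (p * (norm (g x) powr (p - 2) * (g x \<bullet> i)\<^sup>2) - norm (g x) powr p) \<partial>lborel)
        + (\<integral>z. gagliardo_integrand s p u z * (?\<kappa> *
             (((fst z - snd z) \<bullet> i) * (sin (\<epsilon> * (fst z \<bullet> i)) / \<epsilon> - sin (\<epsilon> * (snd z \<bullet> i)) / \<epsilon>) / (norm (fst z - snd z))\<^sup>2)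
             - cos (\<epsilon> * (fst z \<bullet> i)) - cos (\<epsilon> * (snd z \<bullet> i))) \<partial>(lborel \<Otimes>\<^sub>M lborel))"
        using p0 by simp
      show ?thesis unfolding R D2_def a0_def
        by (rule domain_variation[where c = "\<lambda>r. cos (\<epsilon> * r)" and w = "\<lambda>r. sin (\<epsilon> * r) / \<epsilon>",
              OF sol p s g t _ _ _ _ sin_diff _ _ _ CA CB refl refl m refl])
          (use \<epsilon> in \<open>auto simp: abs_divide divide_right_mono\<close>)
    qed
    then have "t * ?L \<le> t * ?R + t\<^sup>2 * D2 + t powr m * D1" using p0 by (simp add: D1_def mult.assoc mult.left_commute[of _ "t powr m"])
    also have "\<dots> = t * (?R + (t * D2 + t powr (m - 1) * D1))"
      using t by (simp add: powr_diff power2_eq_square distrib_left)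
    finally show ?thesis using t by (simp only: mult_le_cancel_left_pos)
  qed
  have lim: "((\<lambda>t. ?R + (t * D2 + t powr (m - 1) * D1)) \<longlongrightarrow> ?R + (0 * D2 + 0 * D1)) (at_right 0)"
  proof (intro tendsto_intros)
    have "((\<lambda>t. t powr (m - 1)) \<longlongrightarrow> 0 powr (m - 1)) (at_right 0)"
      using m by (intro tendsto_powr2 tendsto_intros) (auto simp: eventually_at_right_field intro!: exI[of _ 1])
    then show "((\<lambda>t. t powr (m - 1)) \<longlongrightarrow> 0) (at_right 0)" by simp
  qed
  have "?L \<le> ?R + (0 * D2 + 0 * D1)"
  proof (rule tendsto_lowerbound[OF lim])
    show "\<forall>\<^sub>F t in at_right 0. ?L \<le> ?R + (t * D2 + t powr (m - 1) * D1)"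
      unfolding eventually_at_right_field by (rule exI[of _ "1 / 2"]) (use ineq in auto)
  qed simp
  then show ?thesis by simp
qed

lemma sin_scaled_tendsto: "(\<lambda>n. sin (inverse (real (Suc n)) * a) / inverse (real (Suc n))) \<longlonglongrightarrow> a"
proof -
  have "((\<lambda>e. sin (e * a)) has_real_derivative cos (0 * a) * a) (at 0)"
    by (auto intro!: derivative_eq_intros)
  then have "((\<lambda>h. sin (h * a) / h) \<longlongrightarrow> a) (at 0)" by (simp add: has_field_derivative_iff)
  moreover have "filterlim (\<lambda>n. inverse (real (Suc n))) (at 0) sequentially"
    by (rule filterlim_atI[OF LIMSEQ_inverse_real_of_nat]) auto
  ultimately show ?thesis by (rule filterlim_compose)
qed

lemma cos_scaled_tendsto: "(\<lambda>n. cos (inverse (real (Suc n)) * a)) \<longlonglongrightarrow> 1"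
proof -
  have "(\<lambda>n. cos (inverse (real (Suc n)) * a)) \<longlonglongrightarrow> cos (0 * a)"
    by (intro tendsto_intros LIMSEQ_inverse_real_of_nat)
  then show ?thesis by simp
qed

text \<open>The sine fields are 1-Lipschitz for every \<epsilon>, so \<kappa> + 2 times the
  Gagliardo integrand dominates the nonlocal terms uniformly, and dominated convergence replaces the
  fields by the linear one.\<close>

lemma pohozaev_directional:
  fixes u :: "'a::euclidean_space \<Rightarrow> real"
  assumes sol: "weak_solution s p u" and p: "1 < p" "p < real DIM('a)" and s: "0 \<le> s"
    and g: "weak_gradient u g" "integrable lborel (\<lambda>x. norm (g x) powr p)"
    and i: "i \<in> Basis"
  shows "- (1 / crit_exp TYPE('a) p) * (\<integral>x. \<bar>u x\<bar> powr crit_exp TYPE('a) p \<partial>lborel)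
    \<le> 1 / p * ((\<integral>x. (p * (norm (g x) powr (p - 2) * (g x \<bullet> i)\<^sup>2) - norm (g x) powr p) \<partial>lborel)
        + (\<integral>z. gagliardo_integrand s p u z * ((real DIM('a) + s * p) *
             (((fst z - snd z) \<bullet> i)\<^sup>2 / (norm (fst z - snd z))\<^sup>2) - 2) \<partial>(lborel \<Otimes>\<^sub>M lborel)))"
    "integrable lborel (\<lambda>x. norm (g x) powr (p - 2) * (g x \<bullet> i)\<^sup>2)"
    "integrable (lborel \<Otimes>\<^sub>M lborel) (\<lambda>z. gagliardo_integrand s p u z * (((fst z - snd z) \<bullet> i)\<^sup>2 / (norm (fst z - snd z))\<^sup>2))"
proof -
  let ?q = "crit_exp TYPE('a) p" and ?\<kappa> = "real DIM('a) + s * p"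
  define K where "K = gagliardo_integrand s p u"
  have uW: "u \<in> W_space s p" using sol by (simp add: weak_solution_def)
  then have uq: "integrable lborel (\<lambda>x. \<bar>u x\<bar> powr ?q)" and Kint: "integrable (lborel \<Otimes>\<^sub>M lborel) K"
    by (auto simp: W_space_def in_Lp_def K_def)
  have [measurable]: "u \<in> borel_measurable borel" "g \<in> borel_measurable borel"
    using g by (auto simp: weak_gradient_def loc_integrable_def)
  have Km: "K \<in> borel_measurable (borel \<Otimes>\<^sub>M borel)" using borel_measurable_integrable[OF Kint] by simp
  note Km[measurable]
  have K0: "0 \<le> K z" for z by (simp add: K_def gagliardo_integrand_def split_beta')
  have \<kappa>: "0 < ?\<kappa>" using s p by (intro add_pos_nonneg) auto
  note gi = powr_norm_coord_le[OF i]
  show gii: "integrable lborel (\<lambda>x. norm (g x) powr (p - 2) * (g x \<bullet> i)\<^sup>2)"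
    by (rule Bochner_Integration.integrable_bound[OF g(2)]) (use gi in auto)
  define e where "e n = inverse (real (Suc n))" for n
  have e: "0 < e n" for n by (simp add: e_def)
  define om where "om n a b = sin (e n * a) / e n - sin (e n * b) / e n" for n a b
  have om_le: "\<bar>om n a b\<bar> \<le> \<bar>a - b\<bar>" for n a b
    unfolding om_def by (rule sin_scaled_diff_le[OF e])
  show "integrable (lborel \<Otimes>\<^sub>M lborel) (\<lambda>z. gagliardo_integrand s p u z * (((fst z - snd z) \<bullet> i)\<^sup>2 / (norm (fst z - snd z))\<^sup>2))"
    unfolding K_def[symmetric]
  proof (rule Bochner_Integration.integrable_bound[OF Kint])
    have "(\<lambda>z. K z * (((fst z - snd z) \<bullet> i)\<^sup>2 / (norm (fst z - snd z))\<^sup>2)) \<in> borel_measurable (borel \<Otimes>\<^sub>M borel)" by measurable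
    then show "(\<lambda>z. K z * (((fst z - snd z) \<bullet> i)\<^sup>2 / (norm (fst z - snd z))\<^sup>2)) \<in> borel_measurable (lborel \<Otimes>\<^sub>M lborel)" by simp
    show "AE z in lborel \<Otimes>\<^sub>M lborel. norm (K z * (((fst z - snd z) \<bullet> i)\<^sup>2 / (norm (fst z - snd z))\<^sup>2)) \<le> norm (K z)"
    proof (rule AE_I2)
      fix z :: "'a \<times> 'a"
      have "\<bar>((fst z - snd z) \<bullet> i)\<^sup>2 / (norm (fst z - snd z))\<^sup>2\<bar> \<le> 1"
        using inner_ratio_le_1[OF i, of "(fst z - snd z) \<bullet> i" "fst z - snd z"] by (simp add: power2_eq_square)
      then show "norm (K z * (((fst z - snd z) \<bullet> i)\<^sup>2 / (norm (fst z - snd z))\<^sup>2)) \<le> norm (K z)"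
        unfolding real_norm_def abs_mult by (intro mult_left_le) auto
    qed
  qed
  have limC: "(\<lambda>n. \<integral>x. cos (e n * (x \<bullet> i)) * \<bar>u x\<bar> powr ?q \<partial>lborel) \<longlonglongrightarrow> (\<integral>x. 1 * \<bar>u x\<bar> powr ?q \<partial>lborel)"
  proof (rule integral_dominated_convergence[where w = "\<lambda>x. \<bar>u x\<bar> powr ?q"])
    show "AE x in lborel. (\<lambda>n. cos (e n * (x \<bullet> i)) * \<bar>u x\<bar> powr ?q) \<longlonglongrightarrow> 1 * \<bar>u x\<bar> powr ?q"
      unfolding e_def by (intro AE_I2 tendsto_intros cos_scaled_tendsto)
  qed (use uq in \<open>auto simp: abs_mult mult_left_le_one_le\<close>)
  have limA: "(\<lambda>n. \<integral>x. cos (e n * (x \<bullet> i)) * (p * (norm (g x) powr (p - 2) * (g x \<bullet> i)\<^sup>2) - norm (g x) powr p) \<partial>lborel)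
     \<longlonglongrightarrow> (\<integral>x. 1 * (p * (norm (g x) powr (p - 2) * (g x \<bullet> i)\<^sup>2) - norm (g x) powr p) \<partial>lborel)"
  proof (rule integral_dominated_convergence[where w = "\<lambda>x. \<bar>p * (norm (g x) powr (p - 2) * (g x \<bullet> i)\<^sup>2) - norm (g x) powr p\<bar>"])
    show "AE x in lborel. (\<lambda>n. cos (e n * (x \<bullet> i)) * (p * (norm (g x) powr (p - 2) * (g x \<bullet> i)\<^sup>2) - norm (g x) powr p))
        \<longlonglongrightarrow> 1 * (p * (norm (g x) powr (p - 2) * (g x \<bullet> i)\<^sup>2) - norm (g x) powr p)"
      unfolding e_def by (intro AE_I2 tendsto_intros cos_scaled_tendsto)
    show "integrable lborel (\<lambda>x. \<bar>p * (norm (g x) powr (p - 2) * (g x \<bullet> i)\<^sup>2) - norm (g x) powr p\<bar>)"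
      using gii g(2) by auto
    show "AE x in lborel. norm (cos (e n * (x \<bullet> i)) * (p * (norm (g x) powr (p - 2) * (g x \<bullet> i)\<^sup>2) - norm (g x) powr p))
        \<le> \<bar>p * (norm (g x) powr (p - 2) * (g x \<bullet> i)\<^sup>2) - norm (g x) powr p\<bar>" for n
      unfolding real_norm_def abs_mult by (intro AE_I2 mult_left_le_one_le) auto
  qed auto
  have limB: "(\<lambda>n. \<integral>z. K z * (?\<kappa> * (((fst z - snd z) \<bullet> i) * om n (fst z \<bullet> i) (snd z \<bullet> i) / (norm (fst z - snd z))\<^sup>2)
             - cos (e n * (fst z \<bullet> i)) - cos (e n * (snd z \<bullet> i))) \<partial>(lborel \<Otimes>\<^sub>M lborel))
     \<longlonglongrightarrow> (\<integral>z. K z * (?\<kappa> * (((fst z - snd z) \<bullet> i) * ((fst z \<bullet> i) - (snd z \<bullet> i)) / (norm (fst z - snd z))\<^sup>2)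
             - 1 - 1) \<partial>(lborel \<Otimes>\<^sub>M lborel))"
  proof (rule integral_dominated_convergence[where w = "\<lambda>z. (?\<kappa> + 2) * K z"])
    have "(\<lambda>z. K z * (?\<kappa> * (((fst z - snd z) \<bullet> i) * ((fst z \<bullet> i) - (snd z \<bullet> i)) / (norm (fst z - snd z))\<^sup>2)
             - 1 - 1)) \<in> borel_measurable (borel \<Otimes>\<^sub>M borel)" by measurable
    then show "(\<lambda>z. K z * (?\<kappa> * (((fst z - snd z) \<bullet> i) * ((fst z \<bullet> i) - (snd z \<bullet> i)) / (norm (fst z - snd z))\<^sup>2)
             - 1 - 1)) \<in> borel_measurable (lborel \<Otimes>\<^sub>M lborel)" by simp
    have "(\<lambda>z. K z * (?\<kappa> * (((fst z - snd z) \<bullet> i) * om n (fst z \<bullet> i) (snd z \<bullet> i) / (norm (fst z - snd z))\<^sup>2)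
             - cos (e n * (fst z \<bullet> i)) - cos (e n * (snd z \<bullet> i)))) \<in> borel_measurable (borel \<Otimes>\<^sub>M borel)" for n
      unfolding om_def by measurable
    then show "(\<lambda>z. K z * (?\<kappa> * (((fst z - snd z) \<bullet> i) * om n (fst z \<bullet> i) (snd z \<bullet> i) / (norm (fst z - snd z))\<^sup>2)
             - cos (e n * (fst z \<bullet> i)) - cos (e n * (snd z \<bullet> i)))) \<in> borel_measurable (lborel \<Otimes>\<^sub>M lborel)" for n by simp
    show "integrable (lborel \<Otimes>\<^sub>M lborel) (\<lambda>z. (?\<kappa> + 2) * K z)" using Kint by simp
    show "AE z in lborel \<Otimes>\<^sub>M lborel. (\<lambda>n. K z * (?\<kappa> * (((fst z - snd z) \<bullet> i) * om n (fst z \<bullet> i) (snd z \<bullet> i) / (norm (fst z - snd z))\<^sup>2)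
             - cos (e n * (fst z \<bullet> i)) - cos (e n * (snd z \<bullet> i))))
        \<longlonglongrightarrow> K z * (?\<kappa> * (((fst z - snd z) \<bullet> i) * ((fst z \<bullet> i) - (snd z \<bullet> i)) / (norm (fst z - snd z))\<^sup>2) - 1 - 1)"
      \<comment> \<open>The denominator becomes a constant factor: on the diagonal it is 0, where a
        limit rule for quotients would not apply.\<close>
      unfolding om_def e_def divide_inverse[of _ "(norm _)\<^sup>2"]
      by (intro AE_I2 tendsto_intros cos_scaled_tendsto sin_scaled_tendsto)
    show "AE z in lborel \<Otimes>\<^sub>M lborel. norm (K z * (?\<kappa> * (((fst z - snd z) \<bullet> i) * om n (fst z \<bullet> i) (snd z \<bullet> i) / (norm (fst z - snd z))\<^sup>2)
             - cos (e n * (fst z \<bullet> i)) - cos (e n * (snd z \<bullet> i)))) \<le> (?\<kappa> + 2) * K z" for n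
    proof (rule AE_I2)
      fix z :: "'a \<times> 'a"
      let ?f = "((fst z - snd z) \<bullet> i) * om n (fst z \<bullet> i) (snd z \<bullet> i) / (norm (fst z - snd z))\<^sup>2"
      have "\<bar>?f\<bar> \<le> 1" using om_le[of n "fst z \<bullet> i" "snd z \<bullet> i"] by (intro inner_ratio_le_1[OF i]) (simp add: inner_diff_left)
      then have "\<bar>?\<kappa> * ?f\<bar> \<le> ?\<kappa> * 1"
        unfolding abs_mult[of ?\<kappa>] using \<kappa> by (intro mult_mono) auto
      then have "\<bar>?\<kappa> * ?f - cos (e n * (fst z \<bullet> i)) - cos (e n * (snd z \<bullet> i))\<bar> \<le> ?\<kappa> + 2"
      proof -
        have "\<bar>a - b - b'\<bar> \<le> k + 2" if "\<bar>a\<bar> \<le> k * 1" "\<bar>b\<bar> \<le> 1" "\<bar>b'\<bar> \<le> 1" for a b b' k :: real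
          using that by linarith
        then show ?thesis using \<open>\<bar>?\<kappa> * ?f\<bar> \<le> ?\<kappa> * 1\<close> abs_cos_le_one by blast
      qed
      then have "K z * \<bar>?\<kappa> * ?f - cos (e n * (fst z \<bullet> i)) - cos (e n * (snd z \<bullet> i))\<bar> \<le> K z * (?\<kappa> + 2)"
        using K0 by (rule mult_left_mono)
      then show "norm (K z * (?\<kappa> * ?f - cos (e n * (fst z \<bullet> i)) - cos (e n * (snd z \<bullet> i)))) \<le> (?\<kappa> + 2) * K z"
        unfolding real_norm_def abs_mult[of "K z"] using K0[of z] by (simp only: abs_of_nonneg mult.commute)
    qed
  qed
  have le: "- (1 / ?q) * (\<integral>x. 1 * \<bar>u x\<bar> powr ?q \<partial>lborel)
    \<le> 1 / p * ((\<integral>x. 1 * (p * (norm (g x) powr (p - 2) * (g x \<bullet> i)\<^sup>2) - norm (g x) powr p) \<partial>lborel)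
      + (\<integral>z. K z * (?\<kappa> * (((fst z - snd z) \<bullet> i) * ((fst z \<bullet> i) - (snd z \<bullet> i)) / (norm (fst z - snd z))\<^sup>2)
             - 1 - 1) \<partial>(lborel \<Otimes>\<^sub>M lborel)))"
  proof (rule LIMSEQ_le)
    show "(\<lambda>n. - (1 / ?q) * (\<integral>x. cos (e n * (x \<bullet> i)) * \<bar>u x\<bar> powr ?q \<partial>lborel)) \<longlonglongrightarrow> - (1 / ?q) * (\<integral>x. 1 * \<bar>u x\<bar> powr ?q \<partial>lborel)"
      by (intro tendsto_intros limC)
    show "(\<lambda>n. 1 / p * ((\<integral>x. cos (e n * (x \<bullet> i)) * (p * (norm (g x) powr (p - 2) * (g x \<bullet> i)\<^sup>2) - norm (g x) powr p) \<partial>lborel)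
        + (\<integral>z. K z * (?\<kappa> * (((fst z - snd z) \<bullet> i) * om n (fst z \<bullet> i) (snd z \<bullet> i) / (norm (fst z - snd z))\<^sup>2)
             - cos (e n * (fst z \<bullet> i)) - cos (e n * (snd z \<bullet> i))) \<partial>(lborel \<Otimes>\<^sub>M lborel))))
      \<longlonglongrightarrow> 1 / p * ((\<integral>x. 1 * (p * (norm (g x) powr (p - 2) * (g x \<bullet> i)\<^sup>2) - norm (g x) powr p) \<partial>lborel)
      + (\<integral>z. K z * (?\<kappa> * (((fst z - snd z) \<bullet> i) * ((fst z \<bullet> i) - (snd z \<bullet> i)) / (norm (fst z - snd z))\<^sup>2)
             - 1 - 1) \<partial>(lborel \<Otimes>\<^sub>M lborel)))"
      by (intro tendsto_mult tendsto_const tendsto_add limA limB)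
  qed (use directional_inequality[OF sol p s g i e] in \<open>auto simp: om_def K_def\<close>)
  then show "- (1 / ?q) * (\<integral>x. \<bar>u x\<bar> powr ?q \<partial>lborel)
    \<le> 1 / p * ((\<integral>x. (p * (norm (g x) powr (p - 2) * (g x \<bullet> i)\<^sup>2) - norm (g x) powr p) \<partial>lborel)
        + (\<integral>z. gagliardo_integrand s p u z * (?\<kappa> *
             (((fst z - snd z) \<bullet> i)\<^sup>2 / (norm (fst z - snd z))\<^sup>2) - 2) \<partial>(lborel \<Otimes>\<^sub>M lborel)))"
    unfolding K_def[symmetric] by (simp add: inner_diff_left[symmetric] power2_eq_square)
qed

text \<open>Summation over the basis: the squared components of the gradient add up to its squared
  norm, those of the normalised difference x - y to 1. Terms without a component are counted N
  times, and N / q = (N - p) / p brings the critical term to the scale of the gradient term.\<close>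

lemma pohozaev_inequality:
  fixes u :: "'a::euclidean_space \<Rightarrow> real"
  assumes sol: "weak_solution s p u" and p: "1 < p" "p < real DIM('a)" and s: "0 \<le> s"
    and g: "weak_gradient u g" "integrable lborel (\<lambda>x. norm (g x) powr p)"
  defines "a0 \<equiv> (\<integral>x. norm (g x) powr p \<partial>lborel)"
    and "b0 \<equiv> integral\<^sup>L (lborel \<Otimes>\<^sub>M lborel) (gagliardo_integrand s p u)"
  shows "- ((real DIM('a) - p) * (a0 + b0)) \<le> - ((real DIM('a) - p) * a0) - (real DIM('a) - s * p) * b0"
proof -
  let ?q = "crit_exp TYPE('a) p" and ?N = "real DIM('a)" and ?\<kappa> = "real DIM('a) + s * p"
  note q = crit_exp_facts[where 'a='a, OF p]
  define K where "K = gagliardo_integrand s p u"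
  have uW: "u \<in> W_space s p" using sol by (simp add: weak_solution_def)
  then have Kint: "integrable (lborel \<Otimes>\<^sub>M lborel) K" by (auto simp: W_space_def K_def)
  note P = pohozaev_directional[OF sol p s g, folded K_def]
  have E: "(\<integral>x. \<bar>u x\<bar> powr ?q \<partial>lborel) = a0 + b0"
    using weak_solution_energy_identity[OF sol g(1)] by (simp add: a0_def b0_def)
  let ?A = "\<lambda>i. \<integral>x. norm (g x) powr (p - 2) * (g x \<bullet> i)\<^sup>2 \<partial>lborel"
  let ?B = "\<lambda>i. \<integral>z. K z * (((fst z - snd z) \<bullet> i)\<^sup>2 / (norm (fst z - snd z))\<^sup>2) \<partial>(lborel \<Otimes>\<^sub>M lborel)"
  have dir: "- (1 / ?q) * (a0 + b0) \<le> 1 / p * ((p * ?A i - a0) + (?\<kappa> * ?B i - 2 * b0))" if i: "i \<in> Basis" for i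
  proof -
    have "(\<integral>x. (p * (norm (g x) powr (p - 2) * (g x \<bullet> i)\<^sup>2) - norm (g x) powr p) \<partial>lborel) = p * ?A i - a0"
      using P(2)[OF i] g(2) by (simp add: a0_def)
    moreover have "(\<integral>z. K z * (?\<kappa> * (((fst z - snd z) \<bullet> i)\<^sup>2 / (norm (fst z - snd z))\<^sup>2) - 2) \<partial>(lborel \<Otimes>\<^sub>M lborel)) = ?\<kappa> * ?B i - 2 * b0"
    proof -
      define F where "F z = K z * (((fst z - snd z) \<bullet> i)\<^sup>2 / (norm (fst z - snd z))\<^sup>2)" for z
      have "K z * (?\<kappa> * (((fst z - snd z) \<bullet> i)\<^sup>2 / (norm (fst z - snd z))\<^sup>2) - 2) = ?\<kappa> * F z - 2 * K z" for z
        by (simp only: F_def right_diff_distrib mult.left_commute mult.commute[of "K z" 2])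
      moreover have "integrable (lborel \<Otimes>\<^sub>M lborel) F" unfolding F_def[abs_def] by (rule P(3)[OF i])
      ultimately show ?thesis using Kint unfolding F_def[symmetric] b0_def K_def[symmetric] by simp
    qed
    ultimately show ?thesis using P(1)[OF i] E by simp
  qed
  have sumA: "(\<Sum>i\<in>Basis. ?A i) = a0"
  proof -
    have "(\<Sum>i\<in>Basis. norm (g x) powr (p - 2) * (g x \<bullet> i)\<^sup>2) = norm (g x) powr p" for x
    proof -
      have "(\<Sum>i\<in>Basis. (g x \<bullet> i)\<^sup>2) = g x \<bullet> g x" by (subst euclidean_inner) (simp add: power2_eq_square)
      then show ?thesis by (simp add: sum_distrib_left[symmetric] powr_norm_self)
    qed
    then show ?thesis using P(2) unfolding a0_def by (subst Bochner_Integration.integral_sum[symmetric]) auto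
  qed
  have sumB: "(\<Sum>i\<in>Basis. ?B i) = b0"
  proof -
    have "(\<Sum>i\<in>Basis. K z * (((fst z - snd z) \<bullet> i)\<^sup>2 / (norm (fst z - snd z))\<^sup>2)) = K z" for z :: "'a \<times> 'a"
    proof (cases "fst z = snd z")
      \<comment> \<open>On the diagonal the ratios add up to 0 by convention instead of 1, but there
        \<open>K\<close> is 0 too.\<close>
      case True
      then show ?thesis using p by (simp add: K_def gagliardo_integrand_def split_beta')
    next
      case False
      have "(\<Sum>i\<in>Basis. ((fst z - snd z) \<bullet> i)\<^sup>2) = (norm (fst z - snd z))\<^sup>2"
        unfolding power2_norm_eq_inner by (subst euclidean_inner) (simp add: power2_eq_square)
      then have "(\<Sum>i\<in>Basis. ((fst z - snd z) \<bullet> i)\<^sup>2 / (norm (fst z - snd z))\<^sup>2) = 1"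
        using False by (simp add: sum_divide_distrib[symmetric])
      then show ?thesis by (simp only: sum_distrib_left[symmetric] mult_1_right)
    qed
    then show ?thesis using P(3) unfolding b0_def K_def[symmetric] by (subst Bochner_Integration.integral_sum[symmetric]) auto
  qed
  have "(\<Sum>i\<in>(Basis::'a set). - (1 / ?q) * (a0 + b0)) \<le> (\<Sum>i\<in>(Basis::'a set). 1 / p * ((p * ?A i - a0) + (?\<kappa> * ?B i - 2 * b0)))"
    by (intro sum_mono dir)
  also have "\<dots> = 1 / p * (p * (\<Sum>i\<in>Basis. ?A i) - ?N * a0 + (?\<kappa> * (\<Sum>i\<in>Basis. ?B i) - ?N * (2 * b0)))"
    by (simp only: sum_distrib_left[symmetric] sum.distrib sum_subtractf sum_constant mult.assoc[symmetric]) (simp only: mult_ac)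
  also have "\<dots> = 1 / p * (p * a0 - ?N * a0 + (?\<kappa> * b0 - ?N * (2 * b0)))" unfolding sumA sumB ..
  finally have "- (?N / ?q * (a0 + b0)) \<le> 1 / p * (p * a0 - ?N * a0 + (?\<kappa> * b0 - ?N * (2 * b0)))" by simp
  then have "p * - ((?N - p) / p * (a0 + b0)) \<le> p * (1 / p * (p * a0 - ?N * a0 + (?\<kappa> * b0 - ?N * (2 * b0))))"
    unfolding q(4) using p by (intro mult_left_mono) auto
  moreover have "p * - ((?N - p) / p * (a0 + b0)) = - ((?N - p) * (a0 + b0))" using p by simp
  \<comment> \<open>Uses \<kappa> - 2 N = -(N - s p).\<close>
  moreover have "p * (1 / p * (p * a0 - ?N * a0 + (?\<kappa> * b0 - ?N * (2 * b0)))) = - ((?N - p) * a0) - (?N - s * p) * b0"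
    using p by (simp add: algebra_simps)
  ultimately show ?thesis by simp
qed

section \<open>Vanishing seminorm and conclusion\<close>

text \<open>A vanishing integrand means u x = u y for almost every pair, so by Fubini one value is
  taken almost everywhere. The whole space has infinite measure, so a constant in L^q is 0.\<close>

lemma gagliardo_zero_imp_AE_zero:
  fixes u :: "'a::euclidean_space \<Rightarrow> real"
  assumes u: "u \<in> W_space s p" and 0: "integral\<^sup>L (lborel \<Otimes>\<^sub>M lborel) (gagliardo_integrand s p u) = 0"
  shows "AE x in lborel. u x = 0"
proof -
  let ?q = "crit_exp TYPE('a) p"
  have Kint: "integrable (lborel \<Otimes>\<^sub>M lborel) (gagliardo_integrand s p u)"
    and uq: "integrable lborel (\<lambda>x. \<bar>u x\<bar> powr ?q)" using u by (auto simp: W_space_def in_Lp_def)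
  have "AE z in lborel \<Otimes>\<^sub>M lborel. gagliardo_integrand s p u z = 0"
    using integral_nonneg_eq_0_iff_AE[OF Kint] 0 by (auto simp: gagliardo_integrand_def split_beta')
  then have "AE z in lborel \<Otimes>\<^sub>M lborel. u (fst z) = u (snd z)"
    by eventually_elim (auto simp: gagliardo_integrand_def split_beta')
  from lborel_pair.AE_pair[OF this] have "AE x in lborel. AE y in lborel. u x = u y" by simp
  then obtain x where x: "AE y in lborel. u x = u y"
    using eventually_happens'[of "ae_filter (lborel :: 'a measure)"] by (auto simp: ae_filter_eq_bot_iff)
  have um: "u \<in> borel_measurable lborel" using u by (simp add: W_space_def in_Lp_def)
  have "integrable lborel (\<lambda>y::'a. \<bar>u x\<bar> powr ?q)"
    by (rule integrable_cong_AE_imp[OF uq]) (use x in \<open>auto elim!: eventually_mono\<close>)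
  then have "\<bar>u x\<bar> powr ?q = 0" by (auto simp: integrable_iff_bounded ennreal_mult_less_top)
  then have "u x = 0" by simp
  with x show ?thesis by (auto elim!: eventually_mono)
qed

theorem theorem1p4:
  fixes p s :: real
  assumes "1 < p" and "0 < s" and "s < 1" and "p < real DIM('a::euclidean_space)"
  shows "\<not> (\<exists>u :: 'a \<Rightarrow> real. weak_solution s p u \<and> in_Lp p u \<and>
              \<not> (AE x in lborel. u x = 0))"
proof
  assume "\<exists>u :: 'a \<Rightarrow> real. weak_solution s p u \<and> in_Lp p u \<and> \<not> (AE x in lborel. u x = 0)"
  then obtain u :: "'a \<Rightarrow> real" where sol: "weak_solution s p u" and nz: "\<not> (AE x in lborel. u x = 0)" by blast
  have uW: "u \<in> W_space s p" using sol by (simp add: weak_solution_def)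
  then obtain g where g: "weak_gradient u g" "integrable lborel (\<lambda>x. norm (g x) powr p)" by (auto simp: W_space_def)
  define b0 where "b0 = integral\<^sup>L (lborel \<Otimes>\<^sub>M lborel) (gagliardo_integrand s p u)"
  have b0: "0 \<le> b0" unfolding b0_def by (intro integral_nonneg_AE) (auto simp: gagliardo_integrand_def split_beta')
  have s0: "0 \<le> s" using assms by simp
  \<comment> \<open>The gradient terms cancel, and (N - s p) - (N - p) = (1 - s) p is
    positive.\<close>
  have "(1 - s) * p * b0 \<le> 0"
    using pohozaev_inequality[OF sol assms(1,4) s0 g, folded b0_def] by (simp add: algebra_simps)
  then have "b0 = 0" using b0 assms by (simp add: mult_le_0_iff)
  then show False using gagliardo_zero_imp_AE_zero[OF uW] nz by (simp add: b0_def)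
qed

end
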